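(* Let $d\in\{2,3\}$, let $I=(a,b)\subset\mathbb{R}$ be a bounded interval and $Q=I^d$. Suppose there exist constants $C_p,C_{N_{1d}},C_v,C_c,b_v>0$ and, for $0<\epsilon\le1$, suppose there exist $p,N_{1d},N_{int}\in\mathbb{N}$ and $c\in\mathbb{R}^{N_{1d}\times\dots\times N_{1d}}$ ($d$ factors) such that $N_{1d}\le C_{N_{1d}}(1+|\log\epsilon|^2)$, $\|c\|_1\le C_c(1+|\log\epsilon|^{2d})$, $p\le C_p(1+|\log\epsilon|)$. Further let $\mathcal{G}_{1d}$ be a partition of $I$ into $N_{int}$ open, disjoint, connected subintervals and, for all $i\in\{1,\dots,N_{1d}\}$, let $v_i\in\mathbb{Q}_p(\mathcal{G}_{1d})\cap H^1(I)$ be such that $\mathrm{supp}(v_i)$ intersects either a single interval or two neighboring subintervals of $\mathcal{G}_{1d}$ and $\|v_i\|_{H^1(I)}\le C_v\epsilon^{-b_v}$, $\|v_i\|_{L^\infty(I)}\le1$. Then there exists a ReLU neural network $\Phi_{\epsilon,c}$ with $d$-dimensional input and one-dimensional output such that $\big\|\sum_{i_1,\dots,i_d=1}^{N_{1d}}c_{i_1\dots i_d}\bigotimes_{j=1}^dv_{i_j}-\mathrm{R}(\Phi_{\epsilon,c})\big\|_{H^1(Q)}\le\epsilon$. Furthermore $\|\mathrm{R}(\Phi_{\epsilon,c})\|_{L^\infty(Q)}\le(2^d+1)C_c(1+|\log\epsilon|^{2d})$, $\mathrm{size}(\Phi_{\epsilon,c})\le C(1+|\log\epsilon|^{2d+1})$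 and $\mathrm{depth}(\Phi_{\epsilon,c})\le C(1+|\log\epsilon|\log(|\log\epsilon|))$, where $C>0$ depends only on $C_p,C_{N_{1d}},C_v,C_c,b_v,d$ and $b-a$.
   Context: $\mathbb{Q}_p(\mathcal{G})$ denotes functions that are polynomials of degree at most $p$ on each interval of the partition $\mathcal{G}$; $(\bigotimes_{j=1}^dv_{i_j})(x_1,\dots,x_d)=\prod_jv_{i_j}(x_j)$; $\|c\|_1$ is the sum of absolute values of the entries. A neural network (NN) $\Phi$ with input dimension $d$ and $L$ layers is a sequence $((A_1,b_1),\dots,(A_L,b_L))$ with $A_\ell\in\mathbb{R}^{N_\ell\times N_{\ell-1}}$, $b_\ell\in\mathbb{R}^{N_\ell}$, $N_0=d$. Its realization $\mathrm{R}(\Phi):\mathbb{R}^d\to\mathbb{R}^{N_L}$ is $x\mapsto x_L$, where $x_0=x$, $x_\ell=\varrho(A_\ell x_{\ell-1}+b_\ell)$ for $\ell<L$, $x_L=A_Lx_{L-1}+b_L$, with $\varrho(t)=\max\{0,t\}$ componentwise. $\mathrm{depth}(\Phi)=L$, $\mathrm{size}(\Phi)=\sum_\ell(\|A_\ell\|_0+\|b_\ell\|_0)$ (number of nonzero entries). *)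

theory Defs
  imports "HOL-Analysis.Analysis" "HOL-Computational_Algebra.Polynomial"
begin

fun Ck :: "nat \<Rightarrow> ('a::euclidean_space \<Rightarrow> real) \<Rightarrow> bool" where
  "Ck 0 f = continuous_on UNIV f"
| "Ck (Suc k) f = ((\<forall>x. f differentiable (at x)) \<and>
      (\<forall>i\<in>Basis. Ck k (\<lambda>x. frechet_derivative f (at x) i)))"

definition smooth_fun :: "('a::euclidean_space \<Rightarrow> real) \<Rightarrow> bool" where
  "smooth_fun f \<longleftrightarrow> (\<forall>k. Ck k f)"

definition tsupport :: "('a::euclidean_space \<Rightarrow> real) \<Rightarrow> 'a set" where
  "tsupport f = closure {x. f x \<noteq> 0}"

definition test_fun :: "'a::euclidean_space set \<Rightarrow> ('a \<Rightarrow> real) \<Rightarrow> bool" where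
  "test_fun S \<phi> \<longleftrightarrow> smooth_fun \<phi> \<and> compact (tsupport \<phi>) \<and> tsupport \<phi> \<subseteq> S"

definition weak_partial :: "'a::euclidean_space set \<Rightarrow> ('a \<Rightarrow> real) \<Rightarrow> 'a \<Rightarrow> ('a \<Rightarrow> real) \<Rightarrow> bool" where
  "weak_partial S u i g \<longleftrightarrow>
     (\<forall>\<phi>. test_fun S \<phi> \<longrightarrow>
        (LINT x:S|lebesgue. u x * frechet_derivative \<phi> (at x) i) = - (LINT x:S|lebesgue. g x * \<phi> x))"

definition sq_int :: "'a::euclidean_space set \<Rightarrow> ('a \<Rightarrow> real) \<Rightarrow> bool" where
  "sq_int S f \<longleftrightarrow> (\<lambda>x. indicator S x * f x) \<in> borel_measurable lebesgue \<and>
                    set_integrable lebesgue S (\<lambda>x. (f x)^2)"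

definition L2_norm_on :: "'a::euclidean_space set \<Rightarrow> ('a \<Rightarrow> real) \<Rightarrow> real" where
  "L2_norm_on S f = sqrt (LINT x:S|lebesgue. (f x)^2)"

definition in_H1 :: "'a::euclidean_space set \<Rightarrow> ('a \<Rightarrow> real) \<Rightarrow> bool" where
  "in_H1 S u \<longleftrightarrow> sq_int S u \<and> (\<forall>i\<in>Basis. \<exists>g. sq_int S g \<and> weak_partial S u i g)"

definition H1_norm :: "'a::euclidean_space set \<Rightarrow> ('a \<Rightarrow> real) \<Rightarrow> real" where
  "H1_norm S u = sqrt ((L2_norm_on S u)^2 +
      (\<Sum>i\<in>Basis. (L2_norm_on S (SOME g. sq_int S g \<and> weak_partial S u i g))^2))"

definition Linf_le :: "'a::euclidean_space set \<Rightarrow> ('a \<Rightarrow> real) \<Rightarrow> real \<Rightarrow> bool" where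
  "Linf_le S u M \<longleftrightarrow> (AE x in lebesgue. x \<in> S \<longrightarrow> \<bar>u x\<bar> \<le> M)"

definition piecewise_poly :: "nat \<Rightarrow> real set set \<Rightarrow> (real \<Rightarrow> real) \<Rightarrow> bool" where
  "piecewise_poly p G v \<longleftrightarrow>
     (\<forall>J\<in>G. \<exists>q::real poly. degree q \<le> p \<and> (\<forall>x\<in>J. v x = poly q x))"

definition interval_partition :: "real \<Rightarrow> real \<Rightarrow> nat \<Rightarrow> real set set \<Rightarrow> bool" where
  "interval_partition a b N G \<longleftrightarrow> finite G \<and> card G = N \<and>
     (\<forall>J\<in>G. \<exists>\<alpha> \<beta>. \<alpha> < \<beta> \<and> J = {\<alpha><..<\<beta>}) \<and>
     (\<forall>J1\<in>G. \<forall>J2\<in>G. J1 \<noteq> J2 \<longrightarrow> J1 \<inter> J2 = {}) \<and>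
     \<Union>G \<subseteq> {a<..<b} \<and> \<Union>(closure ` G) = {a..b}"

definition supp_on :: "real set \<Rightarrow> (real \<Rightarrow> real) \<Rightarrow> real set" where
  "supp_on I v = closure {x\<in>I. v x \<noteq> 0}"

definition local_support :: "real set \<Rightarrow> real set set \<Rightarrow> (real \<Rightarrow> real) \<Rightarrow> bool" where
  "local_support I G v \<longleftrightarrow>
     (let M = {J\<in>G. supp_on I v \<inter> J \<noteq> {}} in
       (\<exists>J. M = {J}) \<or>
       (\<exists>J1 J2. M = {J1, J2} \<and> J1 \<noteq> J2 \<and> closure J1 \<inter> closure J2 \<noteq> {}))"

text \<open>Multi-indices (i_1,...,i_d) are functions from the coordinate set Basis to {1..N}.\<close>
definition tensor_sum :: "nat \<Rightarrow> (('a::euclidean_space \<Rightarrow> nat) \<Rightarrow> real) \<Rightarrow> (nat \<Rightarrow> real \<Rightarrow> real) \<Rightarrow> 'a \<Rightarrow> real" where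
  "tensor_sum N c v x = (\<Sum>\<kappa>\<in>(Basis::'a set) \<rightarrow>\<^sub>E {1..N}. c \<kappa> * (\<Prod>j\<in>Basis. v (\<kappa> j) (x \<bullet> j)))"

definition coeff_l1 :: "nat \<Rightarrow> (('a::euclidean_space \<Rightarrow> nat) \<Rightarrow> real) \<Rightarrow> real" where
  "coeff_l1 N c = (\<Sum>\<kappa>\<in>(Basis::'a set) \<rightarrow>\<^sub>E {1..N}. \<bar>c \<kappa>\<bar>)"

text \<open>A layer is (N_l, N_{l-1}, A_l, b_l), entries A i j for i < N_l, j < N_{l-1}.\<close>
type_synonym layer = "nat \<times> nat \<times> (nat \<Rightarrow> nat \<Rightarrow> real) \<times> (nat \<Rightarrow> real)"
type_synonym nn = "layer list"

definition affine :: "layer \<Rightarrow> (nat \<Rightarrow> real) \<Rightarrow> (nat \<Rightarrow> real)" where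
  "affine l x = (case l of (m, n, A, b) \<Rightarrow> (\<lambda>i. (\<Sum>j<n. A i j * x j) + b i))"

fun nn_eval :: "nn \<Rightarrow> (nat \<Rightarrow> real) \<Rightarrow> (nat \<Rightarrow> real)" where
  "nn_eval [] x = x"
| "nn_eval [l] x = affine l x"
| "nn_eval (l # l' # L) x = nn_eval (l' # L) (\<lambda>i. max 0 (affine l x i))"

definition nn_wf :: "nat \<Rightarrow> nat \<Rightarrow> nn \<Rightarrow> bool" where
  "nn_wf din dout \<Phi> \<longleftrightarrow> \<Phi> \<noteq> [] \<and> fst (snd (hd \<Phi>)) = din \<and> fst (last \<Phi>) = dout \<and>
     (\<forall>k. Suc k < length \<Phi> \<longrightarrow> fst (snd (\<Phi> ! Suc k)) = fst (\<Phi> ! k))"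

definition nn_depth :: "nn \<Rightarrow> nat" where
  "nn_depth \<Phi> = length \<Phi>"

definition layer_size :: "layer \<Rightarrow> nat" where
  "layer_size l = (case l of (m, n, A, b) \<Rightarrow>
      card {(i, j). i < m \<and> j < n \<and> A i j \<noteq> 0} + card {i. i < m \<and> b i \<noteq> 0})"

definition nn_size :: "nn \<Rightarrow> nat" where
  "nn_size \<Phi> = (\<Sum>l\<leftarrow>\<Phi>. layer_size l)"

text \<open>A fixed enumeration of the coordinates of 'a, identifying 'a with R^d.\<close>
definition coord_enum :: "nat \<Rightarrow> 'a::euclidean_space" where
  "coord_enum = (SOME e. bij_betw e {..<DIM('a)} Basis)"

definition realize :: "nn \<Rightarrow> 'a::euclidean_space \<Rightarrow> real" where
  "realize \<Phi> x = nn_eval \<Phi> (\<lambda>j. if j < DIM('a) then x \<bullet> (coord_enum j :: 'a) else 0) 0"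

end

theory Submission
  imports Defs
begin

text \<open>
  Each v_i is an H1 function that is polynomial on the intervals of the partition and lives on at
  most two of them. Comparing it with the sum U of its pieces composed with clamps to these
  intervals, v_i - U has vanishing weak derivative, so v_i is a constant plus a sum of polynomials
  of clamped, rescaled arguments. Writing these polynomials in the Lagrange basis at equispaced
  nodes, every term is a product of linear factors, with weights at most (2e)^n times the increment
  of v_i; the latter is at most |J|^(1/2) times the H1 norm, which compensates the rescaling by
  1/|J| however short the interval J is.

  All products (of linear factors, and of the d univariate factors) are computed by binary trees of
  approximate multiplications, obtained from the sawtooth approximation of the square by
  polarization. On [-1,1] the tree maps into [-1,1] and its error has Lipschitz constant
  4^k / 2^m for 2^k factors and m sawtooth terms; hence errors of derivatives never need derivatives
  of networks, only Lipschitz constants, and m is proportional to 1 + |ln eps|. Binary trees of depth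
  log n give the factor log |ln eps| in the depth.

  ReLU networks and continuous piecewise polynomials have one-sided directional derivatives
  everywhere, and these are the weak derivatives of Lipschitz functions.
\<close>

section \<open>Approximate products\<close>

text \<open>The intervals of the partition may be arbitrarily short, so the Lipschitz constants of
  the functions involved are not bounded in terms of the data. They enter only qualitatively, to
  provide weak derivatives; the quantitative estimates bound increments by increments of clamps
  weighted with sqrt |J|. With t = |ln eps|, the factors (2e)^n and eps^(-b_v) are at most exp of a
  constant times 1 + t, so 2^(-m) with m proportional to 1 + t beats them. The univariate networks
  are computed once per function and coordinate and shared by all N^d products. They cost about N
  n^2 m, of order t^5, which the order t^(2d+1) of the products covers because d >= 2. Network
  values may exceed 1 slightly, so each univariate factor is halved before it enters a tree and 2^d
  is put back in the output weights; this gives the sup bound 2^d times the l1 norm of c. The values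
  of v_i at partition points are arbitrary, so the error is only almost everywhere equal to a
  Lipschitz function, and it is this function that is estimated.\<close>

definition relu :: "real \<Rightarrow> real" where
  "relu t = max 0 t"

definition tent :: "real \<Rightarrow> real" where
  "tent y = 2 * relu y - 4 * relu (y - 1/2)"

text \<open>On [0,1] this is the partial sum of z^2 = z - (sum over k >= 1 of the k-th sawtooth
  divided by 4^k), that is, the piecewise linear interpolant of the square at the multiples of
  2^(-m).\<close>

primrec approx_sq :: "nat \<Rightarrow> real \<Rightarrow> real" where
  "approx_sq 0 z = z"
| "approx_sq (Suc m) z = approx_sq m z - (tent ^^ Suc m) z / 4 ^ Suc m"

text \<open>Polarization: xy is the difference of the squares of (x+y)/2 and (x-y)/2. The absolute
  values move these arguments into [0,1] when |x|, |y| <= 1.\<close>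

definition approx_mul :: "nat \<Rightarrow> real \<Rightarrow> real \<Rightarrow> real" where
  "approx_mul m x y = approx_sq m (\<bar>x + y\<bar> / 2) - approx_sq m (\<bar>x - y\<bar> / 2)"

primrec prod_tree :: "nat \<Rightarrow> nat \<Rightarrow> (nat \<Rightarrow> real) \<Rightarrow> real" where
  "prod_tree m 0 a = a 0"
| "prod_tree m (Suc k) a = approx_mul m (prod_tree m k a) (prod_tree m k (\<lambda>i. a (i + 2 ^ k)))"

lemma tent_range: "tent y \<in> {0..1}" if "y \<in> {0..1}"
  using that by (auto simp: tent_def relu_def max_def)

lemma tents_range: "(tent ^^ k) y \<in> {0..1}" if "y \<in> {0..1}"
proof (induction k)
  case (Suc k)
  then show ?case using tent_range[of "(tent ^^ k) y"] by simp
qed (use that in simp)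

lemma tent_lipschitz: "\<bar>tent x - tent y\<bar> \<le> 2 * \<bar>x - y\<bar>" if "x \<in> {0..1}" "y \<in> {0..1}"
  using that by (auto simp: tent_def relu_def max_def abs_if)

lemma tents_lipschitz:
  assumes "x \<in> {0..1}" "y \<in> {0..1}"
  shows "\<bar>(tent ^^ k) x - (tent ^^ k) y\<bar> \<le> 2 ^ k * \<bar>x - y\<bar>"
proof (induction k)
  case (Suc k)
  have "\<bar>(tent ^^ Suc k) x - (tent ^^ Suc k) y\<bar> \<le> 2 * \<bar>(tent ^^ k) x - (tent ^^ k) y\<bar>"
    using tent_lipschitz[OF tents_range tents_range] assms by simp
  then show ?case using Suc by simp
qed simp

text \<open>Iterating this self-similarity of the parabola gives the remainder of the sawtooth series.\<close>

lemma parabola_tent: "y - y\<^sup>2 = tent y / 4 + (tent y - (tent y)\<^sup>2) / 4" if "y \<in> {0..1}"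
proof (cases "y \<le> 1/2")
  case True
  then have "tent y = 2 * y" using that by (auto simp: tent_def relu_def max_def)
  then show ?thesis by (simp add: power2_eq_square field_simps)
next
  case False
  then have *: "tent y = 2 - 2 * y" using that by (auto simp: tent_def relu_def max_def)
  show ?thesis unfolding * by (simp add: power2_eq_square field_simps)
qed

lemma approx_sq_eq:
  assumes "z \<in> {0..1}"
  shows "approx_sq m z = z\<^sup>2 + ((tent ^^ m) z - ((tent ^^ m) z)\<^sup>2) / 4 ^ m"
proof (induction m)
  case (Suc m)
  define y where "y = (tent ^^ m) z"
  have y: "y \<in> {0..1}" using tents_range[OF assms] by (simp add: y_def)
  have "approx_sq (Suc m) z = z\<^sup>2 + (y - y\<^sup>2) / 4 ^ m - tent y / 4 ^ Suc m"
    using Suc by (simp add: y_def)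
  also have "\<dots> = z\<^sup>2 + (tent y - (tent y)\<^sup>2) / 4 ^ Suc m"
    unfolding parabola_tent[OF y] by (simp add: field_simps)
  finally show ?case by (simp add: y_def)
qed simp

text \<open>Only nonnegative terms are subtracted from z, and the remainder above z^2 is
  nonnegative. That the range is exactly [0,1], without slack, lets products be nested without
  rescaling between the levels of a tree.\<close>

lemma approx_sq_range: "approx_sq m z \<in> {0..1}" if "z \<in> {0..1}"
proof -
  have "approx_sq m z \<le> z"
  proof (induction m)
    case (Suc m)
    have "0 \<le> (tent ^^ Suc m) z / 4 ^ Suc m" using tents_range[OF that, of "Suc m"] by auto
    then show ?case using Suc by simp
  qed simp
  moreover have "approx_sq m z \<ge> 0"
    using tents_range[OF that, of m] unfolding approx_sq_eq[OF that]
    by (intro add_nonneg_nonneg divide_nonneg_nonneg) (auto simp: power2_eq_square mult_left_le)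
  ultimately show ?thesis using that by auto
qed

lemma four_pow_ge: "(2::real) ^ m \<le> 4 ^ m"
  by (rule power_mono) auto

text \<open>The remainder is (u - u^2) / 4^m with u the m-th sawtooth: u has slope at most 2^m and u
  - u^2 is 1-Lipschitz on [0,1].\<close>

lemma approx_sq_error_lipschitz:
  assumes "x \<in> {0..1}" "y \<in> {0..1}"
  shows "\<bar>(approx_sq m x - x\<^sup>2) - (approx_sq m y - y\<^sup>2)\<bar> \<le> \<bar>x - y\<bar> / 2 ^ m"
proof -
  define u v where "u = (tent ^^ m) x" and "v = (tent ^^ m) y"
  have uv: "u \<in> {0..1}" "v \<in> {0..1}" using tents_range assms by (auto simp: u_def v_def)
  have "\<bar>(u - u\<^sup>2) - (v - v\<^sup>2)\<bar> = \<bar>u - v\<bar> * \<bar>1 - (u + v)\<bar>"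
    unfolding abs_mult[symmetric] by (simp add: power2_eq_square algebra_simps)
  also have "\<dots> \<le> \<bar>u - v\<bar> * 1" using uv by (intro mult_left_mono) auto
  also have "\<dots> \<le> 2 ^ m * \<bar>x - y\<bar>" using tents_lipschitz[OF assms] by (simp add: u_def v_def)
  finally have "\<bar>(u - u\<^sup>2) - (v - v\<^sup>2)\<bar> / 4 ^ m \<le> 2 ^ m * \<bar>x - y\<bar> / 4 ^ m"
    by (rule divide_right_mono) simp
  also have "\<dots> = \<bar>x - y\<bar> / 2 ^ m"
    by (simp add: field_simps flip: power_mult_distrib)
  finally show ?thesis
    unfolding approx_sq_eq[OF assms(1)] approx_sq_eq[OF assms(2)]
    by (simp add: u_def v_def flip: diff_divide_distrib)
qed

lemma approx_sq_error_bound: "\<bar>approx_sq m z - z\<^sup>2\<bar> \<le> 1 / (2 * 2 ^ m)" if "z \<in> {0..1}"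
proof -
  define u where "u = (tent ^^ m) z"
  have u: "u \<in> {0..1}" using tents_range that by (auto simp: u_def)
  have "u - u\<^sup>2 = 1/4 - (u - 1/2)\<^sup>2" by (simp add: power2_eq_square algebra_simps)
  then have "u - u\<^sup>2 \<le> 1/2" using zero_le_power2[of "u - 1/2"] by linarith
  moreover have "u - u\<^sup>2 \<ge> 0" using u by (auto simp: power2_eq_square mult_left_le)
  ultimately have "\<bar>u - u\<^sup>2\<bar> / 4 ^ m \<le> (1/2) / 2 ^ m"
    using four_pow_ge by (intro frac_le) auto
  then show ?thesis unfolding approx_sq_eq[OF that] by (simp add: u_def)
qed

lemma approx_mul_error_eq:
  "approx_mul m x y - x * y = (approx_sq m (\<bar>x + y\<bar> / 2) - (\<bar>x + y\<bar> / 2)\<^sup>2) - (approx_sq m (\<bar>x - y\<bar> / 2) - (\<bar>x - y\<bar> / 2)\<^sup>2)"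
  by (simp add: approx_mul_def power_divide power2_eq_square field_simps)

lemma half_sum_range: "\<bar>x + y\<bar> / 2 \<in> {0..1}" "\<bar>x - y\<bar> / 2 \<in> {0..1}"
  if "\<bar>x\<bar> \<le> 1" "\<bar>y\<bar> \<le> (1::real)"
  using that by auto

lemma approx_mul_range: "\<bar>approx_mul m x y\<bar> \<le> 1" if "\<bar>x\<bar> \<le> 1" "\<bar>y\<bar> \<le> 1"
  using approx_sq_range[OF half_sum_range(1)[OF that], of m] approx_sq_range[OF half_sum_range(2)[OF that], of m]
  by (auto simp: approx_mul_def)

lemma approx_mul_error_bound: "\<bar>approx_mul m x y - x * y\<bar> \<le> 1 / 2 ^ m" if "\<bar>x\<bar> \<le> 1" "\<bar>y\<bar> \<le> 1"
  using approx_sq_error_bound[OF half_sum_range(1)[OF that], of m]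
    approx_sq_error_bound[OF half_sum_range(2)[OF that], of m]
    field_sum_of_halves[of "1 / 2 ^ m :: real"]
  unfolding approx_mul_error_eq divide_divide_eq_left mult.commute[of "2 ^ m" 2]
  by (smt (verit, best) abs_triangle_ineq4)

lemma approx_mul_error_lipschitz:
  assumes "\<bar>x\<bar> \<le> 1" "\<bar>y\<bar> \<le> 1" "\<bar>x'\<bar> \<le> 1" "\<bar>y'\<bar> \<le> 1"
  shows "\<bar>(approx_mul m x y - x * y) - (approx_mul m x' y' - x' * y')\<bar> \<le> (\<bar>x - x'\<bar> + \<bar>y - y'\<bar>) / 2 ^ m"
proof -
  define D where "D = \<bar>x - x'\<bar> + \<bar>y - y'\<bar>"
  have "\<bar>\<bar>x + y\<bar> - \<bar>x' + y'\<bar>\<bar> \<le> D" "\<bar>\<bar>x - y\<bar> - \<bar>x' - y'\<bar>\<bar> \<le> D"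
    unfolding D_def by linarith+
  then have "\<bar>\<bar>x + y\<bar> / 2 - \<bar>x' + y'\<bar> / 2\<bar> \<le> D / 2" "\<bar>\<bar>x - y\<bar> / 2 - \<bar>x' - y'\<bar> / 2\<bar> \<le> D / 2"
    by (simp_all flip: diff_divide_distrib)
  then have "\<bar>\<bar>x + y\<bar> / 2 - \<bar>x' + y'\<bar> / 2\<bar> / 2 ^ m \<le> D / 2 / 2 ^ m"
    "\<bar>\<bar>x - y\<bar> / 2 - \<bar>x' - y'\<bar> / 2\<bar> / 2 ^ m \<le> D / 2 / 2 ^ m"
    by (simp_all only: divide_right_mono zero_le_power zero_le_numeral)
  note bnds = order_trans[OF approx_sq_error_lipschitz[OF half_sum_range(1)[OF assms(1,2)]
        half_sum_range(1)[OF assms(3,4)]] this(1)]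
      order_trans[OF approx_sq_error_lipschitz[OF half_sum_range(2)[OF assms(1,2)]
        half_sum_range(2)[OF assms(3,4)]] this(2)]
  have "\<bar>(p - q) - (p' - q')\<bar> \<le> e + f" if "\<bar>p - p'\<bar> \<le> e" "\<bar>q - q'\<bar> \<le> f" for p q p' q' e f :: real
    using that by linarith
  from this[OF bnds] have "\<bar>(approx_mul m x y - x * y) - (approx_mul m x' y' - x' * y')\<bar> \<le> D / 2 / 2 ^ m + D / 2 / 2 ^ m"
    unfolding approx_mul_error_eq .
  also have "\<dots> = D / 2 ^ m" by (simp add: field_simps)
  finally show ?thesis unfolding D_def .
qed

section \<open>Range and error of the product trees\<close>

lemma prod_tree_range: "\<bar>prod_tree m k a\<bar> \<le> 1" if "\<And>i. i < 2 ^ k \<Longrightarrow> \<bar>a i\<bar> \<le> 1"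
  using that
proof (induction k arbitrary: a)
  case (Suc k)
  show ?case using Suc.prems by (auto intro!: approx_mul_range Suc.IH)
qed simp

lemma sum_prod_split_two_power:
  fixes f :: "nat \<Rightarrow> real"
  shows "(\<Sum>i<2 ^ Suc k. f i) = (\<Sum>i<2 ^ k. f i) + (\<Sum>i<2 ^ k. f (i + 2 ^ k))"
    and "(\<Prod>i<2 ^ Suc k. f i) = (\<Prod>i<2 ^ k. f i) * (\<Prod>i<2 ^ k. f (i + 2 ^ k))"
proof -
  have "{..<2 ^ Suc k} = {..<2 ^ k} \<union> {2 ^ k..<2 ^ k + (2::nat) ^ k}" by auto
  then show "(\<Sum>i<2 ^ Suc k. f i) = (\<Sum>i<2 ^ k. f i) + (\<Sum>i<2 ^ k. f (i + 2 ^ k))"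
    "(\<Prod>i<2 ^ Suc k. f i) = (\<Prod>i<2 ^ k. f i) * (\<Prod>i<2 ^ k. f (i + 2 ^ k))"
    using sum.shift_bounds_nat_ivl[of f 0 "2^k" "2^k"] prod.shift_bounds_nat_ivl[of f 0 "2^k" "2^k"]
    by (simp_all add: sum.union_disjoint prod.union_disjoint ivl_disj_int atLeast0LessThan)
qed

lemma prod_range: "\<bar>\<Prod>i\<in>A. a i\<bar> \<le> (1::real)" if "\<And>i. i \<in> A \<Longrightarrow> \<bar>a i\<bar> \<le> 1"
  unfolding abs_prod using that by (intro prod_le_1) auto

lemma prod_lipschitz: "\<bar>(\<Prod>i\<in>A. a i) - (\<Prod>i\<in>A. b i)\<bar> \<le> (\<Sum>i\<in>A. \<bar>a i - b i :: real\<bar>)"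
  if "\<And>i. i \<in> A \<Longrightarrow> \<bar>a i\<bar> \<le> 1" "\<And>i. i \<in> A \<Longrightarrow> \<bar>b i\<bar> \<le> 1"
  using norm_prod_diff[of A a b] that by simp

lemma abs_mult_le: "\<bar>x * y\<bar> \<le> c * d" if "\<bar>x\<bar> \<le> c" "\<bar>y\<bar> \<le> (d::real)"
proof -
  have "0 \<le> c" using that(1) abs_ge_zero order_trans by blast
  then show ?thesis unfolding abs_mult using that by (intro mult_mono) auto
qed

text \<open>Both bounds go through one induction, since the Lipschitz bound of a product needs the
  size of the errors of its factors. One level turns the constant L into at most 3 L + 2 / 2^m, and
  (4^k - 1) / 2^m satisfies this recursion with room to spare. The hypothesis on k and m keeps L
  below 1.\<close>

lemma prod_tree_error:
  assumes "4 ^ k \<le> (2::real) ^ m" and "\<And>i. i < 2 ^ k \<Longrightarrow> \<bar>a i\<bar> \<le> 1" "\<And>i. i < 2 ^ k \<Longrightarrow> \<bar>b i\<bar> \<le> 1"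
  shows "\<bar>prod_tree m k a - (\<Prod>i<2 ^ k. a i)\<bar> \<le> (4 ^ k - 1) / 2 ^ m \<and>
    \<bar>(prod_tree m k a - (\<Prod>i<2 ^ k. a i)) - (prod_tree m k b - (\<Prod>i<2 ^ k. b i))\<bar>
       \<le> (4 ^ k - 1) / 2 ^ m * (\<Sum>i<2 ^ k. \<bar>a i - b i\<bar>)"
  using assms
proof (induction k arbitrary: a b)
  case 0
  then show ?case by (simp add: lessThan_Suc)
next
  case (Suc k)
  define \<mu> L where "\<mu> = 1 / (2::real) ^ m" and "L = (4 ^ k - 1) / (2::real) ^ m"
  have \<mu>: "0 \<le> \<mu>" by (simp add: \<mu>_def)
  have "4 ^ k \<le> (4::real) ^ Suc k" by simp
  then have k: "4 ^ k \<le> (2::real) ^ m" using Suc.prems(1) by linarith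
  have L: "0 \<le> L" "L \<le> 1" using k by (auto simp: L_def field_simps)
  have step: "3 * L + 2 * \<mu> \<le> (4 ^ Suc k - 1) / 2 ^ m"
    by (simp add: L_def \<mu>_def field_simps)
  define a' b' where "a' = (\<lambda>i. a (i + 2 ^ k))" and "b' = (\<lambda>i. b (i + 2 ^ k))"
  have bnd: "\<And>i. i < 2 ^ k \<Longrightarrow> \<bar>a i\<bar> \<le> 1" "\<And>i. i < 2 ^ k \<Longrightarrow> \<bar>b i\<bar> \<le> 1"
    "\<And>i. i < 2 ^ k \<Longrightarrow> \<bar>a' i\<bar> \<le> 1" "\<And>i. i < 2 ^ k \<Longrightarrow> \<bar>b' i\<bar> \<le> 1"
    using Suc.prems by (auto simp: a'_def b'_def)
  define s t s' t' where "s = prod_tree m k a" and "t = prod_tree m k a'" and "s' = prod_tree m k b" and "t' = prod_tree m k b'"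
  define p q p' q' where "p = (\<Prod>i<2 ^ k. a i)" and "q = (\<Prod>i<2 ^ k. a' i)"
    and "p' = (\<Prod>i<2 ^ k. b i)" and "q' = (\<Prod>i<2 ^ k. b' i)"
  define A B where "A = (\<Sum>i<2 ^ k. \<bar>a i - b i\<bar>)" and "B = (\<Sum>i<2 ^ k. \<bar>a' i - b' i\<bar>)"
  have AB: "0 \<le> A" "0 \<le> B" by (auto simp: A_def B_def sum_nonneg)
  have r: "\<bar>s\<bar> \<le> 1" "\<bar>t\<bar> \<le> 1" "\<bar>s'\<bar> \<le> 1" "\<bar>t'\<bar> \<le> 1"
    using bnd by (auto simp: s_def t_def s'_def t'_def intro!: prod_tree_range)
  have r': "\<bar>p\<bar> \<le> 1" "\<bar>p'\<bar> \<le> 1" "\<bar>q'\<bar> \<le> 1"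
    using bnd by (auto simp: p_def p'_def q'_def intro!: prod_range)
  have pp: "\<bar>p - p'\<bar> \<le> A" "\<bar>q - q'\<bar> \<le> B"
    using bnd by (auto simp: p_def p'_def q_def q'_def A_def B_def intro!: prod_lipschitz)
  have ih: "\<bar>prod_tree m k f - (\<Prod>i<2 ^ k. f i)\<bar> \<le> L \<and>
      \<bar>(prod_tree m k f - (\<Prod>i<2 ^ k. f i)) - (prod_tree m k g - (\<Prod>i<2 ^ k. g i))\<bar>
        \<le> L * (\<Sum>i<2 ^ k. \<bar>f i - g i\<bar>)"
    if "\<And>i. i < 2 ^ k \<Longrightarrow> \<bar>f i\<bar> \<le> 1" "\<And>i. i < 2 ^ k \<Longrightarrow> \<bar>g i\<bar> \<le> 1" for f g
    unfolding L_def by (rule Suc.IH) (use k that in blast)+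
  have e1: "\<bar>s - p\<bar> \<le> L \<and> \<bar>(s - p) - (s' - p')\<bar> \<le> L * A"
    unfolding s_def s'_def p_def p'_def A_def by (rule ih) (use bnd in blast)+
  have e2: "\<bar>t - q\<bar> \<le> L \<and> \<bar>(t - q) - (t' - q')\<bar> \<le> L * B"
    unfolding t_def t'_def q_def q'_def B_def by (rule ih) (use bnd in blast)+
  have e3: "\<bar>s' - p'\<bar> \<le> L" "\<bar>t' - q'\<bar> \<le> L"
    unfolding s'_def p'_def t'_def q'_def
    by (rule conjunct1[OF ih]; use bnd in blast)+
  have e: "\<bar>s - p\<bar> \<le> L" "\<bar>t - q\<bar> \<le> L" "\<bar>(s - p) - (s' - p')\<bar> \<le> L * A" "\<bar>(t - q) - (t' - q')\<bar> \<le> L * B"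
    using e1 e2 by blast+
  have LA: "L * A \<le> A" "L * B \<le> B" using L AB by (auto intro: mult_left_le_one_le)
  \<comment> \<open>The exact product is 1-Lipschitz in the l1 distance, and its error adds at most
    L <= 1; this doubling is the 2 in \<open>2 * \<mu>\<close>.\<close>
  have st: "\<bar>s - s'\<bar> \<le> 2 * A" "\<bar>t - t'\<bar> \<le> 2 * B"
    using e(3,4) pp LA by linarith+
  have E: "prod_tree m (Suc k) a - (\<Prod>i<2 ^ Suc k. a i) = (approx_mul m s t - s * t) + (s - p) * t + p * (t - q)"
    "prod_tree m (Suc k) b - (\<Prod>i<2 ^ Suc k. b i) = (approx_mul m s' t' - s' * t') + (s' - p') * t' + p' * (t' - q')"
    unfolding sum_prod_split_two_power
    by (simp_all add: s_def t_def s'_def t'_def p_def q_def p'_def q'_def a'_def b'_def algebra_simps)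
  have "\<bar>(s - p) * t\<bar> \<le> L * 1" "\<bar>p * (t - q)\<bar> \<le> 1 * L"
    by (rule abs_mult_le; fact)+
  moreover have "\<bar>approx_mul m s t - s * t\<bar> \<le> \<mu>" using approx_mul_error_bound[OF r(1,2)] by (simp add: \<mu>_def)
  ultimately have 1: "\<bar>prod_tree m (Suc k) a - (\<Prod>i<2 ^ Suc k. a i)\<bar> \<le> (4 ^ Suc k - 1) / 2 ^ m"
    unfolding E using step L(1) \<mu> by linarith
  have "\<bar>(approx_mul m s t - s * t) - (approx_mul m s' t' - s' * t')\<bar> \<le> \<mu> * (\<bar>s - s'\<bar> + \<bar>t - t'\<bar>)"
    using approx_mul_error_lipschitz[OF r] by (simp add: \<mu>_def mult.commute)
  also have "\<dots> \<le> \<mu> * (2 * A + 2 * B)" using st \<mu> by (intro mult_left_mono) auto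
  finally have m1: "\<bar>(approx_mul m s t - s * t) - (approx_mul m s' t' - s' * t')\<bar> \<le> \<mu> * (2 * A + 2 * B)" .
  have "(s - p) * t - (s' - p') * t' = ((s - p) - (s' - p')) * t + (s' - p') * (t - t')"
    by (simp add: algebra_simps)
  moreover have "\<bar>((s - p) - (s' - p')) * t\<bar> \<le> (L * A) * 1" "\<bar>(s' - p') * (t - t')\<bar> \<le> L * (2 * B)"
    by (rule abs_mult_le; fact)+
  ultimately have m2: "\<bar>(s - p) * t - (s' - p') * t'\<bar> \<le> L * A + 2 * (L * B)" by linarith
  have "p * (t - q) - p' * (t' - q') = p * ((t - q) - (t' - q')) + (p - p') * (t' - q')"
    by (simp add: algebra_simps)
  moreover have "\<bar>p * ((t - q) - (t' - q'))\<bar> \<le> 1 * (L * B)" "\<bar>(p - p') * (t' - q')\<bar> \<le> A * L"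
    by (rule abs_mult_le; fact)+
  ultimately have m3: "\<bar>p * (t - q) - p' * (t' - q')\<bar> \<le> L * B + L * A" by (simp add: mult.commute)
  have "\<bar>(prod_tree m (Suc k) a - (\<Prod>i<2 ^ Suc k. a i)) - (prod_tree m (Suc k) b - (\<Prod>i<2 ^ Suc k. b i))\<bar>
      \<le> \<mu> * (2 * A + 2 * B) + 2 * (L * A) + 3 * (L * B)"
    unfolding E using m1 m2 m3 by linarith
  also have "\<dots> \<le> (3 * L + 2 * \<mu>) * (A + B)" using L AB by (simp add: algebra_simps)
  also have "\<dots> \<le> (4 ^ Suc k - 1) / 2 ^ m * (A + B)"
    using step AB by (intro mult_right_mono) auto
  also have "A + B = (\<Sum>i<2 ^ Suc k. \<bar>a i - b i\<bar>)"
    unfolding sum_prod_split_two_power by (simp add: A_def B_def a'_def b'_def)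
  finally show ?case using 1 by blast
qed

section \<open>ReLU computations on sets of features\<close>

text \<open>Networks are built layer by layer as sets of functions of the network input, so that parallel
  composition and sharing of neurons are unions of sets. A cost c in aff F c g bounds the number
  of weights plus one for the bias; computes F L S G says that L hidden layers of total size S
  turn the features F into the features G. A real value f is carried through ReLU layers as the
  pair of its positive and negative parts.\<close>

definition aff :: "('z \<Rightarrow> real) set \<Rightarrow> nat \<Rightarrow> ('z \<Rightarrow> real) \<Rightarrow> bool" where
  "aff F c g \<longleftrightarrow> (\<exists>T w b. finite T \<and> T \<subseteq> F \<and> card T + 1 \<le> c \<and> g = (\<lambda>z. (\<Sum>f\<in>T. w f * f z) + b))"

definition relu_step :: "('z \<Rightarrow> real) set \<Rightarrow> nat \<Rightarrow> ('z \<Rightarrow> real) set \<Rightarrow> bool" where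
  "relu_step F c G \<longleftrightarrow> finite G \<and>
     (\<exists>k h. (\<forall>g\<in>G. aff F (k g) (h g) \<and> g = (\<lambda>z. relu (h g z))) \<and> (\<Sum>g\<in>G. k g) \<le> c)"

primrec computes :: "('z \<Rightarrow> real) set \<Rightarrow> nat \<Rightarrow> nat \<Rightarrow> ('z \<Rightarrow> real) set \<Rightarrow> bool" where
  "computes F 0 S G \<longleftrightarrow> G \<subseteq> F"
| "computes F (Suc L) S G \<longleftrightarrow> (\<exists>H S1 S2. computes F L S1 H \<and> relu_step H S2 G \<and> S1 + S2 \<le> S)"

definition pm_parts :: "('z \<Rightarrow> real) \<Rightarrow> ('z \<Rightarrow> real) set" where
  "pm_parts f = {\<lambda>z. relu (f z), \<lambda>z. relu (- f z)}"

section \<open>Cost rules for affine combinations, single layers and their compositions\<close>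

lemma aff_mono: "aff F c g \<Longrightarrow> F \<subseteq> F' \<Longrightarrow> c \<le> c' \<Longrightarrow> aff F' c' g"
  unfolding aff_def by (elim exE conjE, intro exI conjI, assumption, erule (1) subset_trans, erule (1) le_trans)

lemma aff_const: "aff F 1 (\<lambda>z. b)"
  unfolding aff_def by (rule exI[of _ "{}"]) auto

lemma aff_feature: "f \<in> F \<Longrightarrow> aff F 2 f"
  unfolding aff_def by (intro exI[of _ "{f}"] exI[of _ "\<lambda>_. 1"] exI[of _ 0]) auto

lemma aff_scale: "aff F c g \<Longrightarrow> aff F c (\<lambda>z. r * g z)"
proof -
  assume "aff F c g"
  then obtain T w b where "finite T" "T \<subseteq> F" "card T + 1 \<le> c" "g = (\<lambda>z. (\<Sum>f\<in>T. w f * f z) + b)"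
    unfolding aff_def by blast
  then show ?thesis
    unfolding aff_def
    by (intro exI[of _ T] exI[of _ "\<lambda>f. r * w f"] exI[of _ "r * b"]) (auto simp: sum_distrib_left algebra_simps)
qed

lemma aff_add:
  assumes "aff F c g" "aff F c' g'"
  shows "aff F (c + c') (\<lambda>z. g z + g' z)"
proof -
  obtain T w b where T: "finite T" "T \<subseteq> F" "card T + 1 \<le> c" "g = (\<lambda>z. (\<Sum>f\<in>T. w f * f z) + b)"
    using assms(1) unfolding aff_def by blast
  obtain T' w' b' where T': "finite T'" "T' \<subseteq> F" "card T' + 1 \<le> c'" "g' = (\<lambda>z. (\<Sum>f\<in>T'. w' f * f z) + b')"
    using assms(2) unfolding aff_def by blast
  define W where "W = (\<lambda>f. (if f \<in> T then w f else 0) + (if f \<in> T' then w' f else 0))"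
  have "(\<Sum>f\<in>T \<union> T'. W f * f z) = (\<Sum>f\<in>T. w f * f z) + (\<Sum>f\<in>T'. w' f * f z)" for z
  proof -
    have "(\<Sum>f\<in>T \<union> T'. W f * f z) = (\<Sum>f\<in>T \<union> T'. if f \<in> T then w f * f z else 0)
        + (\<Sum>f\<in>T \<union> T'. if f \<in> T' then w' f * f z else 0)"
      unfolding sum.distrib[symmetric] by (rule sum.cong) (auto simp: W_def algebra_simps)
    also have "\<dots> = (\<Sum>f\<in>T. w f * f z) + (\<Sum>f\<in>T'. w' f * f z)"
      using T(1) T'(1) by (intro arg_cong2[of _ _ _ _ "(+)"]; subst sum.inter_restrict[symmetric]) (auto simp: Int_absorb1 Int_absorb2)
    finally show ?thesis .
  qed
  then have "(\<lambda>z. g z + g' z) = (\<lambda>z. (\<Sum>f\<in>T \<union> T'. W f * f z) + (b + b'))"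
    using T(4) T'(4) by (auto simp: algebra_simps)
  moreover have "card (T \<union> T') + 1 \<le> c + c'" using card_Un_le[of T T'] T(3) T'(3) by linarith
  ultimately show ?thesis unfolding aff_def using T(1,2) T'(1,2)
    by (intro exI[of _ "T \<union> T'"] exI[of _ W] exI[of _ "b + b'"]) simp
qed

lemma aff_diff: "aff F c g \<Longrightarrow> aff F c' g' \<Longrightarrow> aff F (c + c') (\<lambda>z. g z - g' z)"
  using aff_add[of F c g c' "\<lambda>z. (-1) * g' z"] aff_scale[of F c' g' "-1"] by simp

lemma aff_sum:
  assumes "finite I" "\<And>i. i \<in> I \<Longrightarrow> aff F c (g i)"
  shows "aff F (1 + card I * c) (\<lambda>z. \<Sum>i\<in>I. g i z)"
  using assms
proof (induction I rule: finite_induct)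
  case empty
  then show ?case using aff_const[of F 0] by simp
next
  case (insert i I)
  then show ?case using aff_add[of F c "g i" "1 + card I * c" "\<lambda>z. \<Sum>i\<in>I. g i z"]
    by (auto simp: algebra_simps)
qed

lemma relu_diff: "relu t - relu (- t) = t" "relu t + relu (- t) = \<bar>t\<bar>"
  by (auto simp: relu_def max_def)

lemma aff_pm_parts: "aff F 4 f" if "pm_parts f \<subseteq> F"
  using aff_diff[of F 2 "\<lambda>z. relu (f z)" 2 "\<lambda>z. relu (- f z)"] aff_feature that
  by (auto simp: pm_parts_def relu_diff)

lemma relu_step_mono: "relu_step F c G \<Longrightarrow> F \<subseteq> F' \<Longrightarrow> c \<le> c' \<Longrightarrow> relu_step F' c' G"
  unfolding relu_step_def by (meson aff_mono order_refl le_trans)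

lemma relu_step_subset: "relu_step F c G \<Longrightarrow> G' \<subseteq> G \<Longrightarrow> relu_step F c G'"
  unfolding relu_step_def by (meson finite_subset le_trans subsetD sum_mono2 zero_le)

lemma relu_step_single: "aff F c h \<Longrightarrow> relu_step F c {\<lambda>z. relu (h z)}"
  unfolding relu_step_def by (auto intro!: exI[of _ "\<lambda>_. c"] exI[of _ "\<lambda>_. h"])

lemma relu_step_Un:
  assumes "relu_step F c G" "relu_step F c' G'"
  shows "relu_step F (c + c') (G \<union> G')"
proof -
  obtain k h where k: "finite G" "\<And>g. g \<in> G \<Longrightarrow> aff F (k g) (h g) \<and> g = (\<lambda>z. relu (h g z))" "(\<Sum>g\<in>G. k g) \<le> c"
    using assms(1) unfolding relu_step_def by blast
  obtain k' h' where k': "finite G'" "\<And>g. g \<in> G' \<Longrightarrow> aff F (k' g) (h' g) \<and> g = (\<lambda>z. relu (h' g z))" "(\<Sum>g\<in>G'. k' g) \<le> c'"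
    using assms(2) unfolding relu_step_def by blast
  \<comment> \<open>A neuron that occurs in both layers is built and paid for once, with the recipe
    from \<open>G\<close>.\<close>
  define K H where "K = (\<lambda>g. if g \<in> G then k g else k' g)" and "H = (\<lambda>g. if g \<in> G then h g else h' g)"
  have "(\<Sum>g\<in>G \<union> G'. K g) = (\<Sum>g\<in>G. K g) + (\<Sum>g\<in>G' - G. K g)"
    using k(1) k'(1) sum.union_disjoint[of G "G' - G" K] by (simp add: Un_Diff_cancel)
  also have "\<dots> \<le> c + c'"
  proof (rule add_mono)
    show "(\<Sum>g\<in>G. K g) \<le> c" using k(3) by (simp add: K_def)
    have "(\<Sum>g\<in>G' - G. K g) = (\<Sum>g\<in>G' - G. k' g)" by (rule sum.cong) (auto simp: K_def)
    also have "\<dots> \<le> (\<Sum>g\<in>G'. k' g)" using k'(1) by (intro sum_mono2) auto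
    finally show "(\<Sum>g\<in>G' - G. K g) \<le> c'" using k'(3) by simp
  qed
  finally have sum: "(\<Sum>g\<in>G \<union> G'. K g) \<le> c + c'" .
  have all: "\<forall>g\<in>G \<union> G'. aff F (K g) (H g) \<and> g = (\<lambda>z. relu (H g z))"
  proof
    fix g assume "g \<in> G \<union> G'"
    then show "aff F (K g) (H g) \<and> g = (\<lambda>z. relu (H g z))"
      using k(2)[of g] k'(2)[of g] by (cases "g \<in> G") (auto simp: K_def H_def)
  qed
  show ?thesis unfolding relu_step_def using k(1) k'(1) sum all by blast
qed

lemma relu_step_insert: "aff F c h \<Longrightarrow> relu_step F c' G \<Longrightarrow> relu_step F (c + c') (insert (\<lambda>z. relu (h z)) G)"
  using relu_step_Un[OF relu_step_single, of F c h c' G] by simp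

lemma relu_step_pm_parts: "aff F c f \<Longrightarrow> relu_step F (2 * c) (pm_parts f)"
  using relu_step_insert[of F c f c "{\<lambda>z. relu (- f z)}"] relu_step_single[of F c "\<lambda>z. - f z"] aff_scale[of F c f "-1"]
  by (simp add: pm_parts_def mult_2)

lemma computes_mono: "computes F L S G \<Longrightarrow> S \<le> S' \<Longrightarrow> G' \<subseteq> G \<Longrightarrow> computes F L S' G'"
proof (cases L)
  case (Suc l)
  assume "computes F L S G" "S \<le> S'" "G' \<subseteq> G"
  then show ?thesis using Suc by (auto intro: relu_step_subset order_trans)
qed auto

lemma computes_trans: "computes F L S H \<Longrightarrow> computes H L' S' G \<Longrightarrow> computes F (L + L') (S + S') G"
proof (induction L' arbitrary: S' G)
  case 0
  then show ?case using computes_mono[of F L S H "S + S'" G] by simp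
next
  case (Suc L')
  then obtain H' S1 S2 where "computes H L' S1 H'" "relu_step H' S2 G" "S1 + S2 \<le> S'" by auto
  then have "computes F (L + L') (S + S1) H' \<and> relu_step H' S2 G \<and> S + S1 + S2 \<le> S + S'"
    using Suc.IH[OF Suc.prems(1)] by auto
  then show ?case unfolding add_Suc_right computes.simps by blast
qed

lemma computes_relu_step: "relu_step H c G \<Longrightarrow> computes H 1 c G"
  unfolding One_nat_def computes.simps by (rule exI[of _ H], rule exI[of _ 0]) auto

lemma computes_Un: "computes F L S G \<Longrightarrow> computes F L S' G' \<Longrightarrow> computes F L (S + S') (G \<union> G')"
proof (induction L arbitrary: S S' G G')
  case (Suc L)
  obtain H S1 S2 where H: "computes F L S1 H" "relu_step H S2 G" "S1 + S2 \<le> S" using Suc.prems by auto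
  obtain H' S1' S2' where H': "computes F L S1' H'" "relu_step H' S2' G'" "S1' + S2' \<le> S'" using Suc.prems by auto
  have "relu_step (H \<union> H') (S2 + S2') (G \<union> G')"
    using H(2) H'(2) by (intro relu_step_Un) (auto elim: relu_step_mono)
  moreover have "computes F L (S1 + S1') (H \<union> H')" using Suc.IH H(1) H'(1) by blast
  moreover have "S1 + S1' + (S2 + S2') \<le> S + S'" using H(3) H'(3) by linarith
  ultimately show ?case unfolding computes.simps by blast
qed auto

lemma computes_empty: "computes F L 0 {}"
proof (induction L)
  case (Suc L)
  have "relu_step {} 0 {}" by (auto simp: relu_step_def)
  then show ?case using Suc by fastforce
qed simp

lemma computes_UN:
  assumes "finite I" "\<And>i. i \<in> I \<Longrightarrow> computes F L S (G i)"
  shows "computes F L (card I * S) (\<Union>i\<in>I. G i)"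
  using assms
proof (induction I rule: finite_induct)
  case (insert i I)
  then show ?case using computes_Un[of F L S "G i" "card I * S" "\<Union>i\<in>I. G i"] by auto
qed (simp add: computes_empty)

text \<open>Three neurons travel through the layers: the current sawtooth, its shifted ReLU (the
  second term of the next tent) and the partial sum. Sawtooth and partial sum lie in [0,1], where
  ReLU is the identity, so neither has to be split into a pair. The first layer costs 3c + 1, each
  further one 4 + 5 + 6 = 15.\<close>

lemma computes_approx_sq:
  assumes "aff H c z" "\<And>x. z x \<in> {0..1}"
  shows "computes H (m + 1) (3 * c + 1 + 15 * m)
    {\<lambda>x. (tent ^^ m) (z x), \<lambda>x. relu ((tent ^^ m) (z x) - 1/2), \<lambda>x. approx_sq m (z x)}"
proof (induction m)
  case 0
  have "relu_step H (c + ((c + 1) + c)) {\<lambda>x. relu (z x), \<lambda>x. relu (z x - 1/2), \<lambda>x. relu (z x)}"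
    by (intro relu_step_insert relu_step_single aff_diff aff_const assms)
  moreover have "(\<lambda>x. relu (z x)) = z" using assms(2) by (auto simp: relu_def max_def)
  ultimately have "relu_step H (3 * c + 1) {z, \<lambda>x. relu (z x - 1/2), z}" by (simp add: algebra_simps numeral_3_eq_3)
  then show ?case using computes_relu_step by (simp add: numeral_3_eq_3)
next
  case (Suc m)
  define G where "G = {\<lambda>x. (tent ^^ m) (z x), \<lambda>x. relu ((tent ^^ m) (z x) - 1/2), \<lambda>x. approx_sq m (z x)}"
  have r: "(tent ^^ m) (z x) \<in> {0..1}" "(tent ^^ Suc m) (z x) \<in> {0..1}" "approx_sq (Suc m) (z x) \<in> {0..1}" for x
    using tents_range[OF assms(2)] approx_sq_range[OF assms(2)] by blast+
  have T: "(\<lambda>x. (tent ^^ Suc m) (z x)) = (\<lambda>x. 2 * (tent ^^ m) (z x) - 4 * relu ((tent ^^ m) (z x) - 1/2))"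
    using r(1) by (auto simp: tent_def relu_def max_def)
  have t: "aff G 4 (\<lambda>x. (tent ^^ Suc m) (z x))"
  proof -
    have "aff G (2 + 2) (\<lambda>x. 2 * (tent ^^ m) (z x) - 4 * relu ((tent ^^ m) (z x) - 1/2))"
      by (intro aff_diff aff_scale aff_feature) (auto simp: G_def)
    then show ?thesis unfolding T by simp
  qed
  have s: "aff G (2 + 4) (\<lambda>x. approx_sq m (z x) - 1 / 4 ^ Suc m * (tent ^^ Suc m) (z x))"
    by (intro aff_diff aff_scale t aff_feature) (auto simp: G_def)
  have s': "aff G 6 (\<lambda>x. approx_sq (Suc m) (z x))" using s by (simp del: funpow.simps)
  have "relu_step G (4 + ((4 + 1) + 6)) {\<lambda>x. relu ((tent ^^ Suc m) (z x)),
      \<lambda>x. relu ((tent ^^ Suc m) (z x) - 1/2), \<lambda>x. relu (approx_sq (Suc m) (z x))}"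
    by (intro relu_step_insert relu_step_single aff_diff aff_const t s')
  moreover have "(\<lambda>x. relu ((tent ^^ Suc m) (z x))) = (\<lambda>x. (tent ^^ Suc m) (z x))"
    "(\<lambda>x. relu (approx_sq (Suc m) (z x))) = (\<lambda>x. approx_sq (Suc m) (z x))"
    using r(2,3) by (auto simp: relu_def max_def simp del: funpow.simps approx_sq.simps)
  ultimately have "relu_step G 15 {\<lambda>x. (tent ^^ Suc m) (z x),
      \<lambda>x. relu ((tent ^^ Suc m) (z x) - 1/2), \<lambda>x. approx_sq (Suc m) (z x)}"
    by (simp del: funpow.simps approx_sq.simps)
  from computes_trans[OF Suc.IH[folded G_def] computes_relu_step[OF this]] show ?case
    by (simp del: funpow.simps approx_sq.simps computes.simps add: algebra_simps)
qed

text \<open>One layer forms the parts of the sum and the difference, whose absolute values are then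
  affine in them; m + 1 layers compute both squares in parallel, and a last one splits their
  difference. The size is 32 + 2 (13 + 15 m) + 8.\<close>

lemma computes_approx_mul:
  assumes "pm_parts f \<subseteq> H" "pm_parts g \<subseteq> H" "\<And>x. \<bar>f x\<bar> \<le> 1" "\<And>x. \<bar>g x\<bar> \<le> 1"
  shows "computes H (m + 3) (90 * (m + 1)) (pm_parts (\<lambda>x. approx_mul m (f x) (g x)))"
proof -
  define a b where "a = (\<lambda>x. f x + g x)" and "b = (\<lambda>x. f x - g x)"
  have "aff H (4 + 4) a" "aff H (4 + 4) b"
    unfolding a_def b_def using assms by (intro aff_add aff_diff aff_pm_parts; blast)+
  then have "relu_step H (16 + 16) (pm_parts a \<union> pm_parts b)"
    using relu_step_pm_parts[of H 8 a] relu_step_pm_parts[of H 8 b] by (intro relu_step_Un) auto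
  then have 1: "computes H 1 32 (pm_parts a \<union> pm_parts b)" by (intro computes_relu_step) simp
  define z1 z2 where "z1 = (\<lambda>x. \<bar>f x + g x\<bar> / 2)" and "z2 = (\<lambda>x. \<bar>f x - g x\<bar> / 2)"
  have "aff (pm_parts a \<union> pm_parts b) (2 + 2) (\<lambda>x. 1/2 * relu (a x) + 1/2 * relu (- a x))"
    "aff (pm_parts a \<union> pm_parts b) (2 + 2) (\<lambda>x. 1/2 * relu (b x) + 1/2 * relu (- b x))"
    by (intro aff_add aff_scale aff_feature; simp add: pm_parts_def)+
  moreover have "(\<lambda>x. 1/2 * relu (a x) + 1/2 * relu (- a x)) = z1" "(\<lambda>x. 1/2 * relu (b x) + 1/2 * relu (- b x)) = z2"
    unfolding z1_def z2_def a_def b_def by (auto simp: relu_def max_def)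
  ultimately have z: "aff (pm_parts a \<union> pm_parts b) 4 z1" "aff (pm_parts a \<union> pm_parts b) 4 z2" by auto
  have zr: "z1 x \<in> {0..1}" "z2 x \<in> {0..1}" for x
    using half_sum_range[OF assms(3,4)] by (auto simp: z1_def z2_def)
  define G where "G = {\<lambda>x. approx_sq m (z1 x), \<lambda>x. approx_sq m (z2 x)}"
  have 2: "computes (pm_parts a \<union> pm_parts b) (m + 1) ((13 + 15 * m) + (13 + 15 * m)) G"
    using computes_Un[OF computes_approx_sq[OF z(1) zr(1)] computes_approx_sq[OF z(2) zr(2)]]
    by (rule computes_mono) (auto simp: G_def)
  have "aff G (2 + 2) (\<lambda>x. approx_sq m (z1 x) - approx_sq m (z2 x))"
    by (intro aff_diff aff_feature) (auto simp: G_def)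
  then have "aff G 4 (\<lambda>x. approx_mul m (f x) (g x))" by (simp add: approx_mul_def z1_def z2_def)
  from computes_relu_step[OF relu_step_pm_parts[OF this]] have 3: "computes G 1 8 (pm_parts (\<lambda>x. approx_mul m (f x) (g x)))" by simp
  have "computes H (1 + (m + 1) + 1) (32 + ((13 + 15 * m) + (13 + 15 * m)) + 8) (pm_parts (\<lambda>x. approx_mul m (f x) (g x)))"
    by (intro computes_trans[OF computes_trans[OF 1 2] 3])
  then have "computes H (m + 3) (32 + ((13 + 15 * m) + (13 + 15 * m)) + 8) (pm_parts (\<lambda>x. approx_mul m (f x) (g x)))"
    by (simp add: numeral_3_eq_3 del: computes.simps)
  then show ?thesis by (rule computes_mono) auto
qed

text \<open>The two halves run in parallel, so depth grows by one multiplication per level, while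
  size counts the 2^k - 1 inner nodes.\<close>

lemma computes_prod_tree:
  assumes "\<And>i. i < 2 ^ k \<Longrightarrow> pm_parts (a i) \<subseteq> H" "\<And>i x. i < 2 ^ k \<Longrightarrow> \<bar>a i x\<bar> \<le> 1"
  shows "computes H (k * (m + 3)) ((2 ^ k - 1) * (90 * (m + 1))) (pm_parts (\<lambda>x. prod_tree m k (\<lambda>i. a i x)))"
  using assms
proof (induction k arbitrary: a)
  case (Suc k)
  let ?f = "\<lambda>x. prod_tree m k (\<lambda>i. a i x)" and ?g = "\<lambda>x. prod_tree m k (\<lambda>i. a (i + 2 ^ k) x)"
  let ?c = "90 * (m + 1)"
  have "computes H (k * (m + 3)) ((2 ^ k - 1) * ?c) (pm_parts ?f)"
    by (rule Suc.IH) (use Suc.prems in auto)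
  moreover have "computes H (k * (m + 3)) ((2 ^ k - 1) * ?c) (pm_parts ?g)"
    by (rule Suc.IH) (use Suc.prems in auto)
  ultimately have 1: "computes H (k * (m + 3)) ((2 ^ k - 1) * ?c + (2 ^ k - 1) * ?c) (pm_parts ?f \<union> pm_parts ?g)"
    by (rule computes_Un)
  have 2: "computes (pm_parts ?f \<union> pm_parts ?g) (m + 3) ?c (pm_parts (\<lambda>x. approx_mul m (?f x) (?g x)))"
    by (rule computes_approx_mul) (use Suc.prems in \<open>auto intro!: prod_tree_range\<close>)
  have "(2 ^ k - 1) * ?c + (2 ^ k - 1) * ?c + ?c = ((2 ^ k - 1) + (2 ^ k - 1) + 1) * ?c" by (simp only: distrib_right mult_1)
  also have "(2 ^ k - 1) + (2 ^ k - 1) + 1 = (2 ^ Suc k - 1 :: nat)"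
  proof -
    have "1 \<le> (2::nat) ^ k" by simp
    then show ?thesis unfolding power_Suc by linarith
  qed
  finally have "(2 ^ k - 1) * ?c + (2 ^ k - 1) * ?c + ?c = (2 ^ Suc k - 1) * ?c" .
  with computes_trans[OF 1 2] show ?case by (simp add: add.commute)
qed simp

section \<open>Translation of feature sets into lists of layers\<close>

fun nn_chain :: "nat \<Rightarrow> nn \<Rightarrow> nat \<Rightarrow> bool" where
  "nn_chain d [] n \<longleftrightarrow> d = n"
| "nn_chain d (l # ls) n \<longleftrightarrow> fst (snd l) = d \<and> nn_chain (fst l) ls n"

lemma nn_chain_append: "nn_chain d (ls @ ls') n \<longleftrightarrow> (\<exists>k. nn_chain d ls k \<and> nn_chain k ls' n)"
  by (induction ls arbitrary: d) auto

text \<open>The recursive form of the dimension conditions fits the construction, which appends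
  layers at the end; it is converted once into the indexed form of \<open>nn_wf\<close>.\<close>

lemma nn_chain_imp_wf: "nn_chain d ls n \<Longrightarrow> ls \<noteq> [] \<Longrightarrow> nn_wf d n ls"
proof (induction ls arbitrary: d)
  case (Cons l ls)
  show ?case
  proof (cases ls)
    case Nil
    then show ?thesis using Cons.prems by (auto simp: nn_wf_def)
  next
    case (Cons l' ls')
    then have "nn_wf (fst l) n ls" using Cons.IH Cons.prems by auto
    then show ?thesis using Cons Cons.prems
      by (auto simp: nn_wf_def nth_Cons split: nat.splits)
  qed
qed simp

text \<open>In contrast to \<open>nn_eval\<close>, the last layer is rectified too, so that a list
  of hidden layers can be extended.\<close>

definition nn_hidden :: "nn \<Rightarrow> (nat \<Rightarrow> real) \<Rightarrow> nat \<Rightarrow> real" where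
  "nn_hidden ls x = foldl (\<lambda>x l i. relu (affine l x i)) x ls"

lemma nn_eval_append_last: "nn_eval (ls @ [l]) x = affine l (nn_hidden ls x)"
proof (induction ls arbitrary: x)
  case (Cons l' ls)
  have "nn_eval ((l' # ls) @ [l]) x = nn_eval (ls @ [l]) (\<lambda>i. max 0 (affine l' x i))"
    by (cases ls) auto
  then show ?case using Cons by (simp add: nn_hidden_def relu_def)
qed (simp add: nn_hidden_def)

text \<open>Features are functions, neurons are numbers: \<open>e\<close> names the function held by
  each neuron. The enumeration may repeat a function; \<open>idx\<close> selects one neuron per
  feature and is injective since \<open>e\<close> recovers the feature. Thus the number of nonzero
  weights is at most the number of features used.\<close>

lemma affine_row:
  fixes n :: nat
  assumes "aff H c h" and "\<And>f. f \<in> H \<Longrightarrow> \<exists>j<n. f = e j"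
  obtains A b where "\<And>x z. (\<forall>j<n. x j = e j z) \<Longrightarrow> (\<Sum>j<n. A j * x j) + b = h z"
    "card {j. j < n \<and> A j \<noteq> 0} + 1 \<le> c"
proof -
  obtain T w b where T: "finite T" "T \<subseteq> H" "card T + 1 \<le> c" "h = (\<lambda>z. (\<Sum>f\<in>T. w f * f z) + b)"
    using assms(1) unfolding aff_def by blast
  obtain idx where idx: "\<And>f. f \<in> H \<Longrightarrow> idx f < n \<and> f = e (idx f)"
    using assms(2) by metis
  have inj: "inj_on idx T" using idx T(2) by (metis inj_onI subsetD)
  define A where "A = (\<lambda>j. if j \<in> idx ` T then w (e j) else 0)"
  have *: "(\<Sum>j<n. A j * x j) + b = h z" if "\<forall>j<n. x j = e j z" for x z
  proof -
    have sub: "idx ` T \<subseteq> {..<n}" using idx T(2) by auto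
    have "(\<Sum>j<n. A j * x j) = (\<Sum>j\<in>idx ` T. A j * x j)"
      by (rule sum.mono_neutral_right[OF _ sub]) (auto simp: A_def)
    also have "\<dots> = (\<Sum>f\<in>T. A (idx f) * x (idx f))" by (simp add: sum.reindex[OF inj])
    also have "\<dots> = (\<Sum>f\<in>T. w f * f z)"
    proof (rule sum.cong)
      fix f assume "f \<in> T"
      then show "A (idx f) * x (idx f) = w f * f z"
        using idx[of f] T(2) that by (auto simp: A_def)
    qed simp
    finally show ?thesis using T(4) by simp
  qed
  have "card {j. j < n \<and> A j \<noteq> 0} \<le> card (idx ` T)"
    using T(1) by (intro card_mono) (auto simp: A_def)
  then have "card {j. j < n \<and> A j \<noteq> 0} + 1 \<le> c" using card_image_le[OF T(1), of idx] T(3) by linarith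
  with * show thesis by (assumption | rule that)+
qed

lemma layer_size_le:
  "layer_size (m, n, A, b) \<le> (\<Sum>i<m. card {j. j < n \<and> A i j \<noteq> 0} + 1)"
proof -
  have "{(i, j). i < m \<and> j < n \<and> A i j \<noteq> 0} = (SIGMA i:{..<m}. {j. j < n \<and> A i j \<noteq> 0})" by auto
  then have "card {(i, j). i < m \<and> j < n \<and> A i j \<noteq> 0} = (\<Sum>i<m. card {j. j < n \<and> A i j \<noteq> 0})"
    by (simp add: card_SigmaI)
  moreover have "card {i. i < m \<and> b i \<noteq> 0} \<le> card {..<m}" by (intro card_mono) auto
  ultimately show ?thesis unfolding layer_size_def sum.distrib by simp
qed

lemma relu_step_layer:
  fixes n :: nat
  assumes "relu_step H c G" and "\<And>f. f \<in> H \<Longrightarrow> \<exists>j<n. f = e j"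
  shows "\<exists>m A b e'. (\<forall>g\<in>G. \<exists>i<m. g = e' i) \<and> layer_size (m, n, A, b) \<le> c \<and>
    (\<forall>x z. (\<forall>j<n. x j = e j z) \<longrightarrow> (\<forall>i<m. relu (affine (m, n, A, b) x i) = e' i z))"
proof -
  obtain k h where k: "finite G" "\<And>g. g \<in> G \<Longrightarrow> aff H (k g) (h g) \<and> g = (\<lambda>z. relu (h g z))" "(\<Sum>g\<in>G. k g) \<le> c"
    using assms(1) unfolding relu_step_def by blast
  obtain e' where e': "bij_betw e' {0..<card G} G" using ex_bij_betw_nat_finite[OF k(1)] by blast
  have "\<forall>g\<in>G. \<exists>A b. (\<forall>x z. (\<forall>j<n. x j = e j z) \<longrightarrow> (\<Sum>j<n. A j * x j) + b = h g z) \<and>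
    card {j. j < n \<and> A j \<noteq> 0} + 1 \<le> k g"
  proof
    fix g assume "g \<in> G"
    then have "aff H (k g) (h g)" using k(2) by blast
    obtain A b where
      "\<And>x z. (\<forall>j<n. x j = e j z) \<Longrightarrow> (\<Sum>j<n. A j * x j) + b = h g z"
      "card {j. j < n \<and> A j \<noteq> 0} + 1 \<le> k g" by (rule affine_row[OF \<open>aff H (k g) (h g)\<close> assms(2)]) (assumption | rule that)+
    then show "\<exists>A b. (\<forall>x z. (\<forall>j<n. x j = e j z) \<longrightarrow> (\<Sum>j<n. A j * x j) + b = h g z) \<and>
      card {j. j < n \<and> A j \<noteq> 0} + 1 \<le> k g" by (intro exI[of _ A] exI[of _ b]) simp
  qed
  from bchoice[OF this] obtain A where "\<forall>g\<in>G. \<exists>b. (\<forall>x z. (\<forall>j<n. x j = e j z) \<longrightarrow> (\<Sum>j<n. A g j * x j) + b = h g z) \<and>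
    card {j. j < n \<and> A g j \<noteq> 0} + 1 \<le> k g" ..
  from bchoice[OF this] obtain b where b: "\<forall>g\<in>G. (\<forall>x z. (\<forall>j<n. x j = e j z) \<longrightarrow> (\<Sum>j<n. A g j * x j) + b g = h g z) \<and>
    card {j. j < n \<and> A g j \<noteq> 0} + 1 \<le> k g" ..
  have A: "(\<Sum>j<n. A g j * x j) + b g = h g z" if "g \<in> G" "\<forall>j<n. x j = e j z" for g x z
    using b that by blast
  have A': "card {j. j < n \<and> A g j \<noteq> 0} + 1 \<le> k g" if "g \<in> G" for g
    using b that by blast
  have mem: "e' i \<in> G" if "i < card G" for i using e' that by (auto simp: bij_betw_def)
  have "layer_size (card G, n, \<lambda>i. A (e' i), \<lambda>i. b (e' i)) \<le> (\<Sum>i<card G. card {j. j < n \<and> A (e' i) j \<noteq> 0} + 1)"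
    by (rule layer_size_le)
  also have "\<dots> \<le> (\<Sum>i<card G. k (e' i))" by (intro sum_mono A' mem) simp
  also have "\<dots> = (\<Sum>g\<in>G. k g)"
    using sum.reindex_bij_betw[OF e', of k] by (simp add: atLeast0LessThan)
  finally have size: "layer_size (card G, n, \<lambda>i. A (e' i), \<lambda>i. b (e' i)) \<le> c" using k(3) by simp
  have surj: "\<forall>g\<in>G. \<exists>i<card G. g = e' i"
  proof
    fix g assume "g \<in> G"
    then have "g \<in> e' ` {0..<card G}" using e' by (simp add: bij_betw_def)
    then show "\<exists>i<card G. g = e' i" by auto
  qed
  have "relu (affine (card G, n, \<lambda>i. A (e' i), \<lambda>i. b (e' i)) x i) = e' i z"
    if "\<forall>j<n. x j = e j z" "i < card G" for x z i
    using A[OF mem[OF that(2)] that(1)] fun_cong[OF conjunct2[OF k(2)[OF mem[OF that(2)]]], of z] by (simp add: affine_def)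
  with size surj show ?thesis by blast
qed

text \<open>The invariant of the induction on the number of layers is the enumeration
  \<open>e\<close> of the functions held by the last layer; it starts as the enumeration
  \<open>\<phi>\<close> of the inputs.\<close>

lemma computes_hidden:
  assumes "computes (\<phi> ` {..<d}) L S G"
  shows "\<exists>ls n e. length ls = L \<and> nn_chain d ls n \<and> (\<Sum>l\<leftarrow>ls. layer_size l) \<le> S \<and>
    (\<forall>g\<in>G. \<exists>i<n. g = e i) \<and>
    (\<forall>x z. (\<forall>j<d. x j = \<phi> j z) \<longrightarrow> (\<forall>i<n. nn_hidden ls x i = e i z))"
  using assms
proof (induction L arbitrary: S G)
  case 0
  then show ?case by (intro exI[of _ "[]"] exI[of _ d] exI[of _ \<phi>]) (auto simp: nn_hidden_def)
next
  case (Suc L)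
  then obtain H S1 S2 where H: "computes (\<phi> ` {..<d}) L S1 H" "relu_step H S2 G" "S1 + S2 \<le> S" by auto
  obtain ls n e where ls: "length ls = L" "nn_chain d ls n" "(\<Sum>l\<leftarrow>ls. layer_size l) \<le> S1"
    "\<And>g. g \<in> H \<Longrightarrow> \<exists>i<n. g = e i"
    "\<And>x z. (\<forall>j<d. x j = \<phi> j z) \<Longrightarrow> (\<forall>i<n. nn_hidden ls x i = e i z)"
    using Suc.IH[OF H(1)] by blast
  obtain m A b e' where l: "\<forall>g\<in>G. \<exists>i<m. g = e' i" "layer_size (m, n, A, b) \<le> S2"
    "\<And>x z. (\<forall>j<n. x j = e j z) \<Longrightarrow> (\<forall>i<m. relu (affine (m, n, A, b) x i) = e' i z)"
    using relu_step_layer[OF H(2) ls(4)] by blast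
  have "nn_hidden (ls @ [(m, n, A, b)]) x i = e' i z" if "\<forall>j<d. x j = \<phi> j z" "i < m" for x z i
    using l(3)[OF ls(5)[OF that(1)]] that(2) by (simp add: nn_hidden_def)
  then show ?case using ls l H(3)
    by (intro exI[of _ "ls @ [(m, n, A, b)]"] exI[of _ m] exI[of _ e']) (auto simp: nn_chain_append)
qed

lemma computes_network:
  assumes "computes (\<phi> ` {..<d}) L S G" "aff G c out"
  shows "\<exists>\<Phi>. nn_wf d 1 \<Phi> \<and> nn_depth \<Phi> = L + 1 \<and> nn_size \<Phi> \<le> S + c \<and>
    (\<forall>x z. (\<forall>j<d. x j = \<phi> j z) \<longrightarrow> nn_eval \<Phi> x 0 = out z)"
proof -
  obtain ls n e where ls: "length ls = L" "nn_chain d ls n" "(\<Sum>l\<leftarrow>ls. layer_size l) \<le> S"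
    "\<And>g. g \<in> G \<Longrightarrow> \<exists>i<n. g = e i"
    "\<And>x z. (\<forall>j<d. x j = \<phi> j z) \<Longrightarrow> (\<forall>i<n. nn_hidden ls x i = e i z)"
    using computes_hidden[OF assms(1)] by blast
  obtain A b where A: "\<And>x z. (\<forall>j<n. x j = e j z) \<Longrightarrow> (\<Sum>j<n. A j * x j) + b = out z"
    "card {j. j < n \<and> A j \<noteq> 0} + 1 \<le> c"
    by (rule affine_row[OF assms(2) ls(4)]) (assumption | rule that)+
  define l :: layer where "l = (1, n, \<lambda>i. A, \<lambda>i. b)"
  have "layer_size l \<le> c" using layer_size_le[of 1 n "\<lambda>i. A" "\<lambda>i. b"] A(2) by (simp add: l_def)
  moreover have "nn_eval (ls @ [l]) x 0 = out z" if "\<forall>j<d. x j = \<phi> j z" for x z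
    using A(1)[OF ls(5)[OF that]] by (simp add: nn_eval_append_last affine_def l_def)
  moreover have "nn_wf d 1 (ls @ [l])"
    using ls(2) by (intro nn_chain_imp_wf) (auto simp: nn_chain_append l_def)
  ultimately show ?thesis using ls(1,3)
    by (intro exI[of _ "ls @ [l]"]) (auto simp: nn_depth_def nn_size_def)
qed

section \<open>Test functions\<close>

lemma Ck_const: "Ck k (\<lambda>x. c)"
  by (induction k arbitrary: c) auto

lemma Ck_imp_continuous: "Ck k f \<Longrightarrow> continuous_on UNIV f"
proof (cases k)
  case (Suc n)
  assume "Ck k f"
  then have "\<forall>x. f differentiable (at x)" using Suc by simp
  then show ?thesis
    by (meson continuous_at_imp_continuous_on differentiable_imp_continuous_within)
qed simp

lemma Ck_SucD: "Ck (Suc k) f \<Longrightarrow> Ck k f"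
proof (induction k arbitrary: f)
  case 0
  then show ?case using Ck_imp_continuous[OF 0] by simp
next
  case (Suc k)
  then show ?case using Suc.IH by (subst Ck.simps) (subst (asm) Ck.simps, blast)
qed

lemma Ck_add: "Ck k f \<Longrightarrow> Ck k g \<Longrightarrow> Ck k (\<lambda>x. f x + g x)"
proof (induction k arbitrary: f g)
  case (Suc k)
  have d: "f differentiable (at x)" "g differentiable (at x)" for x using Suc.prems by auto
  have "((\<lambda>x. f x + g x) has_derivative
    (\<lambda>h. frechet_derivative f (at x) h + frechet_derivative g (at x) h)) (at x)" for x
    using d frechet_derivative_works by (intro has_derivative_add) blast+
  from frechet_derivative_at[OF this] have
    "frechet_derivative (\<lambda>x. f x + g x) (at x) i =
      frechet_derivative f (at x) i + frechet_derivative g (at x) i" for x i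
    by metis
  then show ?case using Suc by auto
qed (auto intro: continuous_intros)

lemma Ck_mult: "Ck k f \<Longrightarrow> Ck k g \<Longrightarrow> Ck k (\<lambda>x. f x * g x)"
proof (induction k arbitrary: f g)
  case (Suc k)
  have d: "f differentiable (at x)" "g differentiable (at x)" for x using Suc.prems by auto
  have "((\<lambda>x. f x * g x) has_derivative
    (\<lambda>h. f x * frechet_derivative g (at x) h + frechet_derivative f (at x) h * g x)) (at x)" for x
    using d frechet_derivative_works by (intro has_derivative_mult) blast+
  from frechet_derivative_at[OF this] have
    "frechet_derivative (\<lambda>x. f x * g x) (at x) i =
      f x * frechet_derivative g (at x) i + frechet_derivative f (at x) i * g x" for x i
    by metis
  moreover have "Ck k f" "Ck k g" using Suc.prems Ck_SucD by blast+
  ultimately show ?case using Suc.prems d by (auto intro!: Ck_add Suc.IH)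
qed (auto intro: continuous_intros)

lemma Ck_prod: "(\<And>i. i \<in> I \<Longrightarrow> Ck k (f i)) \<Longrightarrow> Ck k (\<lambda>x. \<Prod>i\<in>I. f i x)"
  by (induction I rule: infinite_finite_induct) (auto intro: Ck_const Ck_mult)

text \<open>By the chain rule the partial derivatives are constant multiples of functions of the
  same form with f' in place of f, so the induction generalizes over f.\<close>

lemma Ck_compose_inner:
  fixes f :: "real \<Rightarrow> real" and b :: "'a::euclidean_space"
  shows "Ck k f \<Longrightarrow> Ck k (\<lambda>x. f (r * (x \<bullet> b) + s))"
proof (induction k arbitrary: f)
  case 0
  then have "continuous_on UNIV f" by simp
  then have "continuous_on UNIV (\<lambda>x::'a. f (r * (x \<bullet> b) + s))"
    by (rule continuous_on_compose2) (auto intro!: continuous_on_add continuous_on_mult continuous_on_inner continuous_on_id continuous_on_const)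
  then show ?case by simp
next
  case (Suc k)
  define f' where "f' = (\<lambda>y. frechet_derivative f (at y) 1)"
  have f': "Ck k f'" using Suc.prems by (simp add: f'_def)
  have "(f has_real_derivative f' y) (at y)" for y
  proof -
    have "f differentiable (at y)" using Suc.prems by simp
    then have "(f has_derivative frechet_derivative f (at y)) (at y)" "linear (frechet_derivative f (at y))"
      using frechet_derivative_works linear_frechet_derivative by blast+
    moreover have "frechet_derivative f (at y) = (*) (f' y)"
    proof
      fix h
      show "frechet_derivative f (at y) h = f' y * h"
        using linear_cmul[OF calculation(2), of h 1] unfolding f'_def by (metis real_scaleR_def mult_1_right mult.commute)
    qed
    ultimately show ?thesis by (simp add: has_field_derivative_def)
  qed
  note fd = this
  have "((\<lambda>x::'a. f (r * (x \<bullet> b) + s)) has_derivative (\<lambda>h. f' (r * (x \<bullet> b) + s) * (r * (h \<bullet> b)))) (at x)" for x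
  proof -
    have "((\<lambda>x::'a. r * (x \<bullet> b) + s) has_derivative (\<lambda>h. r * (h \<bullet> b))) (at x)"
      by (auto intro!: derivative_eq_intros)
    from has_derivative_compose[OF this] fd show ?thesis
      unfolding has_field_derivative_def by blast
  qed
  note D = this
  have "frechet_derivative (\<lambda>x::'a. f (r * (x \<bullet> b) + s)) (at x) i = f' (r * (x \<bullet> b) + s) * (r * (i \<bullet> b))" for x i
    using frechet_derivative_at[OF D] by metis
  then show ?case using D Suc.IH[OF f']
    by (auto intro!: Ck_mult Ck_const simp: differentiable_def)
qed

section \<open>The flat function exp(-1/x) and smooth bumps on boxes\<close>

definition flat_exp :: "real poly \<Rightarrow> real \<Rightarrow> real" where
  "flat_exp P x = (if x > 0 then poly P (inverse x) * exp (- inverse x) else 0)"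

lemma poly_exp_tendsto_0: "((\<lambda>y. poly P y * exp (- y)) \<longlongrightarrow> (0::real)) at_top"
proof -
  have "((\<lambda>y. \<Sum>i\<le>degree P. coeff P i * (y ^ i / exp y)) \<longlongrightarrow> (0::real)) at_top"
    by (intro tendsto_null_sum tendsto_mult_right_zero tendsto_power_div_exp_0)
  then show ?thesis
    by (simp add: poly_altdef sum_distrib_right exp_minus divide_inverse mult.assoc)
qed

text \<open>The polynomial parameter makes the class closed under differentiation: with y = 1/x the
  derivative of P(y) exp(-y) is y^2 (P - P')(y) exp(-y). Smoothness then follows by induction over
  all P at once. At 0 the exponential beats every polynomial.\<close>

lemma flat_exp_deriv:
  "(flat_exp P has_real_derivative flat_exp ([:0, 0, 1:] * (P - pderiv P)) x) (at x)"
proof (cases "x = 0")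
  case False
  then consider "x > 0" | "x < 0" by linarith
  then show ?thesis
  proof cases
    case 1
    have "((\<lambda>x. poly P (inverse x) * exp (- inverse x)) has_real_derivative
        flat_exp ([:0, 0, 1:] * (P - pderiv P)) x) (at x)"
      using 1 by (auto intro!: derivative_eq_intros simp: flat_exp_def field_simps power2_eq_square)
    then show ?thesis
      by (rule has_field_derivative_transform_within_open[where S="{0<..}"]) (use 1 in \<open>auto simp: flat_exp_def\<close>)
  next
    case 2
    have "((\<lambda>x. 0) has_real_derivative flat_exp ([:0, 0, 1:] * (P - pderiv P)) x) (at x)"
      using 2 by (simp add: flat_exp_def)
    then show ?thesis
      by (rule has_field_derivative_transform_within_open[where S="{..<0}"]) (use 2 in \<open>auto simp: flat_exp_def\<close>)
  qed
next
  case True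
  have "((\<lambda>h. flat_exp P h / h) \<longlongrightarrow> 0) (at 0)"
    unfolding filterlim_at_split
  proof
    show "((\<lambda>h. flat_exp P h / h) \<longlongrightarrow> 0) (at_left 0)"
    proof (rule tendsto_eventually)
      show "\<forall>\<^sub>F h in at_left 0. flat_exp P h / h = 0"
        unfolding eventually_at_filter by (auto simp: flat_exp_def)
    qed
    \<comment> \<open>Dividing by h multiplies the polynomial in 1/h by its variable, hence
      \<open>pCons 0 P\<close>.\<close>
    have "((\<lambda>h. poly (pCons 0 P) (inverse h) * exp (- inverse h)) \<longlongrightarrow> 0) (at_right (0::real))"
      by (rule filterlim_compose[OF poly_exp_tendsto_0 filterlim_inverse_at_top_right])
    then show "((\<lambda>h. flat_exp P h / h) \<longlongrightarrow> 0) (at_right 0)"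
    proof (rule Lim_transform_eventually)
      show "\<forall>\<^sub>F h in at_right 0. poly (pCons 0 P) (inverse h) * exp (- inverse h) = flat_exp P h / h"
        unfolding eventually_at_filter by (auto simp: flat_exp_def divide_inverse)
    qed
  qed
  then show ?thesis using True by (simp add: has_field_derivative_iff flat_exp_def)
qed

lemma Ck_flat_exp: "Ck k (flat_exp P)"
proof (induction k arbitrary: P)
  case 0
  show ?case using DERIV_isCont[OF flat_exp_deriv] by (simp add: continuous_at_imp_continuous_on)
next
  case (Suc k)
  have "frechet_derivative (flat_exp P) (at x) 1 = flat_exp ([:0, 0, 1:] * (P - pderiv P)) x" for x
    using frechet_derivative_at[OF has_field_derivative_imp_has_derivative[OF flat_exp_deriv[of P x]]] by (metis mult_1_right)
  moreover have "flat_exp P differentiable (at x)" for x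
    using flat_exp_deriv real_differentiable_def by blast
  ultimately show ?case using Suc.IH by simp
qed

text \<open>The shift by -1 keeps the support away from the boundary of the box; as n grows these
  functions converge to the indicator of the box.\<close>

definition box_bump :: "nat \<Rightarrow> 'a::euclidean_space \<Rightarrow> 'a \<Rightarrow> 'a \<Rightarrow> real" where
  "box_bump n l u x = (\<Prod>b\<in>Basis. flat_exp 1 (Suc n * (x \<bullet> b) + (- Suc n * (l \<bullet> b) - 1))
     * flat_exp 1 (- Suc n * (x \<bullet> b) + (Suc n * (u \<bullet> b) - 1)))"

lemma flat_exp_1_range: "0 \<le> flat_exp 1 x" "flat_exp 1 x \<le> 1"
  by (auto simp: flat_exp_def)

lemma box_bump_range: "0 \<le> box_bump n l u x" "box_bump n l u x \<le> 1"
  unfolding box_bump_def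
  by (auto intro!: prod_nonneg prod_le_1 mult_le_one mult_nonneg_nonneg flat_exp_1_range)

lemma box_bump_nonzero:
  assumes "box_bump n l u x \<noteq> 0"
  shows "x \<in> cbox (l + (1 / Suc n) *\<^sub>R One) (u - (1 / Suc n) *\<^sub>R One)"
proof -
  have "flat_exp 1 (Suc n * (x \<bullet> b) + (- Suc n * (l \<bullet> b) - 1)) \<noteq> 0 \<and>
     flat_exp 1 (- Suc n * (x \<bullet> b) + (Suc n * (u \<bullet> b) - 1)) \<noteq> 0" if "b \<in> Basis" for b
    using assms that unfolding box_bump_def by (auto simp: prod_zero_iff)
  then have "Suc n * (x \<bullet> b) + (- Suc n * (l \<bullet> b) - 1) > 0 \<and>
     - Suc n * (x \<bullet> b) + (Suc n * (u \<bullet> b) - 1) > 0" if "b \<in> Basis" for b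
    using that unfolding flat_exp_def by (metis (no_types, lifting))
  then show ?thesis
    by (auto simp: mem_box inner_simps field_simps intro!: less_imp_le)
qed

lemma shrunk_cbox_subset:
  "cbox (l + (1 / Suc n) *\<^sub>R One) (u - (1 / Suc n) *\<^sub>R One) \<subseteq> box l (u :: 'a::euclidean_space)"
proof
  fix x assume x: "x \<in> cbox (l + (1 / Suc n) *\<^sub>R One) (u - (1 / Suc n) *\<^sub>R One)"
  show "x \<in> box l u" unfolding mem_box
  proof
    fix i :: 'a assume i: "i \<in> Basis"
    have "0 < 1 / real (Suc n)" by simp
    moreover have "l \<bullet> i + 1 / real (Suc n) \<le> x \<bullet> i" "x \<bullet> i \<le> u \<bullet> i - 1 / real (Suc n)"
      using x i by (auto simp: mem_box inner_simps)
    ultimately show "l \<bullet> i < x \<bullet> i \<and> x \<bullet> i < u \<bullet> i" by linarith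
  qed
qed

lemma test_fun_box_bump:
  assumes "box l u \<subseteq> S"
  shows "test_fun S (box_bump n l u)"
proof -
  define K where "K = cbox (l + (1 / Suc n) *\<^sub>R One) (u - (1 / Suc n) *\<^sub>R One)"
  have "tsupport (box_bump n l u) \<subseteq> K"
    unfolding tsupport_def K_def by (rule closure_minimal) (use box_bump_nonzero in auto)
  moreover have "K \<subseteq> box l u"
  proof
    fix x assume "x \<in> K"
    then show "x \<in> box l u"
      unfolding K_def using shrunk_cbox_subset by blast
  qed
  moreover have "compact (tsupport (box_bump n l u))"
    using calculation(1) compact_cbox[of "l + (1 / Suc n) *\<^sub>R One" "u - (1 / Suc n) *\<^sub>R One"]
    unfolding K_def tsupport_def by (metis closed_closure compact_Int_closed inf.absorb_iff2)
  moreover have "smooth_fun (box_bump n l u)"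
    unfolding smooth_fun_def box_bump_def
    by (intro allI Ck_prod Ck_mult Ck_compose_inner Ck_flat_exp)
  ultimately show ?thesis unfolding test_fun_def using assms by auto
qed

lemma box_bump_tendsto: "(\<lambda>n. box_bump n l u x) \<longlonglongrightarrow> indicator (box l u) x"
proof (cases "x \<in> box l u")
  case True
  have lim: "(\<lambda>n. flat_exp 1 (Suc n * c - 1)) \<longlonglongrightarrow> 1" if "c > 0" for c :: real
  proof -
    have lm: "filterlim (\<lambda>n. real (Suc n) * c - 1) at_top sequentially"
      using filterlim_tendsto_add_at_top[OF tendsto_const[of "-1"] filterlim_tendsto_pos_mult_at_top[OF
            tendsto_const that filterlim_compose[OF filterlim_real_sequentially filterlim_Suc]]]
      by (simp add: mult.commute)
    have "((\<lambda>y::real. exp (- inverse y)) \<longlongrightarrow> exp (- 0)) at_top"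
      by (intro tendsto_intros tendsto_inverse_0_at_top filterlim_ident)
    from filterlim_compose[OF this lm] have "(\<lambda>n. exp (- inverse (real (Suc n) * c - 1))) \<longlonglongrightarrow> 1" by simp
    moreover have "\<forall>\<^sub>F n in sequentially. exp (- inverse (real (Suc n) * c - 1)) = flat_exp 1 (Suc n * c - 1)"
      using filterlim_at_top_dense[THEN iffD1, OF lm, rule_format, of 0] by eventually_elim (auto simp: flat_exp_def)
    ultimately show ?thesis by (rule Lim_transform_eventually)
  qed
  have "(\<lambda>n. box_bump n l u x) \<longlonglongrightarrow> (\<Prod>b\<in>(Basis::'a set). 1 * 1)"
    unfolding box_bump_def
  proof (intro tendsto_prod tendsto_mult)
    fix b :: 'a assume "b \<in> Basis"
    then have "0 < x \<bullet> b - l \<bullet> b" "0 < u \<bullet> b - x \<bullet> b" using True by (auto simp: mem_box)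
    from lim[OF this(1)] lim[OF this(2)]
    show "(\<lambda>n. flat_exp 1 (Suc n * (x \<bullet> b) + (- Suc n * (l \<bullet> b) - 1))) \<longlonglongrightarrow> 1"
      "(\<lambda>n. flat_exp 1 (- Suc n * (x \<bullet> b) + (Suc n * (u \<bullet> b) - 1))) \<longlonglongrightarrow> 1"
      by (simp_all add: algebra_simps)
  qed
  then show ?thesis using True by simp
next
  case False
  have "box_bump n l u x = 0" for n
  proof (rule ccontr)
    assume "box_bump n l u x \<noteq> 0"
    from box_bump_nonzero[OF this] have "x \<in> box l u" using shrunk_cbox_subset by blast
    then show False using False by simp
  qed
  then show ?thesis using False by simp
qed

text \<open>The positive and the negative part of H are densities of two finite measures that agree
  on all boxes. Boxes are stable under intersection and generate the Borel sets, so the measures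
  coincide, and with them almost everywhere the densities.\<close>

lemma box_integrals_zero_imp_AE_zero:
  fixes H :: "'a::euclidean_space \<Rightarrow> real"
  assumes H: "integrable lborel H" and zero: "\<And>l u. (\<integral>x. indicator (box l u) x * H x \<partial>lborel) = 0"
  shows "AE x in lborel. H x = 0"
proof -
  define M N where "M = density lborel (\<lambda>x. ennreal (H x))" and "N = density lborel (\<lambda>x. ennreal (- H x))"
  have meas[measurable]: "H \<in> borel_measurable borel" using H by auto
  have fin: "(\<integral>\<^sup>+x. ennreal (H x) * indicator A x \<partial>lborel) < \<infinity>"
    "(\<integral>\<^sup>+x. ennreal (- H x) * indicator A x \<partial>lborel) < \<infinity>" for A
  proof -
    have "(\<integral>\<^sup>+x. ennreal (norm (H x)) \<partial>lborel) < \<infinity>" using H by (simp add: integrable_iff_bounded)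
    moreover have "(\<integral>\<^sup>+x. ennreal (H x) * indicator A x \<partial>lborel) \<le> (\<integral>\<^sup>+x. ennreal (norm (H x)) \<partial>lborel)"
      "(\<integral>\<^sup>+x. ennreal (- H x) * indicator A x \<partial>lborel) \<le> (\<integral>\<^sup>+x. ennreal (norm (H x)) \<partial>lborel)"
      by (intro nn_integral_mono; auto split: split_indicator intro!: ennreal_leI)+
    ultimately show "(\<integral>\<^sup>+x. ennreal (H x) * indicator A x \<partial>lborel) < \<infinity>"
      "(\<integral>\<^sup>+x. ennreal (- H x) * indicator A x \<partial>lborel) < \<infinity>" by (auto intro: le_less_trans)
  qed
  have eq: "emeasure M (box l u) = emeasure N (box l u)" for l u
  proof -
    let ?h = "\<lambda>x. indicator (box l u) x * H x"
    have int: "integrable lborel ?h"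
      using integrable_mult_indicator[OF _ H, of "box l u"] by simp
    have "0 = (\<integral>x. ?h x \<partial>lborel)" using zero by simp
    also have "\<dots> = enn2real (\<integral>\<^sup>+x. ennreal (?h x) \<partial>lborel) - enn2real (\<integral>\<^sup>+x. ennreal (- ?h x) \<partial>lborel)"
      by (rule real_lebesgue_integral_def[OF int])
    also have "(\<integral>\<^sup>+x. ennreal (?h x) \<partial>lborel) = emeasure M (box l u)"
      unfolding M_def by (subst emeasure_density) (auto intro!: nn_integral_cong split: split_indicator)
    also have "(\<integral>\<^sup>+x. ennreal (- ?h x) \<partial>lborel) = emeasure N (box l u)"
      unfolding N_def by (subst emeasure_density) (auto intro!: nn_integral_cong split: split_indicator)
    finally have "enn2real (emeasure M (box l u)) = enn2real (emeasure N (box l u))" by simp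
    moreover have "emeasure M (box l u) < \<infinity>" "emeasure N (box l u) < \<infinity>"
      unfolding M_def N_def using fin by (auto simp: emeasure_density)
    ultimately show ?thesis by (metis ennreal_enn2real infinity_ennreal_def)
  qed
  have "M = N"
  proof (rule measure_eqI_generator_eq)
    let ?E = "range (\<lambda>(a, b). box a b::'a set)"
    show "Int_stable ?E" by (auto simp: Int_stable_def box_Int_box)
    show "?E \<subseteq> Pow UNIV" "sets M = sigma_sets UNIV ?E" "sets N = sigma_sets UNIV ?E"
      by (simp_all add: borel_eq_box M_def N_def)
    let ?A = "\<lambda>n::nat. box (- (real n *\<^sub>R One)) (real n *\<^sub>R One) :: 'a set"
    show "range ?A \<subseteq> ?E" "(\<Union>i. ?A i) = UNIV" unfolding UN_box_eq_UNIV by auto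
    show "emeasure M (?A i) \<noteq> \<infinity>" for i using fin(1)[of "?A i"] by (simp add: M_def emeasure_density less_top)
    show "emeasure M X = emeasure N X" if "X \<in> ?E" for X using eq that by auto
  qed
  then have "AE x in lborel. ennreal (H x) = ennreal (- H x)"
    unfolding M_def N_def by (intro sigma_finite_measure.density_unique[OF lborel.sigma_finite_measure_axioms]) auto
  then show ?thesis
  proof eventually_elim
    case (elim x)
    then show ?case by (cases "H x \<ge> 0") (auto simp: ennreal_neg ennreal_eq_0_iff)
  qed
qed

section \<open>Weak derivatives from difference quotients\<close>

lemma integrable_continuous_bounded_support:
  fixes f :: "'a::euclidean_space \<Rightarrow> real"
  assumes "continuous_on UNIV f" "\<And>x. f x \<noteq> 0 \<Longrightarrow> norm x \<le> r"
  shows "integrable lborel f"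
proof -
  have int: "integrable lborel (\<lambda>x. indicator (cball 0 r) x *\<^sub>R f x)"
    by (rule borel_integrable_compact) (auto intro: continuous_on_subset[OF assms(1)])
  have "(\<lambda>x. indicator (cball 0 r) x *\<^sub>R f x) = f"
    using assms(2) by (force simp: indicator_def)
  then show ?thesis using int by simp
qed

lemma lborel_integral_shift:
  fixes f :: "'a::euclidean_space \<Rightarrow> real"
  assumes [measurable]: "f \<in> borel_measurable borel"
  shows "(\<integral>x. f (c + x) \<partial>lborel) = (\<integral>x. f x \<partial>lborel)"
proof -
  have "(\<integral>x. f x \<partial>lborel) = (\<integral>x. f x \<partial>distr lborel borel ((+) c))"
    by (simp add: lborel_distr_plus)
  also have "\<dots> = (\<integral>x. f (c + x) \<partial>lborel)" by (rule integral_distr) auto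
  finally show ?thesis by simp
qed

lemma test_fun_props:
  fixes \<phi> :: "'a::euclidean_space \<Rightarrow> real"
  assumes "test_fun S \<phi>" "e \<in> Basis"
  shows "continuous_on UNIV \<phi>" "continuous_on UNIV (\<lambda>x. frechet_derivative \<phi> (at x) e)"
    and "\<And>x. ((\<lambda>s. \<phi> (x + s *\<^sub>R e)) has_real_derivative frechet_derivative \<phi> (at x) e) (at 0)"
    and "\<And>x. x \<notin> tsupport \<phi> \<Longrightarrow> \<phi> x = 0" "\<And>x. x \<notin> tsupport \<phi> \<Longrightarrow> frechet_derivative \<phi> (at x) e = 0"
proof -
  have "Ck 1 \<phi>" using assms unfolding test_fun_def smooth_fun_def by blast
  then have d: "\<phi> differentiable (at x)" for x by simp
  then show "continuous_on UNIV \<phi>"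
    by (meson continuous_at_imp_continuous_on differentiable_imp_continuous_within)
  show "continuous_on UNIV (\<lambda>x. frechet_derivative \<phi> (at x) e)"
    using \<open>Ck 1 \<phi>\<close> assms(2) by simp
  show "((\<lambda>s. \<phi> (x + s *\<^sub>R e)) has_real_derivative frechet_derivative \<phi> (at x) e) (at 0)" for x
  proof -
    have "(\<phi> has_derivative frechet_derivative \<phi> (at x)) (at (x + 0 *\<^sub>R e))"
      using d frechet_derivative_works by auto
    moreover have "((\<lambda>s. x + s *\<^sub>R e) has_derivative (\<lambda>s. s *\<^sub>R e)) (at 0)"
      by (auto intro!: derivative_eq_intros)
    ultimately have "((\<lambda>s. \<phi> (x + s *\<^sub>R e)) has_derivative (\<lambda>s. frechet_derivative \<phi> (at x) (s *\<^sub>R e))) (at 0)"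
      by (rule has_derivative_compose[rotated])
    moreover have "(\<lambda>s. frechet_derivative \<phi> (at x) (s *\<^sub>R e)) = (*) (frechet_derivative \<phi> (at x) e)"
      using linear_frechet_derivative[OF d] by (auto simp: linear_cmul)
    ultimately show ?thesis by (simp add: has_field_derivative_def)
  qed
  show z: "\<phi> x = 0" if "x \<notin> tsupport \<phi>" for x
    using that closure_subset[of "{x. \<phi> x \<noteq> 0}"] unfolding tsupport_def by blast
  show "frechet_derivative \<phi> (at x) e = 0" if "x \<notin> tsupport \<phi>" for x
  proof -
    have "open (- tsupport \<phi>)" by (auto simp: tsupport_def)
    then have "(\<phi> has_derivative (\<lambda>_. 0)) (at x)"
      using that z by (intro has_derivative_transform_within_open[OF has_derivative_const[of 0]]) auto
    from frechet_derivative_at[OF this] show ?thesis by metis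
  qed
qed

lemma directional_lipschitz:
  fixes \<phi> :: "'a::euclidean_space \<Rightarrow> real"
  assumes "\<And>x. ((\<lambda>s. \<phi> (x + s *\<^sub>R e)) has_real_derivative \<phi>' x) (at 0)" "\<And>x. \<bar>\<phi>' x\<bar> \<le> B"
  shows "\<bar>\<phi> (x + h *\<^sub>R e) - \<phi> x\<bar> \<le> B * \<bar>h\<bar>"
proof -
  have D: "((\<lambda>s. \<phi> (x + s *\<^sub>R e)) has_real_derivative \<phi>' (x + t *\<^sub>R e)) (at t)" for t
  proof -
    have "((\<lambda>s. \<phi> ((x + t *\<^sub>R e) + s *\<^sub>R e)) has_real_derivative \<phi>' (x + t *\<^sub>R e)) (at 0)" by (rule assms)
    then have "((\<lambda>s. \<phi> (x + (t + s) *\<^sub>R e)) has_real_derivative \<phi>' (x + t *\<^sub>R e)) (at 0)"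
      by (simp add: algebra_simps)
    then show ?thesis using DERIV_shift[of "\<lambda>s. \<phi> (x + s *\<^sub>R e)" "\<phi>' (x + t *\<^sub>R e)" 0 t]
      by (simp add: add.commute)
  qed
  have "norm ((\<lambda>s. \<phi> (x + s *\<^sub>R e)) h - (\<lambda>s. \<phi> (x + s *\<^sub>R e)) 0) \<le> B * norm (h - 0)"
    by (rule field_differentiable_bound[of UNIV _ "\<lambda>t. \<phi>' (x + t *\<^sub>R e)"]) (use D assms(2) in auto)
  then show ?thesis by simp
qed

lemma continuous_imp_bounded_cball:
  fixes f :: "'a::euclidean_space \<Rightarrow> real"
  assumes "continuous_on UNIV f"
  obtains M where "0 \<le> M" "\<And>x. norm x \<le> r \<Longrightarrow> \<bar>f x\<bar> \<le> M"
proof -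
  have "bounded (f ` cball 0 r)"
    by (intro compact_imp_bounded compact_continuous_image continuous_on_subset[OF assms]) auto
  then obtain M where "\<forall>y\<in>f ` cball 0 r. norm y \<le> M" by (auto simp: bounded_iff)
  then show ?thesis by (intro that[of "max 0 M"]) (auto simp: le_max_iff_disj)
qed

text \<open>Shifting the difference quotient from the test function to u replaces Fubini and any
  almost-everywhere differentiability theorem: a Lipschitz function whose one-sided difference
  quotients converge everywhere has that limit as its weak derivative.\<close>

lemma weak_partial_left_quotients:
  fixes u D :: "'a::euclidean_space \<Rightarrow> real"
  assumes e: "e \<in> Basis" and cont: "continuous_on UNIV u"
    and lip: "\<And>x h. \<bar>u (x + h *\<^sub>R e) - u x\<bar> \<le> K * \<bar>h\<bar>"
    and lim: "\<And>x. (\<lambda>n. (u x - u (x - (1 / Suc n) *\<^sub>R e)) * Suc n) \<longlonglongrightarrow> D x"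
  shows "weak_partial S u e D"
  unfolding weak_partial_def
proof (intro allI impI)
  fix \<phi> assume \<phi>: "test_fun S \<phi>"
  define \<phi>' where "\<phi>' = (\<lambda>x. frechet_derivative \<phi> (at x) e)"
  have props: "continuous_on UNIV \<phi>" "continuous_on UNIV \<phi>'"
    "\<And>x. ((\<lambda>s. \<phi> (x + s *\<^sub>R e)) has_real_derivative \<phi>' x) (at 0)"
    "\<And>x. x \<notin> tsupport \<phi> \<Longrightarrow> \<phi> x = 0" "\<And>x. x \<notin> tsupport \<phi> \<Longrightarrow> \<phi>' x = 0"
    unfolding \<phi>'_def by (fact test_fun_props[OF \<phi> e])+
  define h where "h = (\<lambda>n. 1 / real (Suc n))"
  have h: "0 < h n" "h n \<le> 1" "h n * Suc n = 1" for n by (auto simp: h_def field_simps)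
  have T: "tsupport \<phi> \<subseteq> S" "compact (tsupport \<phi>)" using \<phi> by (auto simp: test_fun_def)
  obtain r where r: "\<And>x. x \<in> tsupport \<phi> \<Longrightarrow> norm x \<le> r"
    using compact_imp_bounded[OF T(2)] by (auto simp: bounded_iff)
  \<comment> \<open>All step widths are at most 1, so this ball contains the support of the test
    function and of all its translates; it carries the dominating functions below.\<close>
  define R where "R = r + norm e"
  have R: "norm x \<le> R" if "x \<in> tsupport \<phi>" for x
    using r[OF that] norm_ge_zero[of e] unfolding R_def by linarith
  have Rs: "norm x \<le> R" if "x + h n *\<^sub>R e \<in> tsupport \<phi>" for x n
  proof -
    have "norm x \<le> norm (x + h n *\<^sub>R e) + norm (h n *\<^sub>R e)"
      using norm_triangle_ineq4[of "x + h n *\<^sub>R e" "h n *\<^sub>R e"] by simp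
    also have "norm (h n *\<^sub>R e) \<le> norm e" using h[of n] by (simp add: mult_left_le_one_le)
    finally show ?thesis using r[OF that] by (simp add: R_def)
  qed
  obtain B0 where B0: "0 \<le> B0" "\<And>x. norm x \<le> R \<Longrightarrow> \<bar>\<phi>' x\<bar> \<le> B0"
    by (rule continuous_imp_bounded_cball[OF props(2), of R]) blast
  have B: "\<bar>\<phi>' x\<bar> \<le> B0" for x
    using B0 R[of x] props(5)[of x] by (cases "x \<in> tsupport \<phi>") auto
  obtain Bu where Bu: "0 \<le> Bu" "\<And>x. norm x \<le> R \<Longrightarrow> \<bar>u x\<bar> \<le> Bu"
    by (rule continuous_imp_bounded_cball[OF cont, of R]) blast
  obtain Bp where Bp: "0 \<le> Bp" "\<And>x. norm x \<le> R \<Longrightarrow> \<bar>\<phi> x\<bar> \<le> Bp"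
    by (rule continuous_imp_bounded_cball[OF props(1), of R]) blast
  have lip\<phi>: "\<bar>\<phi> (x + s *\<^sub>R e) - \<phi> x\<bar> \<le> B0 * \<bar>s\<bar>" for x s
    by (rule directional_lipschitz[OF props(3) B])
  have [measurable]: "u \<in> borel_measurable borel" "\<phi> \<in> borel_measurable borel" "\<phi>' \<in> borel_measurable borel"
    using cont props(1,2) by (auto intro: borel_measurable_continuous_onI)
  have mD[measurable]: "D \<in> borel_measurable borel"
    by (rule borel_measurable_LIMSEQ_real[OF lim]) measurable
  have ind: "integrable lborel (\<lambda>x. c * indicator (cball 0 R) x :: real)" for c
    by (intro integrable_mult_right integrable_real_indicator) (use emeasure_bounded_finite[OF bounded_cball, of 0 R] in auto)
  define F where "F = (\<lambda>n x. u x * ((\<phi> (x + h n *\<^sub>R e) - \<phi> x) * Suc n))"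
  have "(\<lambda>n. \<integral>x. F n x \<partial>lborel) \<longlonglongrightarrow> (\<integral>x. u x * \<phi>' x \<partial>lborel)"
  proof (rule integral_dominated_convergence[where w = "\<lambda>x. (Bu * B0) * indicator (cball 0 R) x"])
    show "AE x in lborel. (\<lambda>n. F n x) \<longlonglongrightarrow> u x * \<phi>' x"
    proof (rule AE_I2)
      fix x
      have hl: "filterlim h (at 0) sequentially"
        unfolding h_def filterlim_at using LIMSEQ_inverse_real_of_nat by (auto simp: inverse_eq_divide)
      have "((\<lambda>s. (\<phi> (x + s *\<^sub>R e) - \<phi> x) / s) \<longlongrightarrow> \<phi>' x) (at 0)"
        using props(3)[of x] by (simp add: has_field_derivative_iff)
      from filterlim_compose[OF this hl]
      have "(\<lambda>n. (\<phi> (x + h n *\<^sub>R e) - \<phi> x) / h n) \<longlonglongrightarrow> \<phi>' x" .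
      then show "(\<lambda>n. F n x) \<longlonglongrightarrow> u x * \<phi>' x"
        unfolding F_def by (intro tendsto_mult tendsto_const) (simp add: h_def)
    qed
    show "AE x in lborel. norm (F n x) \<le> (Bu * B0) * indicator (cball 0 R) x" for n
    proof (rule AE_I2)
      fix x
      show "norm (F n x) \<le> (Bu * B0) * indicator (cball 0 R) x"
      proof (cases "norm x \<le> R")
        case True
        have "\<bar>(\<phi> (x + h n *\<^sub>R e) - \<phi> x) * Suc n\<bar> \<le> B0 * \<bar>h n\<bar> * Suc n"
          unfolding abs_mult using lip\<phi>[of x "h n"] by (intro mult_mono) auto
        also have "\<dots> = B0" using h[of n] by simp
        finally have "\<bar>u x\<bar> * \<bar>(\<phi> (x + h n *\<^sub>R e) - \<phi> x) * Suc n\<bar> \<le> Bu * B0"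
          using Bu True B0(1) by (intro mult_mono) auto
        then show ?thesis using True by (simp add: F_def abs_mult)
      next
        case False
        then have "\<phi> x = 0" "\<phi> (x + h n *\<^sub>R e) = 0" using R Rs props(4) by blast+
        then show ?thesis using Bu(1) B0(1) by (simp add: F_def)
      qed
    qed
    show "F n \<in> borel_measurable lborel" for n unfolding F_def by measurable
  qed (use ind in auto)
  moreover have "(\<integral>x. F n x \<partial>lborel) = - (\<integral>x. \<phi> x * ((u x - u (x - h n *\<^sub>R e)) * Suc n) \<partial>lborel)" for n
  proof -
    have i1: "integrable lborel (\<lambda>x. u x * \<phi> (x + h n *\<^sub>R e))"
      by (rule integrable_continuous_bounded_support[where r = R])
        (use Rs props(4) in \<open>auto intro!: continuous_intros cont continuous_on_compose2[OF props(1)]\<close>)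
    have i2: "integrable lborel (\<lambda>x. u x * \<phi> x)"
      by (rule integrable_continuous_bounded_support[where r = R])
        (use R props(4) in \<open>auto intro!: continuous_intros cont props(1)\<close>)
    have i3: "integrable lborel (\<lambda>x. u (x - h n *\<^sub>R e) * \<phi> x)"
      by (rule integrable_continuous_bounded_support[where r = R])
        (use R props(4) in \<open>auto intro!: continuous_intros props(1) continuous_on_compose2[OF cont]\<close>)
    have "(\<integral>x. u x * \<phi> (x + h n *\<^sub>R e) \<partial>lborel) = (\<integral>x. u (x - h n *\<^sub>R e) * \<phi> x \<partial>lborel)"
      using lborel_integral_shift[of "\<lambda>x. u (x - h n *\<^sub>R e) * \<phi> x" "h n *\<^sub>R e"] by (simp add: add.commute)
    then have "(\<integral>x. F n x \<partial>lborel) = ((\<integral>x. u (x - h n *\<^sub>R e) * \<phi> x \<partial>lborel) - (\<integral>x. u x * \<phi> x \<partial>lborel)) * Suc n"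
      using i1 i2 by (simp add: F_def algebra_simps flip: Bochner_Integration.integral_diff)
        (simp add: algebra_simps)
    also have "\<dots> = - (\<integral>x. (u x * \<phi> x - u (x - h n *\<^sub>R e) * \<phi> x) * Suc n \<partial>lborel)"
      using i2 i3 by (simp add: algebra_simps)
    finally show ?thesis by (simp add: algebra_simps)
  qed
  moreover have "(\<lambda>n. \<integral>x. \<phi> x * ((u x - u (x - h n *\<^sub>R e)) * Suc n) \<partial>lborel) \<longlonglongrightarrow> (\<integral>x. \<phi> x * D x \<partial>lborel)"
  proof (rule integral_dominated_convergence[where w = "\<lambda>x. (Bp * K) * indicator (cball 0 R) x"])
    show "AE x in lborel. (\<lambda>n. \<phi> x * ((u x - u (x - h n *\<^sub>R e)) * Suc n)) \<longlonglongrightarrow> \<phi> x * D x"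
      using lim by (auto intro!: tendsto_mult tendsto_const simp: h_def)
    show "AE x in lborel. norm (\<phi> x * ((u x - u (x - h n *\<^sub>R e)) * Suc n)) \<le> (Bp * K) * indicator (cball 0 R) x" for n
    proof (rule AE_I2)
      fix x
      show "norm (\<phi> x * ((u x - u (x - h n *\<^sub>R e)) * Suc n)) \<le> (Bp * K) * indicator (cball 0 R) x"
      proof (cases "x \<in> tsupport \<phi>")
        case True
        have "\<bar>(u x - u (x - h n *\<^sub>R e)) * Suc n\<bar> \<le> K * \<bar>- h n\<bar> * Suc n"
          unfolding abs_mult using lip[of x "- h n"] by (intro mult_mono) (auto simp: abs_minus_commute)
        also have "\<dots> = K" using h[of n] by simp
        finally have "\<bar>\<phi> x\<bar> * \<bar>(u x - u (x - h n *\<^sub>R e)) * Suc n\<bar> \<le> Bp * K"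
          using Bp R[OF True] by (intro mult_mono) auto
        then show ?thesis using R[OF True] by (simp add: abs_mult)
      next
        case False
        have "0 \<le> K * \<bar>1\<bar>" using lip[of 0 1] by linarith
        then show ?thesis using props(4)[OF False] Bp(1) by simp
      qed
    qed
  qed (use ind in auto)
  ultimately have "(\<lambda>n. \<integral>x. F n x \<partial>lborel) \<longlonglongrightarrow> (\<integral>x. u x * \<phi>' x \<partial>lborel)"
    "(\<lambda>n. \<integral>x. F n x \<partial>lborel) \<longlonglongrightarrow> - (\<integral>x. \<phi> x * D x \<partial>lborel)"
    by (auto intro: tendsto_minus)
  then have eq: "(\<integral>x. u x * \<phi>' x \<partial>lborel) = - (\<integral>x. D x * \<phi> x \<partial>lborel)"
    using LIMSEQ_unique by (auto simp: mult.commute)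
  have "(\<lambda>x. indicator S x *\<^sub>R (u x * \<phi>' x)) = (\<lambda>x. u x * \<phi>' x)"
    "(\<lambda>x. indicator S x *\<^sub>R (D x * \<phi> x)) = (\<lambda>x. D x * \<phi> x)"
    using props(4,5) T(1) by (fastforce simp: indicator_def)+
  then have "(LINT x:S|lebesgue. u x * \<phi>' x) = - (LINT x:S|lebesgue. D x * \<phi> x)"
    using eq unfolding set_lebesgue_integral_def by (simp add: integral_completion)
  then show "(LINT x:S|lebesgue. u x * frechet_derivative \<phi> (at x) e) = - (LINT x:S|lebesgue. D x * \<phi> x)"
    unfolding \<phi>'_def .
qed

section \<open>The fundamental lemma of the calculus of variations\<close>

lemma test_fun_continuous: "test_fun S \<phi> \<Longrightarrow> continuous_on UNIV \<phi>"
  unfolding test_fun_def smooth_fun_def by (metis Ck.simps(1))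

lemma test_fun_borel: "test_fun S \<phi> \<Longrightarrow> \<phi> \<in> borel_measurable borel"
  by (intro borel_measurable_continuous_onI test_fun_continuous)

text \<open>Smooth bumps converge boundedly to the indicators of boxes, so dominated convergence
  turns vanishing against test functions into vanishing integrals over boxes.\<close>

lemma test_zero_imp_AE_zero:
  fixes h :: "'a::euclidean_space \<Rightarrow> real"
  assumes int: "set_integrable lebesgue (box A B) h"
    and zero: "\<And>\<phi>. test_fun (box A B) \<phi> \<Longrightarrow> (LINT x:box A B|lebesgue. h x * \<phi> x) = 0"
  shows "AE x in lebesgue. x \<in> box A B \<longrightarrow> h x = 0"
proof -
  define H where "H = (\<lambda>x. indicator (box A B) x * h x)"
  have H: "integrable lebesgue H" using int unfolding set_integrable_def H_def by simp
  then have Hm[measurable]: "H \<in> borel_measurable lebesgue" by auto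
  \<comment> \<open>A Borel version is taken because the argument with measures on boxes lives on
    \<open>lborel\<close>, whereas h is only Lebesgue measurable.\<close>
  obtain H' where H': "H' \<in> borel_measurable lborel" "AE x in lborel. H x = H' x"
    using completion_ex_borel_measurable_real[OF Hm] by blast
  have H'm[measurable]: "H' \<in> borel_measurable borel" using H'(1) by simp
  have H'm2: "H' \<in> borel_measurable lebesgue" using H'(1) by (rule measurable_completion)
  have ae: "AE x in lebesgue. H x = H' x" using H'(2) by (rule AE_completion)
  have "integrable lebesgue H'"
    using integrable_cong_AE[OF Hm H'm2 ae] H by simp
  then have intH': "integrable lborel H'" using integrable_completion[OF H'(1)] by simp
  have "(\<integral>x. indicator (box l u) x * H' x \<partial>lborel) = 0" for l u :: 'a
  proof -
    \<comment> \<open>The part of a box inside the domain is again a box, so its bumps are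
      admissible test functions.\<close>
    have "\<exists>l' u'. box l u \<inter> box A B = box l' u'"
      unfolding box_Int_box by blast
    then obtain l' u' where lu: "box l u \<inter> box A B = box l' u'" by blast
    then have sub: "box l' u' \<subseteq> box A B" by blast
    have im: "(indicator (box l u) :: 'a \<Rightarrow> real) \<in> borel_measurable lebesgue" for l u :: 'a
      by (intro measurable_completion) auto
    have bm: "box_bump n l' u' \<in> borel_measurable lebesgue" for n
      using test_fun_borel[OF test_fun_box_bump[OF sub]] by (intro measurable_completion) simp
    have "(\<lambda>n. \<integral>x. box_bump n l' u' x * H x \<partial>lebesgue) \<longlonglongrightarrow> (\<integral>x. indicator (box l' u') x * H x \<partial>lebesgue)"
    proof (rule integral_dominated_convergence[where w = "\<lambda>x. \<bar>H x\<bar>"])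
      show "AE x in lebesgue. (\<lambda>n. box_bump n l' u' x * H x) \<longlonglongrightarrow> indicator (box l' u') x * H x"
        by (intro AE_I2 tendsto_mult box_bump_tendsto tendsto_const)
      show "AE x in lebesgue. norm (box_bump n l' u' x * H x) \<le> \<bar>H x\<bar>" for n
        using box_bump_range[of n l' u'] by (auto simp: abs_mult intro!: AE_I2 mult_left_le_one_le)
    qed (use H bm im in \<open>auto intro: borel_measurable_times\<close>)
    moreover have "(\<integral>x. box_bump n l' u' x * H x \<partial>lebesgue) = 0" for n
      using zero[OF test_fun_box_bump[OF sub, of n]]
      by (simp add: set_lebesgue_integral_def H_def mult.commute mult.left_commute)
    ultimately have "(\<integral>x. indicator (box l' u') x * H x \<partial>lebesgue) = 0"
      by (simp add: LIMSEQ_const_iff)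
    moreover have "(\<lambda>x. indicator (box l' u') x * H x) = (\<lambda>x. indicator (box l u) x * H x)"
      unfolding lu[symmetric] H_def by (auto simp: indicator_def)
    ultimately have "(\<integral>x. indicator (box l u) x * H x \<partial>lebesgue) = 0" by simp
    moreover have "(\<integral>x. indicator (box l u) x * H x \<partial>lebesgue) = (\<integral>x. indicator (box l u) x * H' x \<partial>lebesgue)"
      using ae by (intro integral_cong_AE) (auto intro: H'm2 im borel_measurable_times)
    moreover have "(\<integral>x. indicator (box l u) x * H' x \<partial>lebesgue) = (\<integral>x. indicator (box l u) x * H' x \<partial>lborel)"
      by (rule integral_completion) measurable
    ultimately show ?thesis by simp
  qed
  from box_integrals_zero_imp_AE_zero[OF intH' this] have "AE x in lebesgue. H' x = 0"
    by (rule AE_completion)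
  with ae show ?thesis by eventually_elim (auto simp: H_def)
qed

section \<open>Primitives of test functions and weakly constant functions\<close>

lemma smooth_fun_antiderivative:
  fixes \<Theta> \<theta> :: "real \<Rightarrow> real"
  assumes "smooth_fun \<theta>" "\<And>x. (\<Theta> has_real_derivative \<theta> x) (at x)"
  shows "smooth_fun \<Theta>" "frechet_derivative \<Theta> (at x) 1 = \<theta> x"
proof -
  have fd: "frechet_derivative \<Theta> (at x) 1 = \<theta> x" for x
    using frechet_derivative_at[OF has_field_derivative_imp_has_derivative[OF assms(2)]] by (metis mult_1_right)
  then show "frechet_derivative \<Theta> (at x) 1 = \<theta> x" .
  have "\<Theta> differentiable (at x)" for x using assms(2) real_differentiable_def by blast
  then have "Ck (Suc k) \<Theta>" for k using assms(1) fd by (simp add: smooth_fun_def)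
  then show "smooth_fun \<Theta>" unfolding smooth_fun_def using Ck_SucD by blast
qed

lemma test_fun_linear:
  assumes "test_fun S \<phi>" "test_fun S \<psi>"
  shows "test_fun S (\<lambda>x. \<phi> x + c * \<psi> x)"
proof -
  have "tsupport (\<lambda>x. \<phi> x + c * \<psi> x) \<subseteq> tsupport \<phi> \<union> tsupport \<psi>"
    unfolding tsupport_def closure_Un[symmetric] by (intro closure_mono) auto
  moreover have "compact (tsupport \<phi> \<union> tsupport \<psi>)" using assms by (auto simp: test_fun_def)
  ultimately have "compact (tsupport (\<lambda>x. \<phi> x + c * \<psi> x))"
    by (metis closed_closure compact_Int_closed inf.absorb_iff2 tsupport_def)
  moreover have "smooth_fun (\<lambda>x. \<phi> x + c * \<psi> x)"
    using assms unfolding test_fun_def smooth_fun_def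
    by (intro allI Ck_add Ck_mult Ck_const) auto
  ultimately show ?thesis
    using \<open>tsupport _ \<subseteq> _\<close> assms unfolding test_fun_def by blast
qed

lemma test_fun_support_interval:
  fixes \<theta> :: "real \<Rightarrow> real"
  assumes "test_fun {a<..<b} \<theta>" "a < b"
  obtains a' b' where "a < a'" "a' \<le> b'" "b' < b" "\<And>x. \<theta> x \<noteq> 0 \<Longrightarrow> a' \<le> x \<and> x \<le> b'"
proof (cases "tsupport \<theta> = {}")
  case True
  then have "\<theta> x = 0" for x using test_fun_props(4)[OF assms(1), of 1 x] by simp
  then show ?thesis using assms(2) that[of "(a + b) / 2" "(a + b) / 2"] by auto
next
  case False
  have K: "compact (tsupport \<theta>)" "tsupport \<theta> \<subseteq> {a<..<b}" using assms(1) by (auto simp: test_fun_def)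
  obtain l where l: "l \<in> tsupport \<theta>" "\<And>x. x \<in> tsupport \<theta> \<Longrightarrow> l \<le> x"
    using compact_attains_inf[OF K(1) False] by blast
  obtain u where u: "u \<in> tsupport \<theta>" "\<And>x. x \<in> tsupport \<theta> \<Longrightarrow> x \<le> u"
    using compact_attains_sup[OF K(1) False] by blast
  have "x \<in> tsupport \<theta>" if "\<theta> x \<noteq> 0" for x using test_fun_props(4)[OF assms(1), of 1 x] that by auto
  then show ?thesis using l u K(2) that[of l u] by (meson greaterThanLessThan_iff subsetD)
qed

text \<open>The integral from a vanishes to the left of the support trivially and to the right of it
  because the total integral is zero; hence the primitive is again compactly supported in the
  interval.\<close>

lemma test_fun_antiderivative:
  fixes \<theta> :: "real \<Rightarrow> real"
  assumes \<theta>: "test_fun {a<..<b} \<theta>" and "a < b" and zero: "(\<integral>x. \<theta> x \<partial>lborel) = 0"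
  obtains \<Theta> where "test_fun {a<..<b} \<Theta>" "\<And>x. frechet_derivative \<Theta> (at x) 1 = \<theta> x"
proof -
  obtain a' b' where ab: "a < a'" "a' \<le> b'" "b' < b" "\<And>x. \<theta> x \<noteq> 0 \<Longrightarrow> a' \<le> x \<and> x \<le> b'"
    using test_fun_support_interval[OF \<theta> \<open>a < b\<close>] by blast
  have cont: "continuous_on UNIV \<theta>" using \<theta> by (rule test_fun_continuous)
  define \<Theta> where "\<Theta> = (\<lambda>x. integral {a..x} \<theta>)"
  have left: "\<Theta> x = 0" if "x < a'" for x
    unfolding \<Theta>_def by (rule integral_unique, rule has_integral_is_0) (use ab(4) that in force)
  have right: "\<Theta> x = 0" if "b' < x" for x
  proof -
    have "integrable lborel \<theta>"
      by (rule integrable_continuous_bounded_support[OF cont, where r = "\<bar>a'\<bar> + \<bar>b'\<bar>"]) (use ab(4) in force)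
    then have "(\<theta> has_integral 0) UNIV" using has_integral_integral_lborel[of \<theta>] zero by simp
    moreover have empty: "{y \<in> UNIV - {a..x}. \<theta> y \<noteq> 0} = {}" "{y \<in> {a..x} - UNIV. \<theta> y \<noteq> 0} = {}"
      using ab that by fastforce+
    ultimately have "(\<theta> has_integral 0) {a..x}"
      using has_integral_spike_set_eq[of UNIV "{a..x}" \<theta> 0] unfolding empty by simp
    then show ?thesis unfolding \<Theta>_def by (rule integral_unique)
  qed
  have D: "(\<Theta> has_real_derivative \<theta> x) (at x)" for x
  proof (cases "x < a'")
    case True
    then have "((\<lambda>_. 0) has_real_derivative \<theta> x) (at x)" using ab(4)[of x] by fastforce
    then show ?thesis
      by (rule has_field_derivative_transform_within_open[where S = "{..<a'}"]) (use True left in auto)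
  next
    case False
    have "(\<Theta> has_real_derivative \<theta> x) (at x within {a..x + 1})"
      unfolding \<Theta>_def using False ab by (intro integral_has_real_derivative continuous_on_subset[OF cont]) auto
    then show ?thesis using False ab by (subst (asm) at_within_interior) auto
  qed
  have sm: "smooth_fun \<theta>" using \<theta> by (simp add: test_fun_def)
  have "tsupport \<Theta> \<subseteq> {a'..b'}" unfolding tsupport_def
    using left right by (intro closure_minimal) (auto simp: not_less[symmetric])
  moreover from this have "compact (tsupport \<Theta>)"
    by (metis closed_closure compact_Icc compact_Int_closed inf.absorb_iff2 tsupport_def)
  ultimately have "test_fun {a<..<b} \<Theta>"
    using smooth_fun_antiderivative(1)[OF sm D] ab unfolding test_fun_def by fastforce
  then show ?thesis using that smooth_fun_antiderivative(2)[OF sm D] by blast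
qed

lemma set_integral_test_fun:
  assumes "test_fun S \<phi>" "S \<in> sets lebesgue"
  shows "(LINT x:S|lebesgue. \<phi> x) = (\<integral>x. \<phi> x \<partial>lborel)"
proof -
  have "(\<lambda>x. indicator S x *\<^sub>R \<phi> x) = \<phi>"
  proof
    fix x
    have "{x. \<phi> x \<noteq> 0} \<subseteq> tsupport \<phi>" unfolding tsupport_def by (rule closure_subset)
    then show "indicator S x *\<^sub>R \<phi> x = \<phi> x" using assms(1) unfolding test_fun_def indicator_def by auto
  qed
  then show ?thesis
    unfolding set_lebesgue_integral_def using test_fun_borel[OF assms(1)] by (simp add: integral_completion)
qed

lemma set_integrable_mult_test:
  fixes u :: "'a::euclidean_space \<Rightarrow> real"
  assumes "set_integrable lebesgue S u" "test_fun S \<phi>"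
  shows "set_integrable lebesgue S (\<lambda>x. u x * \<phi> x)"
proof -
  have "bounded (tsupport \<phi>)" using assms(2) compact_imp_bounded by (auto simp: test_fun_def)
  then obtain r where r: "\<And>x. x \<in> tsupport \<phi> \<Longrightarrow> norm x \<le> r" by (auto simp: bounded_iff)
  obtain B where B: "0 \<le> B" "\<And>x. norm x \<le> r \<Longrightarrow> \<bar>\<phi> x\<bar> \<le> B"
    by (rule continuous_imp_bounded_cball[OF test_fun_continuous[OF assms(2)], of r]) blast
  obtain e :: 'a where "e \<in> Basis" using nonempty_Basis by blast
  then have b: "\<bar>\<phi> x\<bar> \<le> B" for x
    using B r[of x] test_fun_props(4)[OF assms(2), of e x] by (cases "x \<in> tsupport \<phi>") auto
  have m: "\<phi> \<in> borel_measurable lebesgue" using test_fun_borel[OF assms(2)] by (intro measurable_completion) simp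
  define U where "U = (\<lambda>x. indicator S x *\<^sub>R u x)"
  have U: "integrable lebesgue U" using assms(1) by (simp add: set_integrable_def U_def)
  have "integrable lebesgue (\<lambda>x. U x * \<phi> x)"
  proof (rule Bochner_Integration.integrable_bound[of lebesgue "\<lambda>x. B * U x"])
    show "AE x in lebesgue. norm (U x * \<phi> x) \<le> norm (B * U x)"
    proof (rule AE_I2)
      fix x
      have "\<bar>U x\<bar> * \<bar>\<phi> x\<bar> \<le> \<bar>U x\<bar> * B" using b by (intro mult_left_mono) auto
      then show "norm (U x * \<phi> x) \<le> norm (B * U x)" using B(1) by (simp add: abs_mult mult.commute)
    qed
    show "(\<lambda>x. U x * \<phi> x) \<in> borel_measurable lebesgue" using U m by (intro borel_measurable_times) auto
  qed (use U in simp)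
  then show ?thesis by (simp add: set_integrable_def U_def mult.assoc)
qed

text \<open>The du Bois-Reymond argument: subtracting a multiple of a fixed bump
  \<open>\<eta>\<close> gives any test function mean zero, hence a primitive that is itself a test
  function. The constant is the mean of u with weight \<open>\<eta>\<close>.\<close>

lemma weakly_constant_imp_AE_const:
  fixes u :: "real \<Rightarrow> real"
  assumes "a < b" and int: "set_integrable lebesgue {a<..<b} u"
    and zero: "\<And>\<phi>. test_fun {a<..<b} \<phi> \<Longrightarrow> (LINT x:{a<..<b}|lebesgue. u x * frechet_derivative \<phi> (at x) 1) = 0"
  shows "\<exists>\<kappa>. AE x in lebesgue. x \<in> {a<..<b} \<longrightarrow> u x = \<kappa>"
proof -
  let ?I = "{a<..<b}"
  have box: "?I = box a b" by (simp add: box_real)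
  have bt: "test_fun ?I (box_bump n a b)" for n
    by (rule test_fun_box_bump) (simp add: box_real)
  \<comment> \<open>Small n may give the zero function; the limit b - a > 0 supplies a bump with
    positive integral.\<close>
  have "(\<lambda>n. \<integral>x. box_bump n a b x \<partial>lborel) \<longlonglongrightarrow> (\<integral>x. indicator (box a b) x \<partial>lborel)"
  proof (rule integral_dominated_convergence[where w = "\<lambda>x. indicator ?I x"])
    show "AE x in lborel. (\<lambda>n. box_bump n a b x) \<longlonglongrightarrow> indicator (box a b) x"
      by (intro AE_I2 box_bump_tendsto)
    show "AE x in lborel. norm (box_bump n a b x) \<le> indicator ?I x" for n
    proof (rule AE_I2)
      fix x
      show "norm (box_bump n a b x) \<le> indicator ?I x"
        using box_bump_nonzero[of n a b x] shrunk_cbox_subset[of a n b] box_bump_range[of n a b x]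
        unfolding box by (cases "box_bump n a b x = 0") (auto simp: indicator_def)
    qed
  qed (use test_fun_borel[OF bt] assms(1) in auto)
  then have "(\<lambda>n. \<integral>x. box_bump n a b x \<partial>lborel) \<longlonglongrightarrow> b - a" using assms(1) by (simp add: box_real)
  then have "\<forall>\<^sub>F n in sequentially. 0 < (\<integral>x. box_bump n a b x \<partial>lborel)"
    by (rule order_tendstoD) (use assms(1) in simp)
  then obtain n where n: "0 < (\<integral>x. box_bump n a b x \<partial>lborel)"
    using eventually_happens'[OF sequentially_bot] by blast
  define \<eta> where "\<eta> = box_bump n a b"
  define E where "E = (\<integral>x. \<eta> x \<partial>lborel)"
  have E: "0 < E" using n by (simp add: E_def \<eta>_def)
  have \<eta>: "test_fun ?I \<eta>" using bt by (simp add: \<eta>_def)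
  have intt: "integrable lborel \<phi>" if \<phi>: "test_fun ?I \<phi>" for \<phi> :: "real \<Rightarrow> real"
  proof -
    obtain a' b' where "\<And>x. \<phi> x \<noteq> 0 \<Longrightarrow> a' \<le> x \<and> x \<le> b'"
      using test_fun_support_interval[OF \<phi> assms(1)] by blast
    then show ?thesis
      by (intro integrable_continuous_bounded_support[OF test_fun_continuous[OF \<phi>], where r = "\<bar>a'\<bar> + \<bar>b'\<bar>"]) force
  qed
  define \<kappa> where "\<kappa> = (LINT x:?I|lebesgue. u x * \<eta> x) / E"
  have int\<kappa>: "set_integrable lebesgue ?I (\<lambda>x. \<kappa>)"
    unfolding set_integrable_def by (intro integrable_scaleR_left integrable_real_indicator) (auto simp: assms less_imp_le)
  have "(LINT x:?I|lebesgue. (u x - \<kappa>) * \<psi> x) = 0" if \<psi>: "test_fun ?I \<psi>" for \<psi>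
  proof -
    define s where "s = (\<integral>x. \<psi> x \<partial>lborel) / E"
    define \<theta> where "\<theta> = (\<lambda>x. \<psi> x + (- s) * \<eta> x)"
    have \<theta>: "test_fun ?I \<theta>" unfolding \<theta>_def by (rule test_fun_linear[OF \<psi> \<eta>])
    have "(\<integral>x. \<theta> x \<partial>lborel) = (\<integral>x. \<psi> x \<partial>lborel) - s * E"
      unfolding \<theta>_def E_def using intt[OF \<psi>] intt[OF \<eta>] by simp
    also have "\<dots> = 0" using E by (simp add: s_def)
    finally obtain \<Theta> where \<Theta>: "test_fun ?I \<Theta>" "\<And>x. frechet_derivative \<Theta> (at x) 1 = \<theta> x"
      using test_fun_antiderivative[OF \<theta> assms(1)] by blast
    have "0 = (LINT x:?I|lebesgue. u x * \<theta> x)" using zero[OF \<Theta>(1)] unfolding \<Theta>(2) by simp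
    also have "\<dots> = (LINT x:?I|lebesgue. u x * \<psi> x - s * (u x * \<eta> x))"
      unfolding \<theta>_def by (simp add: algebra_simps)
    also have "\<dots> = (LINT x:?I|lebesgue. u x * \<psi> x) - s * (LINT x:?I|lebesgue. u x * \<eta> x)"
      using set_integrable_mult_test[OF int \<psi>] set_integrable_mult_test[OF int \<eta>]
      by (subst set_integral_diff(2)) (auto intro!: set_integrable_mult_right)
    also have "s * (LINT x:?I|lebesgue. u x * \<eta> x) = \<kappa> * (\<integral>x. \<psi> x \<partial>lborel)"
      using E by (simp add: s_def \<kappa>_def)
    also have "(\<integral>x. \<psi> x \<partial>lborel) = (LINT x:?I|lebesgue. \<psi> x)"
      using set_integral_test_fun[OF \<psi>] by simp
    finally have "(LINT x:?I|lebesgue. u x * \<psi> x) - \<kappa> * (LINT x:?I|lebesgue. \<psi> x) = 0" by simp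
    moreover have "(LINT x:?I|lebesgue. (u x - \<kappa>) * \<psi> x) =
        (LINT x:?I|lebesgue. u x * \<psi> x) - (LINT x:?I|lebesgue. \<kappa> * \<psi> x)"
      unfolding left_diff_distrib
      by (rule set_integral_diff(2)[OF set_integrable_mult_test[OF int \<psi>] set_integrable_mult_test[OF int\<kappa> \<psi>]])
    ultimately show ?thesis by simp
  qed
  moreover have "set_integrable lebesgue ?I (\<lambda>x. u x - \<kappa>)" by (rule set_integral_diff(1)[OF int int\<kappa>])
  ultimately have "AE x in lebesgue. x \<in> box a b \<longrightarrow> u x - \<kappa> = 0"
    unfolding box by (intro test_zero_imp_AE_zero)
  then show ?thesis unfolding box by (intro exI[of _ \<kappa>]) simp
qed

section \<open>Lagrange interpolation\<close>

text \<open>Lagrange basis polynomial without its denominator. For s in [0,1] and n > 0 every factor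
  lies in [-1,1], as the product trees require; the large denominators go into the output
  weights.\<close>

definition nodal :: "nat \<Rightarrow> nat \<Rightarrow> real \<Rightarrow> real" where
  "nodal n j s = (\<Prod>i\<in>{..n} - {j}. s - real i / real n)"

lemma nodal_at_node:
  assumes "0 < n" "j \<le> n"
  shows "\<bar>nodal n j (j / n)\<bar> = fact j * fact (n - j) / real n ^ n"
proof -
  have "\<bar>nodal n j (j / n)\<bar> = (\<Prod>i\<in>{..n} - {j}. \<bar>real j - real i\<bar> / n)"
    unfolding nodal_def abs_prod using assms(1) by (intro prod.cong) (auto simp flip: diff_divide_distrib)
  also have "\<dots> = (\<Prod>i\<in>{..n} - {j}. \<bar>real j - real i\<bar>) / (\<Prod>i\<in>{..n} - {j}. real n)"
    by (rule prod_dividef)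
  also have "(\<Prod>i\<in>{..n} - {j}. real n) = real n ^ n" using assms(2) by simp
  also have "{..n} - {j} = {..<j} \<union> {j<..n}" using assms(2) by auto
  also have "(\<Prod>i\<in>{..<j} \<union> {j<..n}. \<bar>real j - real i\<bar>) =
      (\<Prod>i<j. \<bar>real j - real i\<bar>) * (\<Prod>i\<in>{j<..n}. \<bar>real j - real i\<bar>)"
    by (rule prod.union_disjoint) auto
  also have "(\<Prod>i<j. \<bar>real j - real i\<bar>) = fact j"
  proof -
    have "(\<Prod>i<j. \<bar>real j - real i\<bar>) = (\<Prod>i\<in>{1..j}. real i)"
      by (rule prod.reindex_bij_witness[of _ "\<lambda>i. j - i" "\<lambda>i. j - i"]) auto
    then show ?thesis by (simp add: fact_prod)
  qed
  also have "(\<Prod>i\<in>{j<..n}. \<bar>real j - real i\<bar>) = fact (n - j)"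
  proof -
    have "(\<Prod>i\<in>{j<..n}. \<bar>real j - real i\<bar>) = (\<Prod>i\<in>{1..n - j}. real i)"
      by (rule prod.reindex_bij_witness[of _ "\<lambda>i. i + j" "\<lambda>i. i - j"]) auto
    then show ?thesis by (simp add: fact_prod)
  qed
  finally show ?thesis .
qed

text \<open>The weight is n^n / (j! (n-j)!) = (n choose j) (n^n / n!). The binomial is at most 2^n,
  and n^n / n! is a single term of the series of exp n.\<close>

lemma nodal_weight_bound:
  assumes "0 < n" "j \<le> n"
  shows "\<bar>1 / nodal n j (j / n)\<bar> \<le> (2 * exp 1) ^ n"
proof -
  have "real n ^ n / fact n \<le> exp (real n)"
    using sum_le_suminf[OF summable_exp[of "real n"], of "{n}"] by (simp add: exp_def divide_inverse mult.commute)
  also have "\<dots> = exp 1 ^ n" using exp_of_nat_mult[of n "1::real"] by simp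
  finally have e: "real n ^ n / fact n \<le> exp 1 ^ n" .
  have "\<bar>1 / nodal n j (j / n)\<bar> = real n ^ n / (fact j * fact (n - j))"
    unfolding abs_divide nodal_at_node[OF assms] by simp
  also have "\<dots> = real (n choose j) * (real n ^ n / fact n)"
    using binomial_fact[OF assms(2), where 'a = real] by simp
  also have "\<dots> \<le> 2 ^ n * exp 1 ^ n"
  proof (rule mult_mono[OF _ e])
    have "(n choose j) \<le> 2 ^ n" using binomial_le_pow2 by blast
    then show "real (n choose j) \<le> 2 ^ n" by (metis of_nat_le_iff of_nat_numeral of_nat_power)
  qed auto
  finally show ?thesis by (simp add: power_mult_distrib)
qed

lemma nodal_other_node: "nodal n j (i / n) = 0" if "i \<le> n" "i \<noteq> j" for i :: nat
  unfolding nodal_def using that by (auto simp: prod_zero_iff)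

lemma lagrange_interpolation:
  fixes P :: "real poly"
  assumes "0 < n" "degree P \<le> n"
  shows "poly P s = (\<Sum>j\<le>n. poly P (j / n) / nodal n j (j / n) * nodal n j s)"
proof -
  define q where "q = (\<lambda>j. \<Prod>i\<in>{..n} - {j}. [:- (real i / n), 1:])"
  define Q where "Q = (\<Sum>j\<le>n. smult (poly P (j / n) / nodal n j (j / n)) (q j))"
  have q: "poly (q j) s = nodal n j s" for j s
    by (simp add: q_def nodal_def poly_prod)
  have Q: "poly Q s = (\<Sum>j\<le>n. poly P (j / n) / nodal n j (j / n) * nodal n j s)" for s
    by (simp add: Q_def poly_sum q)
  have "degree (q j) \<le> n" if "j \<le> n" for j
  proof -
    have "degree (q j) \<le> (\<Sum>i\<in>{..n} - {j}. degree [:- (real i / n), 1:])"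
      unfolding q_def using degree_prod_sum_le by (metis finite_Diff finite_atMost comp_apply sum.cong)
    also have "\<dots> \<le> n" using that by simp
    finally show ?thesis .
  qed
  then have degQ: "degree Q \<le> n"
    unfolding Q_def by (intro degree_sum_le) (auto intro: order_trans[OF degree_smult_le])
  have "P = Q"
  proof (rule poly_eqI_degree)
    let ?A = "(\<lambda>j. real j / real n) ` {..n}"
    have "card ?A = n + 1"
      using assms(1) by (subst card_image) (auto simp: inj_on_def)
    then show "degree P < card ?A" "degree Q < card ?A" using assms(2) degQ by auto
    fix x assume "x \<in> ?A"
    then obtain i where i: "i \<le> n" "x = i / n" by auto
    have "poly Q x = (\<Sum>j\<le>n. if j = i then poly P (i / n) / nodal n i (i / n) * nodal n i (i / n) else 0)"
      unfolding Q i(2) using i(1) by (intro sum.cong) (auto simp: nodal_other_node)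
    also have "\<dots> = poly P x"
    proof -
      have "nodal n i (i / n) \<noteq> 0" using nodal_at_node[OF assms(1) i(1)] assms(1) by auto
      then show ?thesis using i by simp
    qed
    finally show "poly P x = poly Q x" by simp
  qed
  then show ?thesis using Q by metis
qed

section \<open>One-sided difference quotients\<close>

text \<open>One-sided quotients, because their limits exist at every point for all functions built from
  affine functions, products and ReLU.\<close>

definition left_quot :: "'a::real_normed_vector \<Rightarrow> ('a \<Rightarrow> real) \<Rightarrow> 'a \<Rightarrow> nat \<Rightarrow> real" where
  "left_quot e u x n = (u x - u (x - (1 / real (Suc n)) *\<^sub>R e)) * real (Suc n)"

definition left_diff :: "'a::real_normed_vector \<Rightarrow> ('a \<Rightarrow> real) \<Rightarrow> bool" where
  "left_diff e u \<longleftrightarrow> (\<forall>x. convergent (left_quot e u x))"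

section \<open>Closure of one-sided differentiability under the operations of networks\<close>

lemma left_diff_const: "left_diff e (\<lambda>x. c)"
proof -
  have "left_quot e (\<lambda>x. c) x = (\<lambda>n. 0)" for x by (auto simp: left_quot_def)
  then show ?thesis by (simp add: left_diff_def convergent_const)
qed

lemma left_diff_add:
  assumes "left_diff e u" "left_diff e v"
  shows "left_diff e (\<lambda>x. u x + v x)"
proof -
  have "left_quot e (\<lambda>x. u x + v x) x = (\<lambda>n. left_quot e u x n + left_quot e v x n)" for x
    by (auto simp: left_quot_def algebra_simps)
  then show ?thesis using assms by (simp add: left_diff_def convergent_add)
qed

lemma left_diff_cmult:
  assumes "left_diff e u"
  shows "left_diff e (\<lambda>x. c * u x)"
proof -
  have "left_quot e (\<lambda>x. c * u x) x = (\<lambda>n. c * left_quot e u x n)" for x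
    by (auto simp: left_quot_def algebra_simps)
  then show ?thesis using assms by (simp add: left_diff_def convergent_mult convergent_const)
qed

lemma left_diff_diff: "left_diff e u \<Longrightarrow> left_diff e v \<Longrightarrow> left_diff e (\<lambda>x. u x - v x)"
  using left_diff_add[of e u "\<lambda>x. (-1) * v x"] left_diff_cmult[of e v "-1"] by simp

lemma left_diff_sum: "(\<And>i. i \<in> I \<Longrightarrow> left_diff e (u i)) \<Longrightarrow> left_diff e (\<lambda>x. \<Sum>i\<in>I. u i x)"
  by (induction I rule: infinite_finite_induct) (auto intro: left_diff_const left_diff_add)

lemma left_quot_shift_tendsto:
  assumes "convergent (left_quot e u x)"
  shows "(\<lambda>n. u (x - (1 / real (Suc n)) *\<^sub>R e)) \<longlonglongrightarrow> u x"
proof -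
  obtain L where "left_quot e u x \<longlonglongrightarrow> L" using assms by (auto simp: convergent_def)
  then have "(\<lambda>n. u x - left_quot e u x n * inverse (real (Suc n))) \<longlonglongrightarrow> u x - L * 0"
    by (intro tendsto_intros LIMSEQ_inverse_real_of_nat)
  moreover have "u x - left_quot e u x n * inverse (real (Suc n)) = u (x - (1 / real (Suc n)) *\<^sub>R e)" for n
    unfolding left_quot_def by (simp add: field_simps del: of_nat_Suc)
  ultimately show ?thesis by simp
qed

lemma left_diff_mult:
  assumes "left_diff e u" "left_diff e v"
  shows "left_diff e (\<lambda>x. u x * v x)"
proof -
  have "left_quot e (\<lambda>x. u x * v x) x = (\<lambda>n. left_quot e u x n * v x + u (x - (1 / real (Suc n)) *\<^sub>R e) * left_quot e v x n)" for x
    by (auto simp: left_quot_def algebra_simps)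
  moreover have "convergent (\<lambda>n. u (x - (1 / real (Suc n)) *\<^sub>R e))" for x
    using left_quot_shift_tendsto assms(1) unfolding left_diff_def convergent_def by blast
  ultimately show ?thesis using assms unfolding left_diff_def
    by (simp add: convergent_add convergent_mult convergent_const)
qed

lemma left_diff_prod: "(\<And>i. i \<in> I \<Longrightarrow> left_diff e (u i)) \<Longrightarrow> left_diff e (\<lambda>x. \<Prod>i\<in>I. u i x)"
  by (induction I rule: infinite_finite_induct) (auto intro: left_diff_const left_diff_mult)

text \<open>Away from the kink the sign is eventually constant along the sequence. At a zero of u,
  positive homogeneity moves the ReLU past the division by the step, and the quotient becomes a
  continuous function of the quotient of u.\<close>

lemma left_diff_relu:
  assumes "left_diff e u"
  shows "left_diff e (\<lambda>x. relu (u x))"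
  unfolding left_diff_def
proof
  fix x
  obtain L where L: "left_quot e u x \<longlonglongrightarrow> L" using assms by (auto simp: left_diff_def convergent_def)
  have s: "(\<lambda>n. u (x - (1 / real (Suc n)) *\<^sub>R e)) \<longlonglongrightarrow> u x"
    using assms left_quot_shift_tendsto by (auto simp: left_diff_def)
  consider "u x > 0" | "u x < 0" | "u x = 0" by linarith
  then have "\<exists>L'. left_quot e (\<lambda>x. relu (u x)) x \<longlonglongrightarrow> L'"
  proof cases
    case 1
    have "\<forall>\<^sub>F n in sequentially. u (x - (1 / real (Suc n)) *\<^sub>R e) > 0"
      using order_tendstoD(1)[OF s 1] .
    then have "\<forall>\<^sub>F n in sequentially. left_quot e u x n = left_quot e (\<lambda>x. relu (u x)) x n"
      by eventually_elim (use 1 in \<open>simp add: left_quot_def relu_def\<close>)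
    then show ?thesis using Lim_transform_eventually[OF L] by blast
  next
    case 2
    have "\<forall>\<^sub>F n in sequentially. u (x - (1 / real (Suc n)) *\<^sub>R e) < 0"
      using order_tendstoD(2)[OF s 2] .
    then have "\<forall>\<^sub>F n in sequentially. 0 = left_quot e (\<lambda>x. relu (u x)) x n"
      by eventually_elim (use 2 in \<open>simp add: left_quot_def relu_def\<close>)
    then show ?thesis using Lim_transform_eventually[OF tendsto_const] by blast
  next
    case 3
    have "left_quot e (\<lambda>x. relu (u x)) x n = - max 0 (- left_quot e u x n)" for n
    proof -
      have "max 0 y * real (Suc n) = max 0 (y * real (Suc n))" for y
        by (auto simp: max_def zero_le_mult_iff not_le mult_less_0_iff)
      then show ?thesis using 3 by (simp add: left_quot_def relu_def del: of_nat_Suc)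
    qed
    then have "left_quot e (\<lambda>x. relu (u x)) x = (\<lambda>n. - max 0 (- left_quot e u x n))" by blast
    moreover have "(\<lambda>n. - max 0 (- left_quot e u x n)) \<longlonglongrightarrow> - max 0 (- L)"
      by (intro tendsto_intros L)
    ultimately show ?thesis by auto
  qed
  then show "convergent (left_quot e (\<lambda>x. relu (u x)) x)" by (simp add: convergent_def)
qed

lemma left_diff_abs: "left_diff e u \<Longrightarrow> left_diff e (\<lambda>x. \<bar>u x\<bar>)"
proof -
  assume u: "left_diff e u"
  have "(\<lambda>x. \<bar>u x\<bar>) = (\<lambda>x. relu (u x) + relu (-1 * u x))" by (auto simp: relu_def max_def)
  then show ?thesis using u by (simp only: left_diff_add left_diff_relu left_diff_cmult)
qed

lemma left_diff_id: "left_diff e (\<lambda>x::real. x)"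
proof -
  have "left_quot e (\<lambda>x::real. x) x = (\<lambda>n. e)" for x by (auto simp: left_quot_def simp del: of_nat_Suc)
  then show ?thesis by (simp add: left_diff_def convergent_const)
qed

lemma left_diff_coordinate:
  fixes e j :: "'a::euclidean_space"
  assumes "left_diff 1 f" "e \<in> Basis" "j \<in> Basis"
  shows "left_diff e (\<lambda>x. f (x \<bullet> j))"
proof (cases "e = j")
  case True
  have "left_quot e (\<lambda>x. f (x \<bullet> j)) x = left_quot 1 f (x \<bullet> j)" for x
    unfolding left_quot_def using True assms by (auto simp: inner_diff_left)
  then show ?thesis using assms by (simp add: left_diff_def)
next
  case False
  have "left_quot e (\<lambda>x. f (x \<bullet> j)) x = (\<lambda>n. 0)" for x
    unfolding left_quot_def using False assms by (auto simp: inner_diff_left inner_not_same_Basis)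
  then show ?thesis by (simp add: left_diff_def convergent_const)
qed

lemma left_diff_tents: "left_diff e z \<Longrightarrow> left_diff e (\<lambda>x. (tent ^^ k) (z x))"
proof (induction k)
  case (Suc k)
  have "(\<lambda>x. (tent ^^ Suc k) (z x)) = (\<lambda>x. 2 * relu ((tent ^^ k) (z x)) - 4 * relu ((tent ^^ k) (z x) - 1/2))"
    by (simp add: tent_def)
  moreover have "left_diff e (\<lambda>x. 2 * relu ((tent ^^ k) (z x)) - 4 * relu ((tent ^^ k) (z x) - 1/2))"
    using Suc by (intro left_diff_diff left_diff_cmult left_diff_relu left_diff_const) auto
  ultimately show ?case by metis
qed simp

lemma left_diff_approx_sq: "left_diff e z \<Longrightarrow> left_diff e (\<lambda>x. approx_sq m (z x))"
proof (induction m)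
  case (Suc m)
  have "(\<lambda>x. approx_sq (Suc m) (z x)) = (\<lambda>x. approx_sq m (z x) - 1 / 4 ^ Suc m * (tent ^^ Suc m) (z x))" by simp
  then show ?case using Suc by (simp only: left_diff_diff left_diff_cmult left_diff_tents)
qed simp

lemma left_diff_approx_mul:
  assumes "left_diff e u" "left_diff e v"
  shows "left_diff e (\<lambda>x. approx_mul m (u x) (v x))"
proof -
  have "left_diff e (\<lambda>x. 1/2 * \<bar>u x + v x\<bar>)"
    using assms by (intro left_diff_cmult left_diff_abs left_diff_add)
  moreover have "left_diff e (\<lambda>x. 1/2 * \<bar>u x - v x\<bar>)"
    using assms by (intro left_diff_cmult left_diff_abs left_diff_diff)
  ultimately show ?thesis unfolding approx_mul_def by (intro left_diff_diff left_diff_approx_sq) auto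
qed

lemma left_diff_prod_tree: "(\<And>i. i < 2 ^ k \<Longrightarrow> left_diff e (a i)) \<Longrightarrow> left_diff e (\<lambda>x. prod_tree m k (\<lambda>i. a i x))"
proof (induction k arbitrary: a)
  case (Suc k)
  then show ?case by (auto intro!: left_diff_approx_mul)
qed simp

text \<open>The move from x to y is made one coordinate at a time.\<close>

lemma lipschitz_basis_imp_continuous:
  fixes u :: "'a::euclidean_space \<Rightarrow> real"
  assumes lip: "\<And>e x h. e \<in> Basis \<Longrightarrow> \<bar>u (x + h *\<^sub>R e) - u x\<bar> \<le> K * \<bar>h\<bar>"
  shows "continuous_on UNIV u"
proof -
  have step: "\<bar>u (x + (\<Sum>b\<in>B. f b *\<^sub>R b)) - u x\<bar> \<le> (\<Sum>b\<in>B. K * \<bar>f b\<bar>)"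
    if "finite B" "B \<subseteq> Basis" for B f x
    using that
  proof (induction B rule: finite_induct)
    case (insert b B)
    have "\<bar>u ((x + (\<Sum>b\<in>B. f b *\<^sub>R b)) + f b *\<^sub>R b) - u (x + (\<Sum>b\<in>B. f b *\<^sub>R b))\<bar> \<le> K * \<bar>f b\<bar>"
      using insert by (intro lip) auto
    then show ?case using insert by (auto simp: algebra_simps)
  qed simp
  have bound: "\<bar>u y - u x\<bar> \<le> (\<Sum>b\<in>Basis. K * \<bar>(y - x) \<bullet> b\<bar>)" for x y
    using step[of Basis x "\<lambda>b. (y - x) \<bullet> b"] by (simp add: euclidean_representation)
  have "isCont u x" for x
  proof -
    have "((\<lambda>y. \<Sum>b\<in>Basis. K * \<bar>(y - x) \<bullet> b\<bar>) \<longlongrightarrow> (\<Sum>b\<in>Basis. K * \<bar>(x - x) \<bullet> b\<bar>)) (at x)"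
      by (intro tendsto_intros)
    then have "((\<lambda>y. \<Sum>b\<in>Basis. K * \<bar>(y - x) \<bullet> b\<bar>) \<longlongrightarrow> 0) (at x)" by simp
    then have "((\<lambda>y. u y - u x) \<longlongrightarrow> 0) (at x)"
      by (rule Lim_null_comparison[rotated]) (use bound in \<open>auto intro!: always_eventually\<close>)
    then show ?thesis unfolding isCont_def by (simp add: LIM_zero_iff)
  qed
  then show ?thesis by (simp add: continuous_at_imp_continuous_on)
qed

section \<open>Clamps to an interval, rescaled to [0,1]\<close>

definition unit_clamp :: "real \<Rightarrow> real \<Rightarrow> real \<Rightarrow> real" where
  "unit_clamp \<alpha> \<beta> x = relu ((x - \<alpha>) / (\<beta> - \<alpha>)) - relu ((x - \<alpha>) / (\<beta> - \<alpha>) - 1)"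

lemma left_diff_unit_clamp: "left_diff e (unit_clamp \<alpha> \<beta>)"
proof -
  have "left_diff e (\<lambda>x. relu (1 / (\<beta> - \<alpha>) * (x - \<alpha>)) - relu (1 / (\<beta> - \<alpha>) * (x - \<alpha>) - 1))"
    by (intro left_diff_diff left_diff_relu left_diff_cmult left_diff_id left_diff_const)
  moreover have "(\<lambda>x. relu (1 / (\<beta> - \<alpha>) * (x - \<alpha>)) - relu (1 / (\<beta> - \<alpha>) * (x - \<alpha>) - 1)) = unit_clamp \<alpha> \<beta>"
    by (auto simp: unit_clamp_def)
  ultimately show ?thesis by simp
qed

lemma unit_clamp_range: "unit_clamp \<alpha> \<beta> x \<in> {0..1}"
  by (auto simp: unit_clamp_def relu_def max_def)

lemma unit_clamp_lipschitz:
  assumes "\<alpha> < \<beta>"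
  shows "\<bar>unit_clamp \<alpha> \<beta> x - unit_clamp \<alpha> \<beta> y\<bar> \<le> \<bar>x - y\<bar> / (\<beta> - \<alpha>)"
proof -
  have "\<bar>(relu s - relu (s - 1)) - (relu t - relu (t - 1))\<bar> \<le> \<bar>s - t\<bar>" for s t
    by (auto simp: relu_def max_def abs_if)
  then have "\<bar>unit_clamp \<alpha> \<beta> x - unit_clamp \<alpha> \<beta> y\<bar> \<le> \<bar>(x - \<alpha>) / (\<beta> - \<alpha>) - (y - \<alpha>) / (\<beta> - \<alpha>)\<bar>"
    unfolding unit_clamp_def by blast
  also have "\<dots> = \<bar>x - y\<bar> / (\<beta> - \<alpha>)"
    using assms by (simp add: abs_divide flip: diff_divide_distrib)
  finally show ?thesis .
qed

lemma unit_clamp_values: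
  assumes "\<alpha> < \<beta>"
  shows "x \<le> \<alpha> \<Longrightarrow> unit_clamp \<alpha> \<beta> x = 0" "\<beta> \<le> x \<Longrightarrow> unit_clamp \<alpha> \<beta> x = 1"
    "\<alpha> \<le> x \<Longrightarrow> x \<le> \<beta> \<Longrightarrow> unit_clamp \<alpha> \<beta> x = (x - \<alpha>) / (\<beta> - \<alpha>)"
proof -
  have t: "x \<le> \<alpha> \<Longrightarrow> (x - \<alpha>) / (\<beta> - \<alpha>) \<le> 0" "\<beta> \<le> x \<Longrightarrow> (x - \<alpha>) / (\<beta> - \<alpha>) \<ge> 1"
    "\<alpha> \<le> x \<Longrightarrow> (x - \<alpha>) / (\<beta> - \<alpha>) \<ge> 0" "x \<le> \<beta> \<Longrightarrow> (x - \<alpha>) / (\<beta> - \<alpha>) \<le> 1"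
    using assms by (auto simp: divide_simps)
  show "x \<le> \<alpha> \<Longrightarrow> unit_clamp \<alpha> \<beta> x = 0" "\<beta> \<le> x \<Longrightarrow> unit_clamp \<alpha> \<beta> x = 1"
    "\<alpha> \<le> x \<Longrightarrow> x \<le> \<beta> \<Longrightarrow> unit_clamp \<alpha> \<beta> x = (x - \<alpha>) / (\<beta> - \<alpha>)"
    using t by (simp_all add: unit_clamp_def relu_def max_def)
qed

section \<open>Univariate piecewise polynomials in H1\<close>

lemma test_fun_mono: "test_fun S \<phi> \<Longrightarrow> S \<subseteq> T \<Longrightarrow> test_fun T \<phi>"
  by (auto simp: test_fun_def)

lemma test_fun_derivative:
  assumes "test_fun S \<phi>" "e \<in> Basis"
  shows "test_fun S (\<lambda>x. frechet_derivative \<phi> (at x) e)"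
proof -
  let ?d = "\<lambda>x. frechet_derivative \<phi> (at x) e"
  have "Ck k ?d" for k
  proof -
    have "Ck (Suc k) \<phi>" using assms(1) unfolding test_fun_def smooth_fun_def by blast
    then show ?thesis using assms(2) by simp
  qed
  moreover have sub: "tsupport ?d \<subseteq> tsupport \<phi>"
  proof -
    have "{x. ?d x \<noteq> 0} \<subseteq> tsupport \<phi>" using test_fun_props(5)[OF assms] by blast
    then have "closure {x. ?d x \<noteq> 0} \<subseteq> tsupport \<phi>" by (rule closure_minimal) (simp add: tsupport_def)
    then show ?thesis by (simp add: tsupport_def)
  qed
  moreover have "compact (tsupport ?d)"
  proof -
    have "compact (tsupport \<phi>)" using assms(1) by (simp add: test_fun_def)
    then have "compact (tsupport \<phi> \<inter> tsupport ?d)" by (rule compact_Int_closed) (simp add: tsupport_def)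
    then show ?thesis using sub by (simp add: Int_absorb1)
  qed
  ultimately show ?thesis using assms(1) by (auto simp: test_fun_def smooth_fun_def)
qed

text \<open>This is the definition of the weak derivative for the constant function 1, whose
  difference quotients vanish.\<close>

lemma test_fun_derivative_integral_zero:
  assumes "test_fun S \<phi>" "e \<in> Basis"
  shows "(LINT x:S|lebesgue. frechet_derivative \<phi> (at x) e) = 0"
proof -
  have "weak_partial S (\<lambda>_. 1) e (\<lambda>_. 0)"
    by (rule weak_partial_left_quotients[where K = 0]) (use assms in auto)
  then show ?thesis using assms(1) by (simp add: weak_partial_def)
qed

section \<open>Square integrability and weak derivatives of Lipschitz functions\<close>

lemma sq_int_imp_integrable:
  fixes f :: "'a::euclidean_space \<Rightarrow> real"
  assumes "sq_int S f" "S \<in> lmeasurable"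
  shows "set_integrable lebesgue S f"
  unfolding set_integrable_def
proof (rule Bochner_Integration.integrable_bound)
  have "integrable lebesgue (\<lambda>x. indicator S x *\<^sub>R (f x)\<^sup>2)" using assms(1) by (simp add: sq_int_def set_integrable_def)
  moreover have "integrable lebesgue (indicat_real S)" using assms(2) by (simp add: lmeasurable_iff_integrable)
  ultimately show "integrable lebesgue (\<lambda>x. indicat_real S x + indicator S x *\<^sub>R (f x)\<^sup>2)"
    by (rule Bochner_Integration.integrable_add[rotated])
  show "(\<lambda>x. indicator S x *\<^sub>R f x) \<in> borel_measurable lebesgue" using assms(1) by (simp add: sq_int_def)
  have "\<bar>y\<bar> \<le> 1 + y\<^sup>2" for y :: real
    using zero_le_power2[of "\<bar>y\<bar> - 1"] by (simp add: power2_diff)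
  then show "AE x in lebesgue. norm (indicator S x *\<^sub>R f x) \<le> norm (indicat_real S x + indicator S x *\<^sub>R (f x)\<^sup>2)"
    by (auto simp: indicator_def)
qed

lemma sq_int_bounded:
  fixes f :: "'a::euclidean_space \<Rightarrow> real"
  assumes [measurable]: "f \<in> borel_measurable lebesgue" and "S \<in> lmeasurable" "\<And>x. x \<in> S \<Longrightarrow> \<bar>f x\<bar> \<le> B"
  shows "sq_int S f"
proof -
  have S[measurable]: "S \<in> sets lebesgue" using assms(2) by (rule fmeasurableD)
  have "integrable lebesgue (\<lambda>x. indicator S x *\<^sub>R (f x)\<^sup>2)"
  proof (rule Bochner_Integration.integrable_bound)
    show "integrable lebesgue (\<lambda>x. B\<^sup>2 * indicat_real S x)"
      using assms(2) by (simp add: lmeasurable_iff_integrable)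
    have "(f x)\<^sup>2 \<le> B\<^sup>2" if "x \<in> S" for x
      using assms(3)[OF that] by (metis abs_ge_zero power2_abs power_mono)
    then show "AE x in lebesgue. norm (indicator S x *\<^sub>R (f x)\<^sup>2) \<le> norm (B\<^sup>2 * indicat_real S x)"
      by (auto simp: indicator_def)
  qed measurable
  then show ?thesis by (simp add: sq_int_def set_integrable_def)
qed

text \<open>By continuity the set of violations is open; a nonempty open set is not
  negligible.\<close>

lemma AE_le_imp_le:
  fixes f :: "'a::euclidean_space \<Rightarrow> real"
  assumes "continuous_on UNIV f" "open S" "AE x in lebesgue. x \<in> S \<longrightarrow> f x \<le> c" "x \<in> S"
  shows "f x \<le> c"
proof (rule ccontr)
  assume "\<not> f x \<le> c"
  define T where "T = S \<inter> f -` {c<..}"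
  have T: "open T" unfolding T_def using assms(1,2) by (intro open_Int open_vimage) auto
  have "AE x in lebesgue. x \<notin> T" using assms(3) by eventually_elim (auto simp: T_def)
  moreover have "T \<in> sets lebesgue" using T by auto
  ultimately have "negligible T" by (simp add: negligible_iff_null_sets AE_iff_null_sets)
  moreover have "x \<in> T" using assms(4) \<open>\<not> f x \<le> c\<close> by (auto simp: T_def)
  ultimately show False using open_not_negligible[OF T] by blast
qed

lemma weak_derivative_bound_1d:
  fixes v :: "real \<Rightarrow> real"
  assumes "in_H1 I v" "H1_norm I v \<le> K"
  obtains g where "sq_int I g" "weak_partial I v 1 g" "(LINT x:I|lebesgue. (g x)\<^sup>2) \<le> K\<^sup>2"
proof -
  define g where "g = (SOME g. sq_int I g \<and> weak_partial I v (1::real) g)"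
  have "\<exists>g. sq_int I g \<and> weak_partial I v 1 g" using assms(1) by (auto simp: in_H1_def)
  then have g: "sq_int I g \<and> weak_partial I v 1 g" unfolding g_def by (rule someI_ex)
  have nn: "0 \<le> (LINT x:I|lebesgue. (g x)\<^sup>2)"
    unfolding set_lebesgue_integral_def by (rule integral_nonneg_AE) auto
  have "H1_norm I v = sqrt ((L2_norm_on I v)\<^sup>2 + (L2_norm_on I g)\<^sup>2)"
    by (simp add: H1_norm_def g_def)
  then have "(L2_norm_on I v)\<^sup>2 + (L2_norm_on I g)\<^sup>2 \<le> K\<^sup>2"
    using assms(2) by (metis real_sqrt_le_iff real_sqrt_ge_zero real_sqrt_pow2 power_mono zero_le_power2 add_nonneg_nonneg)
  then have "(L2_norm_on I g)\<^sup>2 \<le> K\<^sup>2" using zero_le_power2[of "L2_norm_on I v"] by linarith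
  then have "(LINT x:I|lebesgue. (g x)\<^sup>2) \<le> K\<^sup>2" using nn by (simp add: L2_norm_on_def)
  then show ?thesis using that g by blast
qed

lemma left_quot_limit_bounded:
  assumes "left_diff e u" "\<And>x h. \<bar>u (x + h *\<^sub>R e) - u x\<bar> \<le> L * \<bar>h\<bar>"
  shows "left_quot e u x \<longlonglongrightarrow> lim (left_quot e u x)" "\<bar>lim (left_quot e u x)\<bar> \<le> L"
proof -
  show l: "left_quot e u x \<longlonglongrightarrow> lim (left_quot e u x)" using assms(1) by (simp add: left_diff_def convergent_LIMSEQ_iff)
  have "\<bar>left_quot e u x n\<bar> \<le> L" for n
  proof -
    have "\<bar>left_quot e u x n\<bar> = \<bar>u (x + (- (1 / real (Suc n))) *\<^sub>R e) - u x\<bar> * real (Suc n)"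
      by (simp add: left_quot_def abs_mult abs_minus_commute del: of_nat_Suc)
    also have "\<dots> \<le> (L * \<bar>- (1 / real (Suc n))\<bar>) * real (Suc n)"
      by (intro mult_right_mono assms(2)) simp
    also have "\<dots> = L" by (simp del: of_nat_Suc)
    finally show ?thesis .
  qed
  then show "\<bar>lim (left_quot e u x)\<bar> \<le> L"
    using tendsto_rabs[OF l] by (intro LIMSEQ_le_const2) auto
qed

lemma weak_partial_lim_left_quot:
  fixes u :: "'a::euclidean_space \<Rightarrow> real"
  assumes "e \<in> Basis" "continuous_on UNIV u" "\<And>x h. \<bar>u (x + h *\<^sub>R e) - u x\<bar> \<le> K * \<bar>h\<bar>" "left_diff e u"
  shows "weak_partial S u e (\<lambda>x. lim (left_quot e u x))"
proof (rule weak_partial_left_quotients[OF assms(1-3)])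
  show "(\<lambda>n. (u x - u (x - (1 / Suc n) *\<^sub>R e)) * Suc n) \<longlonglongrightarrow> lim (left_quot e u x)" for x
  proof -
    have "(\<lambda>n. (u x - u (x - (1 / Suc n) *\<^sub>R e)) * Suc n) = left_quot e u x" by (rule ext) (simp only: left_quot_def)
    then show ?thesis using left_quot_limit_bounded(1)[OF assms(4,3), of x] by (simp only:)
  qed
qed

lemma lim_left_quot_borel:
  fixes u :: "'a::euclidean_space \<Rightarrow> real"
  assumes "continuous_on UNIV u" "\<And>x h. \<bar>u (x + h *\<^sub>R e) - u x\<bar> \<le> K * \<bar>h\<bar>" "left_diff e u"
  shows "(\<lambda>x. lim (left_quot e u x)) \<in> borel_measurable borel"
proof (rule borel_measurable_LIMSEQ_real[OF left_quot_limit_bounded(1)[OF assms(3,2)]])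
  have [measurable]: "u \<in> borel_measurable borel" using assms(1) by (rule borel_measurable_continuous_onI)
  show "(\<lambda>x. left_quot e u x i) \<in> borel_measurable borel" for i unfolding left_quot_def by measurable
qed

text \<open>Testing inside each J identifies g with the one-sided derivative of U there. Since the
  remaining points form a null set and g is a function, the weak derivative of v has no mass at
  partition points: v has no jumps, and the constants on the different J are one and the same. The
  second claim makes the H1 bound of v available for its polynomial pieces.\<close>

lemma H1_eq_lipschitz_plus_const:
  fixes v U g :: "real \<Rightarrow> real"
  assumes ab: "a < b" and G: "finite G" "\<And>J. J \<in> G \<Longrightarrow> \<exists>\<alpha> \<beta>. \<alpha> < \<beta> \<and> J = {\<alpha><..<\<beta>}"
    "\<And>J. J \<in> G \<Longrightarrow> J \<subseteq> {a<..<b}" "finite ({a<..<b} - \<Union>G)"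
    and v: "sq_int {a<..<b} v" "sq_int {a<..<b} g" "weak_partial {a<..<b} v 1 g"
    and U: "left_diff 1 U" "\<And>x y. \<bar>U x - U y\<bar> \<le> L * \<bar>x - y\<bar>"
    and pw: "\<And>J. J \<in> G \<Longrightarrow> \<exists>c. \<forall>x\<in>J. v x - U x = c"
  shows "\<exists>\<kappa>. (\<forall>J\<in>G. \<forall>x\<in>J. v x = U x + \<kappa>)"
    and "AE x in lebesgue. x \<in> {a<..<b} \<longrightarrow> g x = lim (left_quot 1 U x)"
proof -
  let ?I = "{a<..<b}"
  define D where "D = (\<lambda>x. lim (left_quot 1 U x))"
  have I: "?I \<in> lmeasurable" by simp
  have lip: "\<bar>U (x + h *\<^sub>R 1) - U x\<bar> \<le> L * \<bar>h\<bar>" for x h using U(2)[of "x + h" x] by simp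
  have cont: "continuous_on UNIV U"
    by (rule lipschitz_basis_imp_continuous[where K = L]) (use lip in auto)
  have wU: "weak_partial S U 1 D" for S
    unfolding D_def by (rule weak_partial_lim_left_quot[OF _ cont lip U(1)]) simp
  have Dm: "D \<in> borel_measurable lebesgue"
    using lim_left_quot_borel[OF cont lip U(1)] unfolding D_def by (intro measurable_completion) simp
  have "sq_int ?I D"
    by (rule sq_int_bounded[OF Dm I, of L]) (use left_quot_limit_bounded(2)[OF U(1) lip] in \<open>auto simp: D_def\<close>)
  then have intD: "set_integrable lebesgue ?I D" using sq_int_imp_integrable I by blast
  have intg: "set_integrable lebesgue ?I g" and intv: "set_integrable lebesgue ?I v"
    using sq_int_imp_integrable v I by blast+
  have Um: "U \<in> borel_measurable lebesgue"
    using borel_measurable_continuous_onI[OF cont] by (intro measurable_completion) simp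
  have intU: "set_integrable lebesgue ?I U"
  proof -
    have "\<bar>U x\<bar> \<le> \<bar>U a\<bar> + \<bar>L\<bar> * (b - a)" if "x \<in> ?I" for x
    proof -
      have "\<bar>U x - U a\<bar> \<le> \<bar>L\<bar> * (b - a)"
        using U(2)[of x a] that by (smt (verit) greaterThanLessThan_iff mult_mono abs_ge_zero)
      then show ?thesis by linarith
    qed
    then have "sq_int ?I U" by (intro sq_int_bounded[OF Um I])
    then show ?thesis using sq_int_imp_integrable I by blast
  qed
  have diff: "(LINT x:?I|lebesgue. (v x - U x) * frechet_derivative \<phi> (at x) 1) =
      - (LINT x:?I|lebesgue. (g x - D x) * \<phi> x)" if \<phi>: "test_fun ?I \<phi>" for \<phi> :: "real \<Rightarrow> real"
  proof -
    have d: "test_fun ?I (\<lambda>x. frechet_derivative \<phi> (at x) 1)" by (rule test_fun_derivative[OF \<phi>]) simp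
    have "(LINT x:?I|lebesgue. (v x - U x) * frechet_derivative \<phi> (at x) 1) =
      (LINT x:?I|lebesgue. v x * frechet_derivative \<phi> (at x) 1) - (LINT x:?I|lebesgue. U x * frechet_derivative \<phi> (at x) 1)"
      unfolding left_diff_distrib
      by (rule set_integral_diff(2)[OF set_integrable_mult_test[OF intv d] set_integrable_mult_test[OF intU d]])
    also have "\<dots> = - (LINT x:?I|lebesgue. g x * \<phi> x) + (LINT x:?I|lebesgue. D x * \<phi> x)"
      using v(3) wU[of ?I] \<phi> unfolding weak_partial_def by simp
    also have "\<dots> = - (LINT x:?I|lebesgue. (g x - D x) * \<phi> x)"
      unfolding left_diff_distrib
      by (subst set_integral_diff(2)[OF set_integrable_mult_test[OF intg \<phi>] set_integrable_mult_test[OF intD \<phi>]]) simp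
    finally show ?thesis .
  qed
  have on_J: "AE x in lebesgue. x \<in> J \<longrightarrow> g x - D x = 0" if J: "J \<in> G" for J
  proof -
    obtain \<alpha> \<beta> where \<alpha>\<beta>: "\<alpha> < \<beta>" "J = box \<alpha> \<beta>" using G(2)[OF J] by (auto simp: box_real)
    obtain c where c: "\<And>x. x \<in> J \<Longrightarrow> v x - U x = c" using pw[OF J] by blast
    have sub: "J \<subseteq> ?I" using G(3)[OF J] .
    have restrict: "(LINT x:?I|lebesgue. f x * \<psi> x) = (LINT x:J|lebesgue. f x * \<psi> x)"
      if "test_fun J \<psi>" for f \<psi> :: "real \<Rightarrow> real"
    proof -
      have "\<psi> x = 0" if "x \<notin> J" for x
        using test_fun_props(4)[OF \<open>test_fun J \<psi>\<close>, of 1 x] \<open>test_fun J \<psi>\<close> that unfolding test_fun_def by auto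
      then have "(\<lambda>x. indicator ?I x *\<^sub>R (f x * \<psi> x)) = (\<lambda>x. indicator J x *\<^sub>R (f x * \<psi> x))"
        using sub by (intro ext) (case_tac "x \<in> J", auto simp: indicator_def)
      then show ?thesis by (simp add: set_lebesgue_integral_def)
    qed
    have "(LINT x:J|lebesgue. (g x - D x) * \<phi> x) = 0" if \<phi>: "test_fun J \<phi>" for \<phi> :: "real \<Rightarrow> real"
    proof -
      have d: "test_fun J (\<lambda>x. frechet_derivative \<phi> (at x) 1)" by (rule test_fun_derivative[OF \<phi>]) simp
      have "- (LINT x:J|lebesgue. (g x - D x) * \<phi> x) = - (LINT x:?I|lebesgue. (g x - D x) * \<phi> x)"
        using restrict[OF \<phi>] by simp
      also have "\<dots> = (LINT x:?I|lebesgue. (v x - U x) * frechet_derivative \<phi> (at x) 1)"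
        using diff[OF test_fun_mono[OF \<phi> sub]] by simp
      also have "\<dots> = (LINT x:J|lebesgue. (v x - U x) * frechet_derivative \<phi> (at x) 1)"
        using restrict[OF d] by simp
      also have "\<dots> = (LINT x:J|lebesgue. c * frechet_derivative \<phi> (at x) 1)"
        using \<alpha>\<beta>(2) c by (intro set_lebesgue_integral_cong) auto
      also have "\<dots> = 0" using test_fun_derivative_integral_zero[OF \<phi>, of 1] by simp
      finally show ?thesis by simp
    qed
    moreover have "set_integrable lebesgue J (\<lambda>x. g x - D x)"
      by (rule set_integrable_subset[OF set_integral_diff(1)[OF intg intD]]) (use sub \<alpha>\<beta>(2) in auto)
    ultimately show ?thesis unfolding \<alpha>\<beta>(2) by (intro test_zero_imp_AE_zero)
  qed
  have "AE x in lebesgue. x \<notin> ?I - \<Union>G"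
    using G(4) negligible_finite negligible_iff_null_sets AE_not_in by blast
  moreover have "AE x in lebesgue. \<forall>J\<in>G. x \<in> J \<longrightarrow> g x - D x = 0"
    using G(1) on_J by (intro AE_finite_allI) auto
  ultimately have ae: "AE x in lebesgue. x \<in> ?I \<longrightarrow> g x = D x" by eventually_elim auto
  then show "AE x in lebesgue. x \<in> ?I \<longrightarrow> g x = lim (left_quot 1 U x)" by (simp add: D_def)
  have "(LINT x:?I|lebesgue. (v x - U x) * frechet_derivative \<phi> (at x) 1) = 0" if \<phi>: "test_fun ?I \<phi>" for \<phi> :: "real \<Rightarrow> real"
  proof -
    have "(LINT x:?I|lebesgue. (g x - D x) * \<phi> x) = 0"
      unfolding set_lebesgue_integral_def
      by (rule integral_eq_zero_AE) (use ae in \<open>eventually_elim, auto simp: indicator_def\<close>)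
    then show ?thesis using diff[OF \<phi>] by simp
  qed
  from weakly_constant_imp_AE_const[OF ab set_integral_diff(1)[OF intv intU] this]
  obtain \<kappa> where \<kappa>: "AE x in lebesgue. x \<in> ?I \<longrightarrow> v x - U x = \<kappa>" by blast
  have "v x = U x + \<kappa>" if J: "J \<in> G" "x \<in> J" for J x
  proof -
    obtain \<alpha> \<beta> where \<alpha>\<beta>: "\<alpha> < \<beta>" "J = {\<alpha><..<\<beta>}" using G(2)[OF J(1)] by blast
    obtain c where c: "\<And>x. x \<in> J \<Longrightarrow> v x - U x = c" using pw[OF J(1)] by blast
    have "c = \<kappa>"
    \<comment> \<open>An almost everywhere constant and the constant on J must agree because J has
      positive measure; this upgrades the identity to every point of J.\<close>
    proof (rule ccontr)
      assume "c \<noteq> \<kappa>"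
      have "AE x in lebesgue. x \<notin> J"
        using \<kappa> by eventually_elim (use c \<open>c \<noteq> \<kappa>\<close> G(3)[OF J(1)] in auto)
      then have "negligible J" using \<alpha>\<beta>(2) by (simp add: negligible_iff_null_sets AE_iff_null_sets)
      then show False using open_not_negligible[of J] \<alpha>\<beta> J(2) by auto
    qed
    then show ?thesis using c[OF J(2)] by simp
  qed
  then show "\<exists>\<kappa>. \<forall>J\<in>G. \<forall>x\<in>J. v x = U x + \<kappa>" by blast
qed

lemma disjoint_open_intervals:
  fixes \<alpha> :: real
  assumes "{\<alpha><..<\<beta>} \<inter> {\<alpha>'<..<\<beta>'} = {}" "\<alpha> < \<beta>" "\<alpha>' < \<beta>'"
  shows "\<beta> \<le> \<alpha>' \<or> \<beta>' \<le> \<alpha>"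
proof (rule ccontr)
  assume "\<not> ?thesis"
  then have "max \<alpha> \<alpha>' < min \<beta> \<beta>'" using assms by auto
  then obtain x where "max \<alpha> \<alpha>' < x" "x < min \<beta> \<beta>'" using dense by blast
  then have "x \<in> {\<alpha><..<\<beta>} \<inter> {\<alpha>'<..<\<beta>'}" by auto
  then show False using assms by blast
qed

lemma nodal_lipschitz:
  assumes "s \<in> {0..1}" "t \<in> {0..1}" "j \<le> n"
  shows "\<bar>nodal n j s - nodal n j t\<bar> \<le> real n * \<bar>s - t\<bar>"
proof -
  have node: "0 \<le> real i / real n" "real i / real n \<le> 1" if "i \<le> n" for i
    using that by (auto simp: divide_le_eq_1)
  have b: "\<bar>s - real i / real n\<bar> \<le> 1" "\<bar>t - real i / real n\<bar> \<le> 1" if "i \<in> {..n} - {j}" for i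
    using node[of i] that assms(1,2) unfolding abs_le_iff atLeastAtMost_iff Diff_iff atMost_iff by linarith+
  have "\<bar>nodal n j s - nodal n j t\<bar> \<le> (\<Sum>i\<in>{..n} - {j}. \<bar>(s - real i / real n) - (t - real i / real n)\<bar>)"
    unfolding nodal_def by (rule prod_lipschitz) (use b in auto)
  also have "\<dots> = real (card ({..n} - {j})) * \<bar>s - t\<bar>" by simp
  also have "card ({..n} - {j}) = n" using assms(3) by simp
  finally show ?thesis .
qed

text \<open>Cauchy-Schwarz for the integral of the derivative, in the form of the weighted AM-GM
  inequality with weight K divided by the square root of the interval length.\<close>

lemma poly_increment_bound:
  fixes q :: "real poly"
  assumes "\<alpha> < \<beta>" "0 < K" "(LINT x:{\<alpha><..<\<beta>}|lebesgue. (poly (pderiv q) x)\<^sup>2) \<le> K\<^sup>2" "x \<in> {\<alpha>..\<beta>}"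
  shows "\<bar>poly q x - poly q \<alpha>\<bar> \<le> sqrt (\<beta> - \<alpha>) * K"
proof -
  define f where "f = poly (pderiv q)"
  define r where "r = sqrt (\<beta> - \<alpha>)"
  have r: "0 < r" "r * r = \<beta> - \<alpha>" using assms(1) by (auto simp: r_def)
  define \<mu> where "\<mu> = K / r"
  have \<mu>: "0 < \<mu>" using assms(2) r by (simp add: \<mu>_def)
  define g where "g = (\<lambda>y. \<mu> / 2 + (1 / (2 * \<mu>)) * (f y)\<^sup>2)"
  have fg: "\<bar>f y\<bar> \<le> g y" for y
  proof -
    have "0 \<le> (\<bar>f y\<bar> - \<mu>)\<^sup>2" by simp
    then have "2 * \<mu> * \<bar>f y\<bar> \<le> (f y)\<^sup>2 + \<mu>\<^sup>2" by (simp add: power2_diff algebra_simps)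
    then show ?thesis using \<mu> by (simp add: g_def field_simps power2_eq_square)
  qed
  have cf: "continuous_on A f" for A unfolding f_def by (intro continuous_intros)
  have cg: "continuous_on A g" for A unfolding g_def using \<mu> by (intro continuous_intros cf) auto
  have "(f has_integral poly q x - poly q \<alpha>) {\<alpha>..x}"
    using assms(4) unfolding f_def
    by (intro fundamental_theorem_of_calculus) (auto intro: poly_DERIV DERIV_subset simp flip: has_real_derivative_iff_has_vector_derivative)
  then have "\<bar>poly q x - poly q \<alpha>\<bar> = norm (integral {\<alpha>..x} f)" by (simp add: integral_unique)
  also have "\<dots> \<le> integral {\<alpha>..x} g"
    using fg by (intro integral_norm_bound_integral integrable_continuous_real cf cg) auto
  also have "\<dots> \<le> integral {\<alpha>..\<beta>} g"
    using assms(4) fg by (intro integral_subset_le integrable_continuous_real cg) (auto intro: order_trans[OF abs_ge_zero])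
  also have "\<dots> = (\<beta> - \<alpha>) * (\<mu> / 2) + (1 / (2 * \<mu>)) * integral {\<alpha>..\<beta>} (\<lambda>y. (f y)\<^sup>2)"
    unfolding g_def using assms(1)
    by (subst Henstock_Kurzweil_Integration.integral_add) (use \<mu> in \<open>auto intro!: integrable_continuous_real continuous_intros cf\<close>)
  also have "integral {\<alpha>..\<beta>} (\<lambda>y. (f y)\<^sup>2) = (LINT x:{\<alpha><..<\<beta>}|lebesgue. (f x)\<^sup>2)"
  proof -
    have "(\<lambda>y. (f y)\<^sup>2) absolutely_integrable_on {\<alpha>..\<beta>}"
      by (intro absolutely_integrable_continuous_real continuous_intros cf)
    then have "(\<lambda>y. (f y)\<^sup>2) absolutely_integrable_on {\<alpha><..<\<beta>}" by (rule set_integrable_subset) auto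
    then show ?thesis by (simp add: set_lebesgue_integral_eq_integral(2) integral_open_interval_real)
  qed
  also have "(\<beta> - \<alpha>) * (\<mu> / 2) + (1 / (2 * \<mu>)) * (LINT x:{\<alpha><..<\<beta>}|lebesgue. (f x)\<^sup>2)
      \<le> (\<beta> - \<alpha>) * (\<mu> / 2) + (1 / (2 * \<mu>)) * K\<^sup>2"
    using assms(3) \<mu> unfolding f_def by (intro add_left_mono mult_left_mono) auto
  also have "\<dots> = r * K"
    unfolding r(2)[symmetric] \<mu>_def using r(1) assms(2) by (simp add: field_simps power2_eq_square)
  finally show ?thesis by (simp add: r_def)
qed

lemma lim_left_quot_poly:
  fixes q :: "real poly"
  assumes "open J" "x \<in> J" "\<And>y. y \<in> J \<Longrightarrow> U y = poly q y + c"
  shows "lim (left_quot 1 U x) = poly (pderiv q) x"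
proof -
  define h where "h = (\<lambda>n. - (1 / real (Suc n)))"
  have h0: "h \<longlonglongrightarrow> 0"
    unfolding h_def using tendsto_minus[OF LIMSEQ_inverse_real_of_nat] by (simp add: inverse_eq_divide)
  then have hl: "filterlim h (at 0) sequentially"
    unfolding filterlim_at by (auto simp: h_def)
  have "((\<lambda>s. (poly q (x + s) - poly q x) / s) \<longlongrightarrow> poly (pderiv q) x) (at 0)"
    using poly_DERIV[of q x] by (simp add: DERIV_def)
  from filterlim_compose[OF this hl]
  have lim: "(\<lambda>n. (poly q (x + h n) - poly q x) / h n) \<longlonglongrightarrow> poly (pderiv q) x" .
  have "(\<lambda>n. x + h n) \<longlonglongrightarrow> x" using tendsto_add[OF tendsto_const h0, of x] by simp
  then have "\<forall>\<^sub>F n in sequentially. x + h n \<in> J" using assms(1,2) by (rule topological_tendstoD)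
  then have "\<forall>\<^sub>F n in sequentially. (poly q (x + h n) - poly q x) / h n = left_quot 1 U x n"
  proof eventually_elim
    case (elim n)
    then have "U (x + h n) = poly q (x + h n) + c" "U x = poly q x + c" using assms by auto
    then show ?case by (simp add: left_quot_def h_def algebra_simps del: of_nat_Suc)
  qed
  from Lim_transform_eventually[OF lim this] show ?thesis by (rule limI)
qed

section \<open>Partitions and clamped interpolants\<close>

lemma interval_partition_finite_complement:
  assumes "interval_partition a b N G"
  shows "finite ({a<..<b} - \<Union>G)"
proof (rule finite_subset)
  have G: "finite G" "\<And>J. J \<in> G \<Longrightarrow> \<exists>\<alpha> \<beta>. \<alpha> < \<beta> \<and> J = {\<alpha><..<\<beta>}" "\<Union>(closure ` G) = {a..b}"
    using assms by (auto simp: interval_partition_def)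
  show "{a<..<b} - \<Union>G \<subseteq> (\<Union>J\<in>G. closure J - J)" using G(3) by fastforce
  have "finite (closure J - J)" if JG: "J \<in> G" for J
  proof -
    obtain \<alpha> \<beta> where "\<alpha> < \<beta>" "J = {\<alpha><..<\<beta>}" using G(2)[OF JG] by blast
    then have "closure J - J \<subseteq> {\<alpha>, \<beta>}" by (auto simp: closure_greaterThanLessThan)
    then show ?thesis by (rule finite_subset) simp
  qed
  then show "finite (\<Union>J\<in>G. closure J - J)" using G(1) by blast
qed

text \<open>From here on the end points are recovered from J as \<open>Inf J\<close> and
  \<open>Sup J\<close>, so that sums over intervals need no choice of end points.\<close>

lemma interval_partition_intervals:
  assumes "interval_partition a b N G" "J \<in> G"
  shows "Inf J < Sup J" "J = {Inf J<..<Sup J}" "a \<le> Inf J" "Sup J \<le> b"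
proof -
  have sub: "J \<subseteq> {a<..<b}" using assms by (simp add: interval_partition_def Sup_le_iff)
  have "\<exists>\<alpha> \<beta>. \<alpha> < \<beta> \<and> J = {\<alpha><..<\<beta>}" using assms by (simp add: interval_partition_def)
  then obtain \<alpha> \<beta> where J: "\<alpha> < \<beta>" "J = {\<alpha><..<\<beta>}" by blast
  have eq: "Inf J = \<alpha>" "Sup J = \<beta>" using J by auto
  with J show "Inf J < Sup J" "J = {Inf J<..<Sup J}" by auto
  have "a \<le> \<alpha> \<and> \<beta> \<le> b" using sub J by (simp add: greaterThanLessThan_subseteq_greaterThanLessThan)
  then show "a \<le> Inf J" "Sup J \<le> b" using eq by auto
qed

definition pw_interp :: "nat \<Rightarrow> real \<Rightarrow> real set set \<Rightarrow> (real set \<Rightarrow> nat \<Rightarrow> real) \<Rightarrow> real \<Rightarrow> real" where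
  "pw_interp n \<kappa> M A x = \<kappa> + (\<Sum>J\<in>M. \<Sum>j\<le>n. A J j * nodal n j (unit_clamp (Inf J) (Sup J) x))"

lemma left_diff_nodal: "left_diff e s \<Longrightarrow> left_diff e (\<lambda>x. nodal n j (s x))"
  unfolding nodal_def by (intro left_diff_prod left_diff_diff left_diff_const)

lemma left_diff_pw_interp: "left_diff e (pw_interp n \<kappa> M A)"
proof -
  have "left_diff e (\<lambda>x. \<kappa> + (\<Sum>J\<in>M. \<Sum>j\<le>n. A J j * nodal n j (unit_clamp (Inf J) (Sup J) x)))"
    by (intro left_diff_add left_diff_const left_diff_sum left_diff_cmult left_diff_nodal left_diff_unit_clamp)
  then show ?thesis by (simp add: pw_interp_def[abs_def])
qed

text \<open>The first form keeps the increments of the clamps, which the quantitative estimates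
  need; the second has a constant that blows up for short intervals and serves only to know that the
  function is Lipschitz.\<close>

lemma pw_interp_lipschitz:
  assumes "\<And>J. J \<in> M \<Longrightarrow> Inf J < Sup J"
  shows "\<bar>pw_interp n \<kappa> M A x - pw_interp n \<kappa> M A y\<bar>
    \<le> (\<Sum>J\<in>M. \<Sum>j\<le>n. \<bar>A J j\<bar> * (real n * \<bar>unit_clamp (Inf J) (Sup J) x - unit_clamp (Inf J) (Sup J) y\<bar>))"
    (is "_ \<le> ?R")
    and "\<bar>pw_interp n \<kappa> M A x - pw_interp n \<kappa> M A y\<bar> \<le> (\<Sum>J\<in>M. \<Sum>j\<le>n. \<bar>A J j\<bar> * (real n / (Sup J - Inf J))) * \<bar>x - y\<bar>"
proof -
  let ?s = "\<lambda>J. unit_clamp (Inf J) (Sup J)"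
  have "\<bar>pw_interp n \<kappa> M A x - pw_interp n \<kappa> M A y\<bar> =
      \<bar>\<Sum>J\<in>M. \<Sum>j\<le>n. A J j * (nodal n j (?s J x) - nodal n j (?s J y))\<bar>"
    by (simp add: pw_interp_def sum_subtractf right_diff_distrib)
  also have "\<dots> \<le> (\<Sum>J\<in>M. \<Sum>j\<le>n. \<bar>A J j * (nodal n j (?s J x) - nodal n j (?s J y))\<bar>)"
    by (intro order_trans[OF sum_abs] sum_mono sum_abs)
  also have "\<dots> \<le> ?R"
    unfolding abs_mult by (intro sum_mono mult_left_mono nodal_lipschitz unit_clamp_range) auto
  finally show 1: "\<bar>pw_interp n \<kappa> M A x - pw_interp n \<kappa> M A y\<bar> \<le> ?R" .
  also have "?R \<le> (\<Sum>J\<in>M. \<Sum>j\<le>n. \<bar>A J j\<bar> * (real n * (\<bar>x - y\<bar> / (Sup J - Inf J))))"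
    by (intro sum_mono mult_left_mono unit_clamp_lipschitz assms) auto
  also have "\<dots> = (\<Sum>J\<in>M. \<Sum>j\<le>n. \<bar>A J j\<bar> * (real n / (Sup J - Inf J))) * \<bar>x - y\<bar>"
    by (simp add: sum_distrib_right mult.assoc)
  finally show "\<bar>pw_interp n \<kappa> M A x - pw_interp n \<kappa> M A y\<bar> \<le> (\<Sum>J\<in>M. \<Sum>j\<le>n. \<bar>A J j\<bar> * (real n / (Sup J - Inf J))) * \<bar>x - y\<bar>" .
qed

lemma one_dim_representation:
  fixes v :: "real \<Rightarrow> real"
  assumes "a < b" and part: "interval_partition a b N G" and pp: "piecewise_poly p G v"
    and H1: "in_H1 {a<..<b} v" "H1_norm {a<..<b} v \<le> K" "0 < K"
    and supp: "local_support {a<..<b} G v" and Linf: "Linf_le {a<..<b} v 1"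
    and n: "0 < n" "p \<le> n"
  shows "\<exists>M \<kappa> A. M \<subseteq> G \<and> card M \<le> 2 \<and>
    (\<forall>J\<in>M. \<forall>j\<le>n. \<bar>A J j\<bar> \<le> sqrt (Sup J - Inf J) * K * (2 * exp 1) ^ n) \<and>
    finite {x \<in> {a<..<b}. v x \<noteq> pw_interp n \<kappa> M A x} \<and> (\<forall>x. \<bar>pw_interp n \<kappa> M A x\<bar> \<le> 1)"
proof -
  let ?I = "{a<..<b}"
  have G: "finite G" "\<And>J. J \<in> G \<Longrightarrow> \<exists>\<alpha> \<beta>. \<alpha> < \<beta> \<and> J = {\<alpha><..<\<beta>}"
    "\<And>J. J \<in> G \<Longrightarrow> J \<subseteq> ?I" "\<And>J J'. J \<in> G \<Longrightarrow> J' \<in> G \<Longrightarrow> J \<noteq> J' \<Longrightarrow> J \<inter> J' = {}"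
    using part by (auto simp: interval_partition_def)
  note J = interval_partition_intervals[OF part]
  have mem: "Inf J < x" "x < Sup J" if "J \<in> G" "x \<in> J" for J x
    using J(2)[OF that(1)] that(2) by (metis greaterThanLessThan_iff)+
  define M where "M = {J \<in> G. supp_on ?I v \<inter> J \<noteq> {}}"
  have M: "M \<subseteq> G" "finite M" using G(1) by (auto simp: M_def)
  have cardM: "card M \<le> 2"
  proof -
    have "(\<exists>J. M = {J}) \<or> (\<exists>J1 J2. M = {J1, J2})"
      using supp unfolding local_support_def M_def[symmetric] Let_def by blast
    then obtain J1 J2 where "M = set [J1, J2]" by auto
    then show ?thesis using card_length[of "[J1, J2]"] by simp
  qed
  have vzero: "v x = 0" if "J \<in> G - M" "x \<in> J" for J x
  proof (rule ccontr)
    assume "v x \<noteq> 0"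
    then have "x \<in> {x \<in> ?I. v x \<noteq> 0}" using that G(3)[of J] by auto
    then have "x \<in> supp_on ?I v" unfolding supp_on_def by (rule subsetD[OF closure_subset])
    then show False using that by (auto simp: M_def)
  qed
  obtain q where q: "\<And>J. J \<in> G \<Longrightarrow> degree (q J) \<le> p" "\<And>J x. J \<in> G \<Longrightarrow> x \<in> J \<Longrightarrow> v x = poly (q J) x"
  proof -
    from pp have "\<forall>J\<in>G. \<exists>q. degree q \<le> p \<and> (\<forall>x\<in>J. v x = poly q x)" by (simp add: piecewise_poly_def)
    from bchoice[OF this] obtain q where "\<forall>J\<in>G. degree (q J) \<le> p \<and> (\<forall>x\<in>J. v x = poly (q J) x)" ..
    then show ?thesis by (intro that[of q]) auto
  qed
  \<comment> \<open>The piece on J is transported to [0,1] and made to vanish at 0, so that its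
    values at the nodes are increments, which the derivative controls.\<close>
  define P where "P = (\<lambda>J. pcompose (q J) [:Inf J, Sup J - Inf J:] - [:poly (q J) (Inf J):])"
  have polyP: "poly (P J) s = poly (q J) (Inf J + s * (Sup J - Inf J)) - poly (q J) (Inf J)" for J s
    by (simp add: P_def poly_pcompose)
  have degP: "degree (P J) \<le> n" if "J \<in> G" for J
  proof -
    have "degree (pcompose (q J) [:Inf J, Sup J - Inf J:]) \<le> degree (q J) * 1"
      by (rule order_trans[OF degree_pcompose_le]) (intro mult_left_mono, auto)
    then have "degree (pcompose (q J) [:Inf J, Sup J - Inf J:]) \<le> n" using q(1)[OF that] n(2) by linarith
    then show ?thesis unfolding P_def by (intro degree_diff_le) auto
  qed
  define A where "A = (\<lambda>J j. poly (P J) (real j / real n) / nodal n j (real j / real n))"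
  define F where "F = (\<lambda>J x. \<Sum>j\<le>n. A J j * nodal n j (unit_clamp (Inf J) (Sup J) x))"
  have F: "F J x = poly (P J) (unit_clamp (Inf J) (Sup J) x)" if "J \<in> G" for J x
    unfolding F_def A_def by (rule lagrange_interpolation[OF n(1) degP[OF that], symmetric])
  have F_in: "F J x = poly (q J) x - poly (q J) (Inf J)" if "J \<in> G" "x \<in> J" for J x
  proof -
    have "unit_clamp (Inf J) (Sup J) x = (x - Inf J) / (Sup J - Inf J)"
      using mem[OF that] by (intro unit_clamp_values(3)[OF J(1)[OF that(1)]]) auto
    then show ?thesis using J(1)[OF that(1)] by (simp add: F[OF that(1)] polyP)
  qed
  have F_out: "F J' x = F J' y" if "J \<in> G" "J' \<in> G" "J \<noteq> J'" "x \<in> J" "y \<in> J" for J J' x y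
  proof -
    have "Sup J \<le> Inf J' \<or> Sup J' \<le> Inf J"
      using disjoint_open_intervals[of "Inf J" "Sup J" "Inf J'" "Sup J'"] G(4)[OF that(1-3)]
        J(1,2)[OF that(1)] J(1,2)[OF that(2)] by simp
    moreover have "Inf J < x" "x < Sup J" "Inf J < y" "y < Sup J"
      using mem[OF that(1,4)] mem[OF that(1,5)] by blast+
    ultimately have "unit_clamp (Inf J') (Sup J') x = unit_clamp (Inf J') (Sup J') y"
      using unit_clamp_values(1,2)[OF J(1)[OF that(2)], of x] unit_clamp_values(1,2)[OF J(1)[OF that(2)], of y] by auto
    then show ?thesis by (simp add: F[OF that(2)])
  qed
  define U where "U = pw_interp n 0 M A"
  have U: "U x = (\<Sum>J\<in>M. F J x)" for x by (simp add: U_def pw_interp_def F_def)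
  have pw: "v x - U x = v y - U y" if "J \<in> G" "x \<in> J" "y \<in> J" for J x y
  proof (cases "J \<in> M")
    case True
    have "(\<Sum>J'\<in>M - {J}. F J' x) = (\<Sum>J'\<in>M - {J}. F J' y)"
      using M(1) that by (intro sum.cong F_out) auto
    then show ?thesis
      using sum.remove[OF M(2) True, of "\<lambda>J. F J x"] sum.remove[OF M(2) True, of "\<lambda>J. F J y"]
        F_in[OF that(1,2)] F_in[OF that(1,3)] q(2)[OF that(1,2)] q(2)[OF that(1,3)] by (simp add: U)
  next
    case False
    then have "v x = 0" "v y = 0" using vzero that by blast+
    moreover have "U x = U y" unfolding U using M(1) that False by (intro sum.cong refl F_out) auto
    ultimately show ?thesis by simp
  qed
  obtain g where g: "sq_int ?I g" "weak_partial ?I v 1 g" "(LINT x:?I|lebesgue. (g x)\<^sup>2) \<le> K\<^sup>2"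
    using weak_derivative_bound_1d[OF H1(1,2)] by blast
  have sqv: "sq_int ?I v" using H1(1) by (simp add: in_H1_def)
  define L where "L = (\<Sum>J\<in>M. \<Sum>j\<le>n. \<bar>A J j\<bar> * (real n / (Sup J - Inf J)))"
  have lipU: "\<bar>U x - U y\<bar> \<le> L * \<bar>x - y\<bar>" for x y
    unfolding U_def L_def using J(1) M(1) by (intro pw_interp_lipschitz(2)) auto
  have lqU: "left_diff 1 U" unfolding U_def by (rule left_diff_pw_interp)
  have fin: "finite (?I - \<Union>G)" by (rule interval_partition_finite_complement[OF part])
  have pw': "\<exists>c. \<forall>x\<in>J. v x - U x = c" if "J \<in> G" for J
  proof -
    have "(Inf J + Sup J) / 2 \<in> {Inf J<..<Sup J}" using J(1)[OF that] by auto
    then have "(Inf J + Sup J) / 2 \<in> J" using J(2)[OF that] by blast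
    then show ?thesis using pw[OF that] by blast
  qed
  note lemma_const = H1_eq_lipschitz_plus_const[OF assms(1) G(1,2,3) fin sqv g(1,2) lqU lipU pw']
  obtain \<kappa> where \<kappa>: "\<And>J x. J \<in> G \<Longrightarrow> x \<in> J \<Longrightarrow> v x = U x + \<kappa>" using lemma_const(1) by blast
  have aeg: "AE x in lebesgue. x \<in> ?I \<longrightarrow> g x = lim (left_quot 1 U x)" by (rule lemma_const(2))
  have V: "pw_interp n \<kappa> M A x = U x + \<kappa>" for x by (simp add: U_def pw_interp_def)
  have bound: "\<bar>A J j\<bar> \<le> sqrt (Sup J - Inf J) * K * (2 * exp 1) ^ n" if JM: "J \<in> M" "j \<le> n" for J j
  proof -
    have JG: "J \<in> G" using JM M by blast
    have deriv: "lim (left_quot 1 U x) = poly (pderiv (q J)) x" if "x \<in> J" for x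
    proof (rule lim_left_quot_poly[OF _ that])
      show "open J" using J(2)[OF JG] by (metis open_greaterThanLessThan)
      show "U y = poly (q J) y + (- \<kappa>)" if "y \<in> J" for y using \<kappa>[OF JG that] q(2)[OF JG that] by simp
    qed
    have sets: "J \<in> sets lebesgue" using J(2)[OF JG] lebesgue_openin[of UNIV J] by (metis open_greaterThanLessThan lborelD borel_open sets_completionI_sets)
    have ig: "integrable lebesgue (\<lambda>x. indicator ?I x *\<^sub>R (g x)\<^sup>2)"
      using g(1) by (simp add: sq_int_def set_integrable_def)
    \<comment> \<open>On J the weak derivative g agrees almost everywhere with the derivative of the
      polynomial, so its share of the squared H1 norm bounds the L2 norm of the latter.\<close>
    have "(LINT x:J|lebesgue. (poly (pderiv (q J)) x)\<^sup>2) = (\<integral>x. indicator J x * (indicator ?I x * (g x)\<^sup>2) \<partial>lebesgue)"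
      unfolding set_lebesgue_integral_def
    proof (rule integral_cong_AE)
      have "poly (pderiv (q J)) \<in> borel_measurable lebesgue"
        by (intro measurable_completion) (simp, intro borel_measurable_continuous_onI continuous_intros)
      then show "(\<lambda>x. indicator J x *\<^sub>R (poly (pderiv (q J)) x)\<^sup>2) \<in> borel_measurable lebesgue"
        using sets by measurable
      have "(\<lambda>x. indicator ?I x * (g x)\<^sup>2) \<in> borel_measurable lebesgue" using ig by auto
      then show "(\<lambda>x. indicator J x * (indicator ?I x * (g x)\<^sup>2)) \<in> borel_measurable lebesgue"
        using sets by measurable
      show "AE x in lebesgue. indicator J x *\<^sub>R (poly (pderiv (q J)) x)\<^sup>2 = indicator J x * (indicator ?I x * (g x)\<^sup>2)"
        using aeg
      proof eventually_elim
        case (elim x)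
        then show ?case using deriv[of x] G(3)[OF JG] by (cases "x \<in> J") auto
      qed
    qed
    also have "\<dots> \<le> (\<integral>x. indicator ?I x *\<^sub>R (g x)\<^sup>2 \<partial>lebesgue)"
      by (rule integral_mono_AE'[OF ig]) (auto simp: indicator_def)
    also have "\<dots> \<le> K\<^sup>2" using g(3) by (simp add: set_lebesgue_integral_def)
    finally have L2: "(LINT x:{Inf J<..<Sup J}|lebesgue. (poly (pderiv (q J)) x)\<^sup>2) \<le> K\<^sup>2"
      using J(2)[OF JG] by simp
    have "real j / real n \<in> {0..1}" using JM(2) n(1) by auto
    then have "Inf J + real j / real n * (Sup J - Inf J) \<in> {Inf J..Sup J}"
      using J(1)[OF JG] mult_left_le_one_le[of "Sup J - Inf J" "real j / real n"] by auto
    from poly_increment_bound[OF J(1)[OF JG] H1(3) L2 this]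
    have "\<bar>poly (P J) (real j / real n)\<bar> \<le> sqrt (Sup J - Inf J) * K" by (simp add: polyP)
    from abs_mult_le[OF this nodal_weight_bound[OF n(1) JM(2)]] show ?thesis by (simp add: A_def)
  qed
  have sub: "{x \<in> ?I. v x \<noteq> pw_interp n \<kappa> M A x} \<subseteq> ?I - \<Union>G" using \<kappa> V by auto
  have cont: "continuous_on UNIV (pw_interp n \<kappa> M A)"
    by (rule lipschitz_basis_imp_continuous[where K = L]) (use lipU in \<open>simp add: V, metis add_diff_cancel_left'\<close>)
  have "AE x in lebesgue. x \<notin> ?I - \<Union>G"
    using fin negligible_finite negligible_iff_null_sets AE_not_in by blast
  \<comment> \<open>The bound for v holds almost everywhere on the open interval. Continuity extends
    it to every point and to the closure; outside, all clamps are frozen at their values at a or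
    b.\<close>
  then have "AE x in lebesgue. x \<in> ?I \<longrightarrow> \<bar>pw_interp n \<kappa> M A x\<bar> \<le> 1"
    using Linf unfolding Linf_le_def by eventually_elim (use sub in auto)
  then have "\<bar>pw_interp n \<kappa> M A x\<bar> \<le> 1" if "x \<in> ?I" for x
    using that by (intro AE_le_imp_le[where S = ?I and f = "\<lambda>x. \<bar>pw_interp n \<kappa> M A x\<bar>"] continuous_on_rabs cont) auto
  then have "closure ?I \<subseteq> {x. \<bar>pw_interp n \<kappa> M A x\<bar> \<le> 1}"
    by (intro closure_minimal closed_Collect_le continuous_on_rabs cont continuous_on_const) auto
  then have cl: "\<bar>pw_interp n \<kappa> M A x\<bar> \<le> 1" if "x \<in> {a..b}" for x
    using that assms(1) by (auto simp: closure_greaterThanLessThan)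
  have "\<bar>pw_interp n \<kappa> M A x\<bar> \<le> 1" for x
  proof -
    define y where "y = max a (min b x)"
    have "unit_clamp (Inf J) (Sup J) x = unit_clamp (Inf J) (Sup J) y" if "J \<in> M" for J
    proof -
      have JG: "J \<in> G" using that M by blast
      have "x \<le> a \<and> y = a \<or> b \<le> x \<and> y = b \<or> y = x" using assms(1) by (auto simp: y_def max_def min_def)
      then show ?thesis
        using unit_clamp_values(1,2)[OF J(1)[OF JG], of x] unit_clamp_values(1,2)[OF J(1)[OF JG], of y]
          J(3,4)[OF JG] by auto
    qed
    then have "pw_interp n \<kappa> M A x = pw_interp n \<kappa> M A y" by (simp add: pw_interp_def)
    then show ?thesis using cl[of y] assms(1) by (simp add: y_def)
  qed
  then show ?thesis using M(1) cardM bound finite_subset[OF sub fin] by blast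
qed

section \<open>Errors of the approximating networks\<close>

definition nodal_net :: "nat \<Rightarrow> nat \<Rightarrow> nat \<Rightarrow> nat \<Rightarrow> real \<Rightarrow> real" where
  "nodal_net m k n j s = prod_tree m k (\<lambda>i. if i \<le> n \<and> i \<noteq> j then s - real i / real n else 1)"

definition pw_net :: "nat \<Rightarrow> nat \<Rightarrow> nat \<Rightarrow> real \<Rightarrow> real set set \<Rightarrow> (real set \<Rightarrow> nat \<Rightarrow> real) \<Rightarrow> real \<Rightarrow> real" where
  "pw_net m k n \<kappa> M A x = \<kappa> + (\<Sum>J\<in>M. \<Sum>j\<le>n. A J j * nodal_net m k n j (unit_clamp (Inf J) (Sup J) x))"

text \<open>The clamp to J has slope 1/|J|, so weighting it with the square root of |J| makes the
  L2 norm of its derivative independent of |J|.\<close>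

definition gauge_on :: "real set set \<Rightarrow> real \<Rightarrow> real \<Rightarrow> real" where
  "gauge_on M x y = (\<Sum>J\<in>M. sqrt (Sup J - Inf J) * \<bar>unit_clamp (Inf J) (Sup J) x - unit_clamp (Inf J) (Sup J) y\<bar>)"

lemma shifted_node_range: "\<bar>if i \<le> n \<and> i \<noteq> j then s - real i / real n else 1\<bar> \<le> 1" if "s \<in> {0..1}"
proof -
  have "0 \<le> real i / real n" "i \<le> n \<Longrightarrow> real i / real n \<le> 1" by (auto simp: divide_le_eq_1)
  then have "\<bar>s - real i / real n\<bar> \<le> 1" if "i \<le> n"
    using \<open>s \<in> {0..1}\<close> that unfolding abs_le_iff atLeastAtMost_iff by linarith
  then show ?thesis by simp
qed

lemma nodal_net_error:
  assumes "4 ^ k \<le> (2::real) ^ m" "n < 2 ^ k" "j \<le> n" "s \<in> {0..1}" "t \<in> {0..1}"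
  shows "\<bar>nodal_net m k n j s - nodal n j s\<bar> \<le> 4 ^ k / 2 ^ m"
    and "\<bar>(nodal_net m k n j s - nodal n j s) - (nodal_net m k n j t - nodal n j t)\<bar> \<le> 4 ^ k / 2 ^ m * (real n * \<bar>s - t\<bar>)"
proof -
  define f where "f = (\<lambda>s i. if i \<le> n \<and> i \<noteq> j then s - real i / real n else 1)"
  have sub: "{..n} - {j} \<subseteq> {..<2 ^ k}" using assms(2) by auto
  have P: "(\<Prod>i<2 ^ k. f s i) = nodal n j s" for s
    unfolding nodal_def using sub
    by (intro prod.mono_neutral_cong_right) (auto simp: f_def)
  have S: "(\<Sum>i<2 ^ k. \<bar>f s i - f t i\<bar>) = real n * \<bar>s - t\<bar>"
  proof -
    have "(\<Sum>i<2 ^ k. \<bar>f s i - f t i\<bar>) = (\<Sum>i\<in>{..n} - {j}. \<bar>s - t\<bar>)"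
      using sub by (intro sum.mono_neutral_cong_right) (auto simp: f_def)
    then show ?thesis using assms(3) by simp
  qed
  have E: "\<bar>prod_tree m k (f s) - (\<Prod>i<2 ^ k. f s i)\<bar> \<le> (4 ^ k - 1) / 2 ^ m \<and>
    \<bar>(prod_tree m k (f s) - (\<Prod>i<2 ^ k. f s i)) - (prod_tree m k (f t) - (\<Prod>i<2 ^ k. f t i))\<bar>
       \<le> (4 ^ k - 1) / 2 ^ m * (\<Sum>i<2 ^ k. \<bar>f s i - f t i\<bar>)"
    unfolding f_def by (intro prod_tree_error assms(1) shifted_node_range[OF assms(4)] shifted_node_range[OF assms(5)])
  have le: "(4 ^ k - 1) / 2 ^ m \<le> 4 ^ k / (2::real) ^ m" by (simp add: divide_right_mono)
  have lt: "nodal_net m k n j s = prod_tree m k (f s)" for s by (simp add: nodal_net_def f_def)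
  show "\<bar>nodal_net m k n j s - nodal n j s\<bar> \<le> 4 ^ k / 2 ^ m"
    using E le unfolding lt P by linarith
  have "(4 ^ k - 1) / 2 ^ m * (real n * \<bar>s - t\<bar>) \<le> 4 ^ k / 2 ^ m * (real n * \<bar>s - t\<bar>)"
    by (intro mult_right_mono le) auto
  then show "\<bar>(nodal_net m k n j s - nodal n j s) - (nodal_net m k n j t - nodal n j t)\<bar> \<le> 4 ^ k / 2 ^ m * (real n * \<bar>s - t\<bar>)"
    using E unfolding lt P S by linarith
qed

lemma left_diff_nodal_net: "left_diff e s \<Longrightarrow> left_diff e (\<lambda>x. nodal_net m k n j (s x))"
  unfolding nodal_net_def
proof (rule left_diff_prod_tree)
  fix i assume "left_diff e s"
  then show "left_diff e (\<lambda>x. if i \<le> n \<and> i \<noteq> j then s x - real i / real n else 1)"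
    by (cases "i \<le> n \<and> i \<noteq> j") (auto intro: left_diff_diff left_diff_const)
qed

lemma left_diff_pw_net: "left_diff e (pw_net m k n \<kappa> M A)"
proof -
  have "left_diff e (\<lambda>x. \<kappa> + (\<Sum>J\<in>M. \<Sum>j\<le>n. A J j * nodal_net m k n j (unit_clamp (Inf J) (Sup J) x)))"
    by (intro left_diff_add left_diff_const left_diff_sum left_diff_cmult left_diff_nodal_net left_diff_unit_clamp)
  then show ?thesis by (simp add: pw_net_def[abs_def])
qed

lemma gauge_on_nonneg: "(\<And>J. J \<in> M \<Longrightarrow> Inf J < Sup J) \<Longrightarrow> 0 \<le> gauge_on M x y"
  unfolding gauge_on_def by (intro sum_nonneg mult_nonneg_nonneg) (auto simp: less_imp_le)

text \<open>The square root of |J| in the coefficient bound is exactly the weight in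
  \<open>gauge_on\<close>.\<close>

lemma weighted_sum_le_gauge:
  assumes "\<And>J j. J \<in> M \<Longrightarrow> j \<le> n \<Longrightarrow> \<bar>A J j\<bar> \<le> sqrt (Sup J - Inf J) * B" "0 \<le> c"
  shows "(\<Sum>J\<in>M. \<Sum>j\<le>n. \<bar>A J j\<bar> * (c * \<bar>unit_clamp (Inf J) (Sup J) x - unit_clamp (Inf J) (Sup J) y\<bar>))
    \<le> (real n + 1) * c * B * gauge_on M x y"
proof -
  let ?s = "\<lambda>J. \<bar>unit_clamp (Inf J) (Sup J) x - unit_clamp (Inf J) (Sup J) y\<bar>"
  have "(\<Sum>J\<in>M. \<Sum>j\<le>n. \<bar>A J j\<bar> * (c * ?s J)) \<le> (\<Sum>J\<in>M. \<Sum>j\<le>n. sqrt (Sup J - Inf J) * B * (c * ?s J))"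
    using assms by (intro sum_mono mult_right_mono) auto
  also have "\<dots> = (real n + 1) * c * B * gauge_on M x y"
    by (simp add: gauge_on_def sum_distrib_left algebra_simps)
  finally show ?thesis .
qed

text \<open>One constant \<open>\<Lambda>\<close> serves all three estimates: n + 1 counts the
  coefficients per interval, a second n + 1 covers the slope n of a nodal polynomial, 2 the number
  of intervals, and the summand 1 ensures \<open>\<Lambda>\<close> >= 1. The factor 1 + ell absorbs
  sqrt |J| where values, not increments, are bounded.\<close>

lemma pw_net_error:
  assumes "4 ^ k \<le> (2::real) ^ m" "n < 2 ^ k" "card M \<le> 2" "0 \<le> B" "0 \<le> ell"
    and M: "\<And>J. J \<in> M \<Longrightarrow> Inf J < Sup J \<and> Sup J - Inf J \<le> ell"
    and A: "\<And>J j. J \<in> M \<Longrightarrow> j \<le> n \<Longrightarrow> \<bar>A J j\<bar> \<le> sqrt (Sup J - Inf J) * B"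
  defines "\<delta> \<equiv> 4 ^ k / (2::real) ^ m" and "\<Lambda> \<equiv> 1 + 2 * (real n + 1)\<^sup>2 * B"
  shows "\<bar>pw_interp n \<kappa> M A x - pw_interp n \<kappa> M A y\<bar> \<le> \<Lambda> * gauge_on M x y"
    and "\<bar>pw_net m k n \<kappa> M A x - pw_interp n \<kappa> M A x\<bar> \<le> \<Lambda> * (1 + ell) * \<delta>"
    and "\<bar>(pw_net m k n \<kappa> M A x - pw_interp n \<kappa> M A x) - (pw_net m k n \<kappa> M A y - pw_interp n \<kappa> M A y)\<bar>
      \<le> \<Lambda> * (1 + ell) * \<delta> * gauge_on M x y"
proof -
  let ?s = "\<lambda>J. unit_clamp (Inf J) (Sup J)"
  let ?e = "\<lambda>J j x. nodal_net m k n j (?s J x) - nodal n j (?s J x)"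
  have g: "0 \<le> gauge_on M x y" using M by (intro gauge_on_nonneg) blast
  have \<delta>: "0 \<le> \<delta>" by (simp add: \<delta>_def)
  have "(real n + 1) * real n * B \<le> (real n + 1) * (real n + 1) * B"
    using assms(4) by (intro mult_right_mono mult_left_mono) auto
  also have "\<dots> \<le> \<Lambda>"
  proof -
    have "0 \<le> (real n + 1) * (real n + 1) * B" using assms(4) by (intro mult_nonneg_nonneg) auto
    moreover have "\<Lambda> = 1 + ((real n + 1) * (real n + 1) * B + (real n + 1) * (real n + 1) * B)"
      by (simp add: \<Lambda>_def power2_eq_square algebra_simps)
    ultimately show ?thesis by linarith
  qed
  finally have c: "(real n + 1) * real n * B \<le> \<Lambda>" .
  have \<Lambda>: "1 \<le> \<Lambda>" using assms(4) by (simp add: \<Lambda>_def)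
  have "\<bar>pw_interp n \<kappa> M A x - pw_interp n \<kappa> M A y\<bar> \<le> (real n + 1) * real n * B * gauge_on M x y"
    using M A by (intro order_trans[OF pw_interp_lipschitz(1) weighted_sum_le_gauge]) auto
  also have "\<dots> \<le> \<Lambda> * gauge_on M x y" using c g by (intro mult_right_mono)
  finally show "\<bar>pw_interp n \<kappa> M A x - pw_interp n \<kappa> M A y\<bar> \<le> \<Lambda> * gauge_on M x y" .
  have diff: "pw_net m k n \<kappa> M A x - pw_interp n \<kappa> M A x = (\<Sum>J\<in>M. \<Sum>j\<le>n. A J j * ?e J j x)" for x
    by (simp add: pw_net_def pw_interp_def sum_subtractf right_diff_distrib)
  have "\<bar>pw_net m k n \<kappa> M A x - pw_interp n \<kappa> M A x\<bar> \<le> (\<Sum>J\<in>M. \<Sum>j\<le>n. \<bar>A J j * ?e J j x\<bar>)"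
    unfolding diff by (intro order_trans[OF sum_abs] sum_mono sum_abs)
  also have "\<dots> \<le> (\<Sum>J\<in>M. \<Sum>j\<le>n. (1 + ell) * B * \<delta>)"
  proof (intro sum_mono abs_mult_le)
    fix J j assume J: "J \<in> M" "j \<in> {..n}"
    \<comment> \<open>|J| <= ell <= (1 + ell)^2 avoids distinguishing ell < 1 from ell >= 1.\<close>
    have "sqrt (Sup J - Inf J) \<le> sqrt ((1 + ell)\<^sup>2)"
    proof (rule real_sqrt_le_mono)
      have "(1 + ell)\<^sup>2 = 1 + ell + ell + ell * ell" by (simp add: power2_eq_square algebra_simps)
      moreover have "0 \<le> ell * ell" by simp
      ultimately show "Sup J - Inf J \<le> (1 + ell)\<^sup>2" using M[OF J(1)] assms(5) by linarith
    qed
    then have "sqrt (Sup J - Inf J) \<le> 1 + ell" using assms(5) by simp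
    then have "sqrt (Sup J - Inf J) * B \<le> (1 + ell) * B" using assms(4) by (intro mult_right_mono)
    then show "\<bar>A J j\<bar> \<le> (1 + ell) * B" using A[OF J(1), of j] J(2) by (meson atMost_iff order_trans)
    show "\<bar>?e J j x\<bar> \<le> \<delta>"
      unfolding \<delta>_def using J(2) by (intro nodal_net_error(1)[OF assms(1,2), where t = 0] unit_clamp_range) auto
  qed
  also have "\<dots> = real (card M) * (real n + 1) * ((1 + ell) * B * \<delta>)" by simp
  also have "\<dots> \<le> 2 * (real n + 1) * ((1 + ell) * B * \<delta>)"
    using assms(3,4,5) \<delta> by (intro mult_right_mono mult_nonneg_nonneg) auto
  also have "\<dots> \<le> 2 * (real n + 1)\<^sup>2 * ((1 + ell) * B * \<delta>)"
    using assms(4,5) \<delta> by (intro mult_right_mono mult_nonneg_nonneg mult_left_mono) (auto simp: power2_eq_square algebra_simps)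
  also have "\<dots> = (\<Lambda> - 1) * ((1 + ell) * \<delta>)" by (simp add: \<Lambda>_def)
  also have "\<dots> \<le> \<Lambda> * (1 + ell) * \<delta>"
    using assms(5) \<delta> \<Lambda> by (simp add: algebra_simps)
  finally show "\<bar>pw_net m k n \<kappa> M A x - pw_interp n \<kappa> M A x\<bar> \<le> \<Lambda> * (1 + ell) * \<delta>" .
  have "\<bar>(pw_net m k n \<kappa> M A x - pw_interp n \<kappa> M A x) - (pw_net m k n \<kappa> M A y - pw_interp n \<kappa> M A y)\<bar>
      = \<bar>\<Sum>J\<in>M. \<Sum>j\<le>n. A J j * (?e J j x - ?e J j y)\<bar>"
    unfolding diff by (simp add: sum_subtractf right_diff_distrib)
  also have "\<dots> \<le> (\<Sum>J\<in>M. \<Sum>j\<le>n. \<bar>A J j * (?e J j x - ?e J j y)\<bar>)"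
    by (intro order_trans[OF sum_abs] sum_mono sum_abs)
  also have "\<dots> \<le> (\<Sum>J\<in>M. \<Sum>j\<le>n. \<bar>A J j\<bar> * ((\<delta> * real n) * \<bar>?s J x - ?s J y\<bar>))"
    unfolding abs_mult
  proof (intro sum_mono mult_left_mono)
    fix J j assume "j \<in> {..n}"
    then show "\<bar>?e J j x - ?e J j y\<bar> \<le> \<delta> * real n * \<bar>?s J x - ?s J y\<bar>"
      using nodal_net_error(2)[OF assms(1,2) _ unit_clamp_range unit_clamp_range, of j "Inf J" "Sup J" x "Inf J" "Sup J" y]
      unfolding \<delta>_def by (simp add: mult.assoc)
  qed simp
  also have "\<dots> \<le> (real n + 1) * (\<delta> * real n) * B * gauge_on M x y"
    using A \<delta> by (intro weighted_sum_le_gauge) auto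
  also have "\<dots> = ((real n + 1) * real n * B) * (\<delta> * gauge_on M x y)" by (simp add: algebra_simps)
  also have "\<dots> \<le> \<Lambda> * (\<delta> * gauge_on M x y)" using c \<delta> g by (intro mult_right_mono) auto
  also have "\<dots> \<le> \<Lambda> * (1 + ell) * \<delta> * gauge_on M x y"
    using assms(5) \<delta> g \<Lambda> by (simp add: algebra_simps)
  finally show "\<bar>(pw_net m k n \<kappa> M A x - pw_interp n \<kappa> M A x) - (pw_net m k n \<kappa> M A y - pw_interp n \<kappa> M A y)\<bar>
      \<le> \<Lambda> * (1 + ell) * \<delta> * gauge_on M x y" .
qed

text \<open>A tree with four leaves serves d <= 3 factors padded by ones. The increment is stated
  for a change of one leaf, since a move along a coordinate changes only one factor. Its bound
  consists of the change of the error of that factor and of the change of the factor itself,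
  multiplied by the error 2 \<open>\<eta>\<close> of the product of the others plus the Lipschitz
  error \<open>\<delta>\<close> of the tree.\<close>

lemma prod_tree_two_error:
  fixes a b :: "nat \<Rightarrow> real"
  assumes m: "16 \<le> (2::real) ^ m" and \<delta>: "16 / 2 ^ m \<le> \<delta>"
    and a: "\<And>i. \<bar>a i\<bar> \<le> 1" and b: "\<And>i. \<bar>b i\<bar> \<le> 1" and ab: "\<And>i. \<bar>a i - b i\<bar> \<le> \<eta> / 2"
  shows "\<bar>(\<Prod>i<4. b i) - prod_tree m 2 a\<bar> \<le> 2 * \<eta> + \<delta>"
    and "\<lbrakk>i0 < 4; \<bar>a0\<bar> \<le> 1; \<bar>b0\<bar> \<le> 1; \<bar>a0 - b0\<bar> \<le> \<eta> / 2\<rbrakk> \<Longrightarrow>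
      \<bar>((\<Prod>i<4. b i) - prod_tree m 2 a) - ((\<Prod>i<4. (b(i0 := b0)) i) - prod_tree m 2 (a(i0 := a0)))\<bar>
      \<le> \<bar>(b i0 - a i0) - (b0 - a0)\<bar> + (2 * \<eta> + \<delta>) * \<bar>a i0 - a0\<bar>"
proof -
  have m': "4 ^ 2 \<le> (2::real) ^ m" using m by simp
  have E: "\<bar>prod_tree m 2 a - (\<Prod>i<4. a i)\<bar> \<le> \<delta> \<and>
    \<bar>(prod_tree m 2 a - (\<Prod>i<4. a i)) - (prod_tree m 2 a' - (\<Prod>i<4. a' i))\<bar> \<le> \<delta> * (\<Sum>i<4. \<bar>a i - a' i\<bar>)"
    if "\<And>i. \<bar>a' i\<bar> \<le> 1" for a'
  proof -
    have "(4 ^ 2 - 1) / 2 ^ m \<le> 16 / (2::real) ^ m" by (simp add: divide_right_mono)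
    then have le: "(4 ^ 2 - 1) / (2::real) ^ m \<le> \<delta>" using \<delta> by linarith
    have "(4 ^ 2 - 1) / 2 ^ m * (\<Sum>i<4. \<bar>a i - a' i\<bar>) \<le> \<delta> * (\<Sum>i<4. \<bar>a i - a' i\<bar>)"
      by (intro mult_right_mono le sum_nonneg) auto
    moreover have "\<bar>prod_tree m 2 a - (\<Prod>i<2 ^ 2. a i)\<bar> \<le> (4 ^ 2 - 1) / 2 ^ m \<and>
      \<bar>(prod_tree m 2 a - (\<Prod>i<2 ^ 2. a i)) - (prod_tree m 2 a' - (\<Prod>i<2 ^ 2. a' i))\<bar> \<le> (4 ^ 2 - 1) / 2 ^ m * (\<Sum>i<2 ^ 2. \<bar>a i - a' i\<bar>)"
      by (rule prod_tree_error) (use m' a that in auto)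
    moreover have "(2::nat) ^ 2 = 4" by simp
    ultimately show ?thesis using le by (smt (verit))
  qed
  have E0: "\<bar>prod_tree m 2 a - (\<Prod>i<4. a i)\<bar> \<le> \<delta>" using E[of a] a by blast
  have "\<bar>(\<Prod>i<4. b i) - (\<Prod>i<4. a i)\<bar> \<le> (\<Sum>i<(4::nat). \<bar>b i - a i\<bar>)"
    by (rule prod_lipschitz) (use a b in auto)
  also have "\<dots> \<le> (\<Sum>i<(4::nat). \<eta> / 2)" by (intro sum_mono) (metis ab abs_minus_commute)
  finally have "\<bar>(\<Prod>i<4. b i) - (\<Prod>i<4. a i)\<bar> \<le> 2 * \<eta>" by simp
  then show "\<bar>(\<Prod>i<4. b i) - prod_tree m 2 a\<bar> \<le> 2 * \<eta> + \<delta>" using E0 by linarith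
  assume i0: "i0 < 4" and a0: "\<bar>a0\<bar> \<le> 1" and b0: "\<bar>b0\<bar> \<le> 1" and ab0: "\<bar>a0 - b0\<bar> \<le> \<eta> / 2"
  define I where "I = {..<4::nat} - {i0}"
  define PA PB where "PA = (\<Prod>i\<in>I. a i)" and "PB = (\<Prod>i\<in>I. b i)"
  have split: "(\<Prod>i<4. f i) = f i0 * (\<Prod>i\<in>I. f i)" for f :: "nat \<Rightarrow> real"
    unfolding I_def using i0 by (intro prod.remove) auto
  have upd: "(\<Prod>i\<in>I. (f(i0 := c)) i) = (\<Prod>i\<in>I. f i)" for f :: "nat \<Rightarrow> real" and c
    by (rule prod.cong) (auto simp: I_def)
  have "\<bar>PA - PB\<bar> \<le> (\<Sum>i\<in>I. \<bar>a i - b i\<bar>)"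
    unfolding PA_def PB_def by (rule prod_lipschitz) (use a b in auto)
  also have "\<dots> \<le> (\<Sum>i\<in>I. \<eta> / 2)" by (intro sum_mono ab)
  also have "\<dots> = 3 * (\<eta> / 2)" using i0 by (simp add: I_def)
  also have "\<dots> \<le> 2 * \<eta>" using order_trans[OF abs_ge_zero ab[of 0]] by simp
  finally have PAB: "\<bar>PA - PB\<bar> \<le> 2 * \<eta>" .
  have PB: "\<bar>PB\<bar> \<le> 1" unfolding PB_def by (rule prod_range) (use b in auto)
  have "\<bar>(prod_tree m 2 a - (\<Prod>i<4. a i)) - (prod_tree m 2 (a(i0 := a0)) - (\<Prod>i<4. (a(i0 := a0)) i))\<bar>
      \<le> \<delta> * (\<Sum>i<4. \<bar>a i - (a(i0 := a0)) i\<bar>)"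
    using E[of "a(i0 := a0)"] a a0 by auto
  also have "(\<Sum>i<4. \<bar>a i - (a(i0 := a0)) i\<bar>) = (\<Sum>i<4. if i = i0 then \<bar>a i0 - a0\<bar> else 0)"
    by (rule sum.cong) auto
  also have "\<dots> = \<bar>a i0 - a0\<bar>" using i0 by simp
  finally have T: "\<bar>(prod_tree m 2 a - a i0 * PA) - (prod_tree m 2 (a(i0 := a0)) - a0 * PA)\<bar> \<le> \<delta> * \<bar>a i0 - a0\<bar>"
    unfolding split upd by (simp add: PA_def fun_upd_def)
  have eq: "((\<Prod>i<4. b i) - prod_tree m 2 a) - ((\<Prod>i<4. (b(i0 := b0)) i) - prod_tree m 2 (a(i0 := a0)))
     = ((b i0 - a i0) - (b0 - a0)) * PB - (a i0 - a0) * (PA - PB)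
      - ((prod_tree m 2 a - a i0 * PA) - (prod_tree m 2 (a(i0 := a0)) - a0 * PA))"
    unfolding split upd by (simp add: PB_def algebra_simps)
  have "\<bar>p - q - r\<bar> \<le> p' + q' + r'" if "\<bar>p\<bar> \<le> p'" "\<bar>q\<bar> \<le> q'" "\<bar>r\<bar> \<le> r'" for p q r p' q' r' :: real
    using that by linarith
  from this[OF abs_mult_le[OF order_refl PB] abs_mult_le[OF order_refl PAB] T]
  show "\<bar>((\<Prod>i<4. b i) - prod_tree m 2 a) - ((\<Prod>i<4. (b(i0 := b0)) i) - prod_tree m 2 (a(i0 := a0)))\<bar>
      \<le> \<bar>(b i0 - a i0) - (b0 - a0)\<bar> + (2 * \<eta> + \<delta>) * \<bar>a i0 - a0\<bar>"
    unfolding eq by (rule order_trans) (simp add: algebra_simps)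
qed

section \<open>Estimates in H1\<close>

lemma set_integral_cong_AE_lebesgue:
  fixes f g :: "'a::euclidean_space \<Rightarrow> real"
  assumes "(\<lambda>x. indicator S x * f x) \<in> borel_measurable lebesgue" "AE x in lebesgue. x \<in> S \<longrightarrow> f x = g x"
  shows "(\<lambda>x. indicator S x * g x) \<in> borel_measurable lebesgue"
    and "(LINT x:S|lebesgue. f x) = (LINT x:S|lebesgue. g x)"
    and "set_integrable lebesgue S f \<longleftrightarrow> set_integrable lebesgue S g"
proof -
  have ae: "AE x in lebesgue. indicator S x * f x = indicator S x * g x"
    using assms(2) by eventually_elim (auto simp: indicator_def)
  show m: "(\<lambda>x. indicator S x * g x) \<in> borel_measurable lebesgue"
    by (rule borel_measurable_AE[OF assms(1) ae])
  show "(LINT x:S|lebesgue. f x) = (LINT x:S|lebesgue. g x)"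
    unfolding set_lebesgue_integral_def using integral_cong_AE[OF assms(1) m ae] by simp
  show "set_integrable lebesgue S f \<longleftrightarrow> set_integrable lebesgue S g"
    unfolding set_integrable_def using integrable_cong_AE[OF assms(1) m ae] by simp
qed

text \<open>Weak derivatives agree almost everywhere, so the arbitrary choice inside
  \<open>H1_norm\<close> can be replaced by any concrete weak derivative.\<close>

lemma weak_partial_unique_L2:
  fixes w g D :: "'a::euclidean_space \<Rightarrow> real"
  assumes "sq_int (box A B) g" "weak_partial (box A B) w e g" "sq_int (box A B) D" "weak_partial (box A B) w e D"
  shows "L2_norm_on (box A B) g = L2_norm_on (box A B) D"
proof -
  let ?Q = "box A B"
  have Q: "?Q \<in> lmeasurable" by simp
  have ig: "set_integrable lebesgue ?Q g" "set_integrable lebesgue ?Q D"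
    using assms sq_int_imp_integrable Q by blast+
  have "(LINT x:?Q|lebesgue. (g x - D x) * \<phi> x) = 0" if \<phi>: "test_fun ?Q \<phi>" for \<phi>
  proof -
    have "(LINT x:?Q|lebesgue. (g x - D x) * \<phi> x) = (LINT x:?Q|lebesgue. g x * \<phi> x) - (LINT x:?Q|lebesgue. D x * \<phi> x)"
      unfolding left_diff_distrib
      by (rule set_integral_diff(2)[OF set_integrable_mult_test[OF ig(1) \<phi>] set_integrable_mult_test[OF ig(2) \<phi>]])
    also have "\<dots> = 0" using assms(2,4) \<phi> unfolding weak_partial_def by simp
    finally show ?thesis .
  qed
  then have "AE x in lebesgue. x \<in> ?Q \<longrightarrow> g x - D x = 0"
    by (intro test_zero_imp_AE_zero set_integral_diff(1)[OF ig])
  then have ae: "AE x in lebesgue. x \<in> ?Q \<longrightarrow> (g x)\<^sup>2 = (D x)\<^sup>2" by eventually_elim auto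
  have "(\<lambda>x. (indicator ?Q x * g x)\<^sup>2) \<in> borel_measurable lebesgue"
    using assms(1) unfolding sq_int_def by (intro borel_measurable_power) blast
  moreover have "(\<lambda>x. (indicator ?Q x * g x)\<^sup>2) = (\<lambda>x. indicator ?Q x * (g x)\<^sup>2)"
    by (auto simp: indicator_def)
  ultimately have "(\<lambda>x. indicator ?Q x * (g x)\<^sup>2) \<in> borel_measurable lebesgue" by simp
  from set_integral_cong_AE_lebesgue(2)[OF this ae] show ?thesis by (simp add: L2_norm_on_def)
qed

text \<open>The two functions are kept apart because w inherits the arbitrary values of the v_i at
  partition points, while all pointwise estimates concern the Lipschitz version w'. The constant K
  yields only existence of the weak derivatives; the norm depends on B0 and B1.\<close>

lemma H1_bound:
  fixes w w' :: "'a::euclidean_space \<Rightarrow> real"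
  assumes ae: "AE x in lebesgue. x \<in> box A B \<longrightarrow> w' x = w x"
    and lip: "\<And>e x h. e \<in> Basis \<Longrightarrow> \<bar>w' (x + h *\<^sub>R e) - w' x\<bar> \<le> K * \<bar>h\<bar>"
    and left_diff: "\<And>e. e \<in> Basis \<Longrightarrow> left_diff e w'"
    and b0: "\<And>x. \<bar>w' x\<bar> \<le> B0"
    and b1: "\<And>e. e \<in> Basis \<Longrightarrow> (LINT x:box A B|lebesgue. (lim (left_quot e w' x))\<^sup>2) \<le> B1"
  shows "in_H1 (box A B) w" "(H1_norm (box A B) w)\<^sup>2 \<le> B0\<^sup>2 * measure lebesgue (box A B) + real DIM('a) * B1"
proof -
  let ?Q = "box A B"
  have Q: "?Q \<in> lmeasurable" by simp
  then have Qs[measurable]: "?Q \<in> sets lebesgue" by (rule fmeasurableD)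
  have cont: "continuous_on UNIV w'" by (rule lipschitz_basis_imp_continuous[OF lip])
  have m[measurable]: "w' \<in> borel_measurable lebesgue"
    using borel_measurable_continuous_onI[OF cont] by (intro measurable_completion) simp
  have mQ: "(\<lambda>x. indicator ?Q x * w' x) \<in> borel_measurable lebesgue" by measurable
  have mQ2: "(\<lambda>x. indicator ?Q x * (w' x)\<^sup>2) \<in> borel_measurable lebesgue" by measurable
  have ae2: "AE x in lebesgue. x \<in> ?Q \<longrightarrow> (w' x)\<^sup>2 = (w x)\<^sup>2" using ae by eventually_elim auto
  have sq': "sq_int ?Q w'" by (rule sq_int_bounded[OF m Q b0])
  have sq: "sq_int ?Q w"
    using sq' set_integral_cong_AE_lebesgue(1)[OF mQ ae] set_integral_cong_AE_lebesgue(3)[OF mQ2 ae2]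
    by (simp add: sq_int_def)
  define D where "D = (\<lambda>e x. lim (left_quot e w' x))"
  have sqD: "sq_int ?Q (D e)" if e: "e \<in> Basis" for e
  proof (rule sq_int_bounded[OF _ Q])
    show "D e \<in> borel_measurable lebesgue"
      using lim_left_quot_borel[OF cont lip[OF e] left_diff[OF e]] unfolding D_def by (intro measurable_completion) simp
    show "\<bar>D e x\<bar> \<le> K" for x unfolding D_def by (rule left_quot_limit_bounded(2)[OF left_diff[OF e] lip[OF e]])
  qed
  have wD: "weak_partial ?Q w e (D e)" if e: "e \<in> Basis" for e
    unfolding weak_partial_def
  proof (intro allI impI)
    fix \<phi> assume \<phi>: "test_fun ?Q \<phi>"
    have "(\<lambda>x. frechet_derivative \<phi> (at x) e) \<in> borel_measurable lebesgue"
      using test_fun_borel[OF test_fun_derivative[OF \<phi> e]] by (intro measurable_completion) simp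
    then have mm: "(\<lambda>x. indicator ?Q x * (w' x * frechet_derivative \<phi> (at x) e)) \<in> borel_measurable lebesgue"
      by measurable
    have "AE x in lebesgue. x \<in> ?Q \<longrightarrow> w' x * frechet_derivative \<phi> (at x) e = w x * frechet_derivative \<phi> (at x) e"
      using ae by eventually_elim auto
    from set_integral_cong_AE_lebesgue(2)[OF mm this]
    have "(LINT x:?Q|lebesgue. w x * frechet_derivative \<phi> (at x) e) = (LINT x:?Q|lebesgue. w' x * frechet_derivative \<phi> (at x) e)"
      by simp
    also have "\<dots> = - (LINT x:?Q|lebesgue. D e x * \<phi> x)"
      using weak_partial_lim_left_quot[OF e cont lip[OF e] left_diff[OF e], of ?Q] \<phi> unfolding weak_partial_def D_def by blast
    finally show "(LINT x:?Q|lebesgue. w x * frechet_derivative \<phi> (at x) e) = - (LINT x:?Q|lebesgue. D e x * \<phi> x)" .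
  qed
  show "in_H1 ?Q w" unfolding in_H1_def using sq sqD wD by blast
  have "L2_norm_on ?Q (SOME g. sq_int ?Q g \<and> weak_partial ?Q w e g) = L2_norm_on ?Q (D e)" if e: "e \<in> Basis" for e
  proof -
    have "\<exists>g. sq_int ?Q g \<and> weak_partial ?Q w e g" using sqD[OF e] wD[OF e] by blast
    from someI_ex[OF this] show ?thesis using weak_partial_unique_L2 sqD[OF e] wD[OF e] by blast
  qed
  moreover have "(L2_norm_on ?Q (D e))\<^sup>2 \<le> B1" if e: "e \<in> Basis" for e
  proof -
    have "0 \<le> (LINT x:?Q|lebesgue. (D e x)\<^sup>2)"
      unfolding set_lebesgue_integral_def by (rule integral_nonneg_AE) auto
    then show ?thesis using b1[OF e] by (simp add: L2_norm_on_def D_def)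
  qed
  ultimately have sumb: "(\<Sum>e\<in>Basis. (L2_norm_on ?Q (SOME g. sq_int ?Q g \<and> weak_partial ?Q w e g))\<^sup>2) \<le> real DIM('a) * B1"
    by (intro sum_bounded_above) auto
  have "(L2_norm_on ?Q w)\<^sup>2 = (LINT x:?Q|lebesgue. (w x)\<^sup>2)"
  proof -
    have "0 \<le> (LINT x:?Q|lebesgue. (w x)\<^sup>2)"
      unfolding set_lebesgue_integral_def by (rule integral_nonneg_AE) auto
    then show ?thesis by (simp add: L2_norm_on_def)
  qed
  also have "\<dots> = (LINT x:?Q|lebesgue. (w' x)\<^sup>2)"
    using set_integral_cong_AE_lebesgue(2)[OF mQ2 ae2] by simp
  also have "\<dots> \<le> (\<integral>x. B0\<^sup>2 * indicator ?Q x \<partial>lebesgue)"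
    unfolding set_lebesgue_integral_def
  proof (rule integral_mono)
    show "integrable lebesgue (\<lambda>x. indicator ?Q x *\<^sub>R (w' x)\<^sup>2)" using sq' by (simp add: sq_int_def set_integrable_def)
    show "integrable lebesgue (\<lambda>x. B0\<^sup>2 * indicat_real ?Q x)" using Q by (simp add: lmeasurable_iff_integrable)
    show "indicator ?Q x *\<^sub>R (w' x)\<^sup>2 \<le> B0\<^sup>2 * indicator ?Q x" for x
    proof -
      have "(w' x)\<^sup>2 \<le> B0\<^sup>2" using b0[of x] by (metis abs_ge_zero power2_abs power_mono)
      then show ?thesis by (simp add: indicator_def)
    qed
  qed
  also have "\<dots> = B0\<^sup>2 * measure lebesgue ?Q" by simp
  finally have wb: "(L2_norm_on ?Q w)\<^sup>2 \<le> B0\<^sup>2 * measure lebesgue ?Q" .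
  have "(H1_norm ?Q w)\<^sup>2 = (L2_norm_on ?Q w)\<^sup>2 + (\<Sum>e\<in>Basis. (L2_norm_on ?Q (SOME g. sq_int ?Q g \<and> weak_partial ?Q w e g))\<^sup>2)"
    unfolding H1_norm_def by (intro real_sqrt_pow2 add_nonneg_nonneg sum_nonneg) auto
  then show "(H1_norm ?Q w)\<^sup>2 \<le> B0\<^sup>2 * measure lebesgue ?Q + real DIM('a) * B1" using wb sumb by linarith
qed

section \<open>The cube and functions concentrated on slabs\<close>

definition cube :: "real \<Rightarrow> real \<Rightarrow> 'a::euclidean_space set" where
  "cube a b = {x. \<forall>j\<in>Basis. x \<bullet> j \<in> {a<..<b}}"

lemma cube_eq_box: "cube a b = box (a *\<^sub>R One) (b *\<^sub>R One)"
  by (auto simp: cube_def mem_box)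

text \<open>The corners differ from those of the cube in the e-th coordinate only: the closed box
  consists of the points whose e-th coordinate runs over the given interval.\<close>

lemma measure_slab:
  fixes e :: "'a::euclidean_space"
  assumes "e \<in> Basis" "a \<le> b" "\<alpha> \<le> \<beta>"
  defines "l \<equiv> a *\<^sub>R One + (\<alpha> - a) *\<^sub>R e" and "u \<equiv> b *\<^sub>R One + (\<beta> - b) *\<^sub>R e"
  shows "x \<in> cube a b \<Longrightarrow> x \<bullet> e \<in> {\<alpha>..\<beta>} \<Longrightarrow> x \<in> cbox l u"
    and "measure lebesgue (cbox l u) = (\<beta> - \<alpha>) * (b - a) ^ (DIM('a) - 1)"
proof -
  have lj: "l \<bullet> j = (if j = e then \<alpha> else a)" "u \<bullet> j = (if j = e then \<beta> else b)" if "j \<in> Basis" for j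
    using assms(1) that by (auto simp: l_def u_def inner_add_left inner_Basis)
  show "x \<in> cbox l u" if "x \<in> cube a b" "x \<bullet> e \<in> {\<alpha>..\<beta>}"
    unfolding mem_box
  proof
    fix j :: 'a assume "j \<in> Basis"
    then show "l \<bullet> j \<le> x \<bullet> j \<and> x \<bullet> j \<le> u \<bullet> j" using that lj[of j] by (auto simp: cube_def less_imp_le)
  qed
  have "measure lebesgue (cbox l u) = (\<Prod>j\<in>Basis. u \<bullet> j - l \<bullet> j)"
    using content_cbox[of l u] lj assms(2,3) by (simp add: measure_completion)
  also have "\<dots> = (\<Prod>j\<in>Basis. if j = e then \<beta> - \<alpha> else b - a)" by (rule prod.cong) (auto simp: lj)
  also have "\<dots> = (\<beta> - \<alpha>) * (\<Prod>j\<in>Basis - {e}. b - a)"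
    by (subst prod.remove[OF _ assms(1)]) (auto intro!: arg_cong2[of _ _ _ _ "(*)"] prod.cong)
  also have "(\<Prod>j\<in>Basis - {e}. b - a) = (b - a) ^ (DIM('a) - 1)" using assms(1) by simp
  finally show "measure lebesgue (cbox l u) = (\<beta> - \<alpha>) * (b - a) ^ (DIM('a) - 1)" .
qed

text \<open>The square of |J|^(-1/2) on the slab over J has integral (b-a)^(d-1), whatever the
  length of J. Two uses of the Cauchy-Schwarz inequality reduce to this case: one for the at most
  two intervals of an index, giving a factor 2, one for the weights |c|, giving a factor Y. Adding
  the integrals over two slabs gives the second 2, hence the square of 2 C X.\<close>

lemma L2_step_bound:
  fixes D :: "'a::euclidean_space \<Rightarrow> real" and cc :: "'i \<Rightarrow> real" and M :: "'i \<Rightarrow> real set set"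
  assumes e: "e \<in> Basis" and ab: "a < b" and S: "finite S" and C: "0 \<le> C"
    and M: "\<And>\<kappa>. \<kappa> \<in> S \<Longrightarrow> finite (M \<kappa>) \<and> card (M \<kappa>) \<le> 2" "\<And>\<kappa> J. \<kappa> \<in> S \<Longrightarrow> J \<in> M \<kappa> \<Longrightarrow> Inf J < Sup J"
    and D: "\<And>x. \<bar>D x\<bar> \<le> C * (\<Sum>\<kappa>\<in>S. \<bar>cc \<kappa>\<bar> * (\<Sum>J\<in>M \<kappa>. 1 / sqrt (Sup J - Inf J) * indicator {Inf J..Sup J} (x \<bullet> e)))"
    and X: "(\<Sum>\<kappa>\<in>S. \<bar>cc \<kappa>\<bar>) \<le> X"
  shows "(LINT x:cube a b|lebesgue. (D x)\<^sup>2) \<le> (2 * C * X)\<^sup>2 * (b - a) ^ (DIM('a) - 1)"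
proof -
  define Y where "Y = (\<Sum>\<kappa>\<in>S. \<bar>cc \<kappa>\<bar>)"
  have Y: "0 \<le> Y" by (simp add: Y_def sum_nonneg)
  define B where "B = (\<lambda>J. cbox (a *\<^sub>R One + (Inf J - a) *\<^sub>R e) (b *\<^sub>R One + (Sup J - b) *\<^sub>R e))"
  define R where "R = (\<lambda>x. C\<^sup>2 * (Y * (\<Sum>\<kappa>\<in>S. \<bar>cc \<kappa>\<bar> * (2 * (\<Sum>J\<in>M \<kappa>. 1 / (Sup J - Inf J) * indicator (B J) x)))))"
  have intR: "integrable lebesgue R"
    unfolding R_def B_def by (intro integrable_mult_right Bochner_Integration.integrable_sum) (auto simp: lmeasurable_iff_integrable[symmetric])
  have sq: "(D x)\<^sup>2 \<le> R x" if x: "x \<in> cube a b" for x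
  proof -
    define \<beta> where "\<beta> = (\<lambda>\<kappa>. \<Sum>J\<in>M \<kappa>. 1 / sqrt (Sup J - Inf J) * indicator {Inf J..Sup J} (x \<bullet> e))"
    have \<beta>: "(\<beta> \<kappa>)\<^sup>2 \<le> 2 * (\<Sum>J\<in>M \<kappa>. 1 / (Sup J - Inf J) * indicator (B J) x)" if \<kappa>: "\<kappa> \<in> S" for \<kappa>
    proof -
      have "(\<beta> \<kappa>)\<^sup>2 \<le> (\<Sum>J\<in>M \<kappa>. 1\<^sup>2) * (\<Sum>J\<in>M \<kappa>. (1 / sqrt (Sup J - Inf J) * indicator {Inf J..Sup J} (x \<bullet> e))\<^sup>2)"
        using Cauchy_Schwarz_ineq_sum[of "\<lambda>_. 1" "\<lambda>J. 1 / sqrt (Sup J - Inf J) * indicator {Inf J..Sup J} (x \<bullet> e)" "M \<kappa>"]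
        by (simp add: \<beta>_def)
      also have "\<dots> \<le> 2 * (\<Sum>J\<in>M \<kappa>. 1 / (Sup J - Inf J) * indicator (B J) x)"
      proof (intro mult_mono sum_mono)
        show "(\<Sum>J\<in>M \<kappa>. 1\<^sup>2) \<le> (2::real)" using M(1)[OF \<kappa>] by simp
        fix J assume J: "J \<in> M \<kappa>"
        show "(1 / sqrt (Sup J - Inf J) * indicator {Inf J..Sup J} (x \<bullet> e))\<^sup>2 \<le> 1 / (Sup J - Inf J) * indicator (B J) x"
        proof (cases "x \<bullet> e \<in> {Inf J..Sup J}")
          case True
          then have "x \<in> B J" unfolding B_def using M(2)[OF \<kappa> J] ab by (intro measure_slab(1)[OF e _ _ x]) auto
          then show ?thesis using True M(2)[OF \<kappa> J] by (simp add: power_divide)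
        next
          case False
          then show ?thesis using M(2)[OF \<kappa> J] by (auto simp: indicator_def)
        qed
      qed (auto intro: sum_nonneg)
      finally show ?thesis .
    qed
    \<comment> \<open>Splitting the weight evenly keeps the l1 norm of the coefficients as the only
      trace of the number of terms.\<close>
    have "(\<Sum>\<kappa>\<in>S. \<bar>cc \<kappa>\<bar> * \<beta> \<kappa>)\<^sup>2 = (\<Sum>\<kappa>\<in>S. sqrt \<bar>cc \<kappa>\<bar> * (sqrt \<bar>cc \<kappa>\<bar> * \<beta> \<kappa>))\<^sup>2"
      by (simp flip: mult.assoc)
    also have "\<dots> \<le> (\<Sum>\<kappa>\<in>S. (sqrt \<bar>cc \<kappa>\<bar>)\<^sup>2) * (\<Sum>\<kappa>\<in>S. (sqrt \<bar>cc \<kappa>\<bar> * \<beta> \<kappa>)\<^sup>2)"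
      by (rule Cauchy_Schwarz_ineq_sum)
    also have "\<dots> = Y * (\<Sum>\<kappa>\<in>S. \<bar>cc \<kappa>\<bar> * (\<beta> \<kappa>)\<^sup>2)" by (simp add: Y_def power_mult_distrib)
    also have "\<dots> \<le> Y * (\<Sum>\<kappa>\<in>S. \<bar>cc \<kappa>\<bar> * (2 * (\<Sum>J\<in>M \<kappa>. 1 / (Sup J - Inf J) * indicator (B J) x)))"
      using \<beta> Y by (intro mult_left_mono sum_mono) auto
    finally have CS: "C\<^sup>2 * (\<Sum>\<kappa>\<in>S. \<bar>cc \<kappa>\<bar> * \<beta> \<kappa>)\<^sup>2 \<le> R x" unfolding R_def by (intro mult_left_mono) auto
    have "\<bar>D x\<bar>\<^sup>2 \<le> (C * (\<Sum>\<kappa>\<in>S. \<bar>cc \<kappa>\<bar> * \<beta> \<kappa>))\<^sup>2" using D[of x] by (intro power_mono) (auto simp: \<beta>_def)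
    then show ?thesis using CS by (simp add: power_mult_distrib)
  qed
  have Rn: "0 \<le> R x" for x
    unfolding R_def using Y M(2) by (intro mult_nonneg_nonneg sum_nonneg) (auto simp: less_imp_le)
  have "(LINT x:cube a b|lebesgue. (D x)\<^sup>2) \<le> (\<integral>x. R x \<partial>lebesgue)"
    unfolding set_lebesgue_integral_def
    by (rule integral_mono_AE'[OF intR]) (use sq Rn in \<open>auto simp: indicator_def\<close>)
  also have "\<dots> = C\<^sup>2 * (Y * (\<Sum>\<kappa>\<in>S. \<bar>cc \<kappa>\<bar> * (2 * (\<Sum>J\<in>M \<kappa>. 1 / (Sup J - Inf J) * measure lebesgue (B J)))))"
  proof -
    have i: "integrable lebesgue (indicat_real (B J))" for J
      unfolding B_def by (auto simp: lmeasurable_iff_integrable[symmetric])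
    show ?thesis unfolding R_def
      by (simp add: i Bochner_Integration.integral_sum del: times_divide_eq_left)
  qed
  also have "\<dots> \<le> C\<^sup>2 * (Y * (\<Sum>\<kappa>\<in>S. \<bar>cc \<kappa>\<bar> * (2 * (2 * (b - a) ^ (DIM('a) - 1)))))"
  proof (intro mult_left_mono sum_mono)
    fix \<kappa> assume \<kappa>: "\<kappa> \<in> S"
    have "(\<Sum>J\<in>M \<kappa>. 1 / (Sup J - Inf J) * measure lebesgue (B J)) = (\<Sum>J\<in>M \<kappa>. (b - a) ^ (DIM('a) - 1))"
    proof (rule sum.cong)
      fix J assume "J \<in> M \<kappa>"
      then have "Inf J < Sup J" using M(2)[OF \<kappa>] by blast
      then show "1 / (Sup J - Inf J) * measure lebesgue (B J) = (b - a) ^ (DIM('a) - 1)"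
        unfolding B_def using measure_slab(2)[OF e, of a b "Inf J" "Sup J"] ab by simp
    qed simp
    also have "\<dots> \<le> 2 * (b - a) ^ (DIM('a) - 1)" using M(1)[OF \<kappa>] ab by (simp add: mult_right_mono)
    finally show "(\<Sum>J\<in>M \<kappa>. 1 / (Sup J - Inf J) * measure lebesgue (B J)) \<le> 2 * (b - a) ^ (DIM('a) - 1)" .
  qed (use Y in auto)
  also have "\<dots> = (2 * C * Y)\<^sup>2 * (b - a) ^ (DIM('a) - 1)"
    by (simp add: Y_def[symmetric] sum_distrib_right[symmetric] power2_eq_square algebra_simps)
  also have "\<dots> \<le> (2 * C * X)\<^sup>2 * (b - a) ^ (DIM('a) - 1)"
    using X Y C ab by (intro mult_right_mono power_mono mult_left_mono mult_nonneg_nonneg) (auto simp: Y_def)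
  finally show ?thesis .
qed

section \<open>Tensor products\<close>

lemma coord_enum_bij: "bij_betw (coord_enum :: nat \<Rightarrow> 'a::euclidean_space) {..<DIM('a)} Basis"
proof -
  have "\<exists>e::nat \<Rightarrow> 'a. bij_betw e {..<DIM('a)} Basis"
    using ex_bij_betw_nat_finite[OF finite_Basis] by (auto simp: atLeast0LessThan)
  then show ?thesis unfolding coord_enum_def by (rule someI_ex)
qed

lemma gauge_on_lipschitz:
  assumes "\<And>J. J \<in> M \<Longrightarrow> Inf J < Sup J"
  shows "gauge_on M x y \<le> (\<Sum>J\<in>M. 1 / sqrt (Sup J - Inf J)) * \<bar>x - y\<bar>"
  unfolding gauge_on_def sum_distrib_right
proof (rule sum_mono)
  fix J assume "J \<in> M"
  then have J: "0 < Sup J - Inf J" using assms by simp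
  have "sqrt (Sup J - Inf J) * \<bar>unit_clamp (Inf J) (Sup J) x - unit_clamp (Inf J) (Sup J) y\<bar>
      \<le> sqrt (Sup J - Inf J) * (\<bar>x - y\<bar> / (Sup J - Inf J))"
    using J by (intro mult_left_mono unit_clamp_lipschitz) auto
  also have "\<dots> = 1 / sqrt (Sup J - Inf J) * \<bar>x - y\<bar>"
    using J real_div_sqrt[of "Sup J - Inf J"] by (simp add: field_simps)
  finally show "sqrt (Sup J - Inf J) * \<bar>unit_clamp (Inf J) (Sup J) x - unit_clamp (Inf J) (Sup J) y\<bar>
      \<le> 1 / sqrt (Sup J - Inf J) * \<bar>x - y\<bar>" .
qed

text \<open>Outside J the clamp is constant near y, so the quotient vanishes: at once to the left of
  J, and to the right as soon as the step is shorter than the distance to J, hence "eventually". At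
  the right end point the left quotient still sees J, which is why the closed interval
  appears.\<close>

lemma gauge_on_quotient:
  assumes "finite M" "\<And>J. J \<in> M \<Longrightarrow> Inf J < Sup J"
  shows "\<forall>\<^sub>F n in sequentially. gauge_on M (y - 1 / real (Suc n)) y * real (Suc n)
    \<le> (\<Sum>J\<in>M. 1 / sqrt (Sup J - Inf J) * indicator {Inf J..Sup J} y)"
proof -
  let ?s = "\<lambda>J. unit_clamp (Inf J) (Sup J)"
  have "\<forall>\<^sub>F n in sequentially. \<bar>?s J (y - 1 / real (Suc n)) - ?s J y\<bar> * real (Suc n)
      \<le> 1 / (Sup J - Inf J) * indicator {Inf J..Sup J} y" if "J \<in> M" for J
  proof -
    have J: "Inf J < Sup J" using assms(2) that .
    consider "y \<in> {Inf J..Sup J}" | "y < Inf J" | "Sup J < y" by fastforce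
    then show ?thesis
    proof cases
      case 1
      have "\<bar>?s J (y - 1 / real (Suc n)) - ?s J y\<bar> * real (Suc n) \<le> 1 / (Sup J - Inf J)" for n
      proof -
        have "\<bar>?s J (y - 1 / real (Suc n)) - ?s J y\<bar> * real (Suc n)
            \<le> (\<bar>y - 1 / real (Suc n) - y\<bar> / (Sup J - Inf J)) * real (Suc n)"
          using J by (intro mult_right_mono unit_clamp_lipschitz) auto
        also have "\<dots> = 1 / (Sup J - Inf J)" by (simp del: of_nat_Suc)
        finally show ?thesis .
      qed
      then show ?thesis using 1 by simp
    next
      case 2
      have "\<bar>?s J (y - 1 / real (Suc n)) - ?s J y\<bar> * real (Suc n) \<le> 1 / (Sup J - Inf J) * indicator {Inf J..Sup J} y" for n
      proof -
        have "0 < 1 / real (Suc n)" by simp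
        then have "?s J (y - 1 / real (Suc n)) = 0" "?s J y = 0"
          using 2 by (intro unit_clamp_values(1)[OF J]; linarith)+
        then show ?thesis using 2 by simp
      qed
      then show ?thesis by simp
    next
      case 3
      have "(\<lambda>n. y - inverse (real (Suc n))) \<longlonglongrightarrow> y - 0"
        by (intro tendsto_diff tendsto_const LIMSEQ_inverse_real_of_nat)
      then have "\<forall>\<^sub>F n in sequentially. Sup J < y - inverse (real (Suc n))"
        using 3 by (intro order_tendstoD(1)[of _ y]) auto
      then show ?thesis
      proof eventually_elim
        case (elim n)
        then have "?s J (y - 1 / real (Suc n)) = 1"
          by (intro unit_clamp_values(2)[OF J]) (simp add: inverse_eq_divide)
        moreover have "?s J y = 1" using 3 by (intro unit_clamp_values(2)[OF J]) simp
        ultimately show ?case using 3 by simp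
      qed
    qed
  qed
  then have "\<forall>\<^sub>F n in sequentially. \<forall>J\<in>M. \<bar>?s J (y - 1 / real (Suc n)) - ?s J y\<bar> * real (Suc n)
      \<le> 1 / (Sup J - Inf J) * indicator {Inf J..Sup J} y"
    using assms(1) by (intro eventually_ball_finite) auto
  then show ?thesis
  proof eventually_elim
    case (elim n)
    show ?case unfolding gauge_on_def sum_distrib_right
    proof (rule sum_mono)
      fix J assume "J \<in> M"
      then have J: "0 < Sup J - Inf J" using assms(2) by simp
      have "sqrt (Sup J - Inf J) * (\<bar>?s J (y - 1 / real (Suc n)) - ?s J y\<bar> * real (Suc n))
          \<le> sqrt (Sup J - Inf J) * (1 / (Sup J - Inf J) * indicator {Inf J..Sup J} y)"
        using elim \<open>J \<in> M\<close> J by (intro mult_left_mono) auto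
      also have "\<dots> = (sqrt (Sup J - Inf J) / (Sup J - Inf J)) * indicator {Inf J..Sup J} y" by simp
      also have "\<dots> = 1 / sqrt (Sup J - Inf J) * indicator {Inf J..Sup J} y"
        using sqrt_divide_self_eq[of "Sup J - Inf J"] J by (simp add: inverse_eq_divide)
      finally show "sqrt (Sup J - Inf J) * \<bar>?s J (y - 1 / real (Suc n)) - ?s J y\<bar> * real (Suc n)
          \<le> 1 / sqrt (Sup J - Inf J) * indicator {Inf J..Sup J} y" by (simp add: mult.assoc)
    qed
  qed
qed

text \<open>The leaves of the tree for one multi-index, padded by ones. The networks are only known
  to be bounded by 2, so the halving keeps the leaves in [-1,1].\<close>

definition tensor_in :: "(nat \<Rightarrow> real \<Rightarrow> real) \<Rightarrow> ('a::euclidean_space \<Rightarrow> nat) \<Rightarrow> 'a \<Rightarrow> nat \<Rightarrow> real" where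
  "tensor_in V \<kappa> x i = (if i < DIM('a) then V (\<kappa> (coord_enum i)) (x \<bullet> coord_enum i) / 2 else 1)"

definition tensor_net :: "nat \<Rightarrow> nat \<Rightarrow> (('a::euclidean_space \<Rightarrow> nat) \<Rightarrow> real) \<Rightarrow> (nat \<Rightarrow> real \<Rightarrow> real) \<Rightarrow> 'a \<Rightarrow> real" where
  "tensor_net m N c V x = (\<Sum>\<kappa>\<in>Basis \<rightarrow>\<^sub>E {1..N}. c \<kappa> * 2 ^ DIM('a) * prod_tree m 2 (tensor_in V \<kappa> x))"

lemma prod_tensor_in:
  fixes x :: "'a::euclidean_space"
  assumes "DIM('a) \<le> 4"
  shows "2 ^ DIM('a) * (\<Prod>i<4. tensor_in V \<kappa> x i) = (\<Prod>j\<in>Basis. V (\<kappa> j) (x \<bullet> j))"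
proof -
  have "(\<Prod>i<4. tensor_in V \<kappa> x i) = (\<Prod>i<DIM('a). V (\<kappa> (coord_enum i)) (x \<bullet> coord_enum i) / 2)"
    using assms by (intro prod.mono_neutral_cong_right) (auto simp: tensor_in_def)
  also have "\<dots> = (\<Prod>i<DIM('a). V (\<kappa> (coord_enum i)) (x \<bullet> coord_enum i)) / 2 ^ DIM('a)"
    by (simp add: prod_dividef)
  also have "(\<Prod>i<DIM('a). V (\<kappa> (coord_enum i)) (x \<bullet> coord_enum i)) = (\<Prod>j\<in>Basis. V (\<kappa> j) (x \<bullet> j))"
    by (rule prod.reindex_bij_betw[OF coord_enum_bij])
  finally show ?thesis by simp
qed

lemma tensor_in_move:
  fixes x :: "'a::euclidean_space"
  assumes "i0 < DIM('a)"
  shows "tensor_in V \<kappa> (x + h *\<^sub>R coord_enum i0) =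
    (tensor_in V \<kappa> x)(i0 := V (\<kappa> (coord_enum i0)) (x \<bullet> coord_enum i0 + h) / 2)"
proof
  fix i
  have B: "coord_enum i0 \<in> (Basis :: 'a set)" "i < DIM('a) \<Longrightarrow> coord_enum i \<in> (Basis :: 'a set)"
    using coord_enum_bij assms by (auto simp: bij_betw_def)
  have inj: "i < DIM('a) \<Longrightarrow> (coord_enum i0 :: 'a) = coord_enum i \<longleftrightarrow> i = i0"
    using coord_enum_bij[where 'a = 'a] assms by (auto simp: bij_betw_def inj_on_def)
  show "tensor_in V \<kappa> (x + h *\<^sub>R coord_enum i0) i =
    ((tensor_in V \<kappa> x)(i0 := V (\<kappa> (coord_enum i0)) (x \<bullet> coord_enum i0 + h) / 2)) i"
    using B inj assms by (auto simp: tensor_in_def inner_add_left inner_Basis)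
qed

text \<open>Here V are the exact univariate functions and W their networks. The constants come from
  2^d <= 8: values give 8 * 3 = 24, increments 8 * 4 = 32, and the step from increments to the L2
  norm of the derivative doubles this to 64.\<close>

lemma tensor_sum_error:
  fixes V W :: "nat \<Rightarrow> real \<Rightarrow> real" and c :: "('a::euclidean_space \<Rightarrow> nat) \<Rightarrow> real"
  assumes dim: "DIM('a) \<le> 3" and ab: "a < b"
    and M: "\<And>i. i \<in> {1..N} \<Longrightarrow> finite (M i) \<and> card (M i) \<le> 2" "\<And>i J. i \<in> {1..N} \<Longrightarrow> J \<in> M i \<Longrightarrow> Inf J < Sup J"
    and \<Lambda>: "1 \<le> \<Lambda>" and \<eta>: "0 \<le> \<eta>" "\<eta> \<le> 1" and m: "16 / (2::real) ^ m \<le> \<eta>"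
    and V: "\<And>i x. i \<in> {1..N} \<Longrightarrow> \<bar>V i x\<bar> \<le> 1"
      "\<And>i x y. i \<in> {1..N} \<Longrightarrow> \<bar>V i x - V i y\<bar> \<le> \<Lambda> * gauge_on (M i) x y"
    and W: "\<And>i x. i \<in> {1..N} \<Longrightarrow> \<bar>W i x - V i x\<bar> \<le> \<eta>"
      "\<And>i x y. i \<in> {1..N} \<Longrightarrow> \<bar>(W i x - V i x) - (W i y - V i y)\<bar> \<le> \<eta> * gauge_on (M i) x y"
    and left_diff: "\<And>i. i \<in> {1..N} \<Longrightarrow> left_diff 1 (V i)" "\<And>i. i \<in> {1..N} \<Longrightarrow> left_diff 1 (W i)"
    and X: "coeff_l1 N c \<le> X"
  defines "w \<equiv> \<lambda>x. tensor_sum N c V x - tensor_net m N c W x"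
  shows "\<bar>w x\<bar> \<le> 24 * \<eta> * X"
    and "\<exists>K. \<forall>e\<in>Basis. \<forall>x h. \<bar>w (x + h *\<^sub>R e) - w x\<bar> \<le> K * \<bar>h\<bar>"
    and "e \<in> Basis \<Longrightarrow> left_diff e w"
    and "e \<in> Basis \<Longrightarrow> (LINT x:cube a b|lebesgue. (lim (left_quot e w x))\<^sup>2) \<le> (64 * \<eta> * \<Lambda> * X)\<^sup>2 * (b - a) ^ (DIM('a) - 1)"
proof -
  define S where "S = (Basis :: 'a set) \<rightarrow>\<^sub>E {1..N}"
  have finS: "finite S" unfolding S_def by (intro finite_PiE) auto
  have \<kappa>: "\<kappa> j \<in> {1..N}" if "\<kappa> \<in> S" "j \<in> Basis" for \<kappa> j using that unfolding S_def by (rule PiE_mem)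
  have e_mem: "coord_enum i \<in> (Basis :: 'a set)" if "i < DIM('a)" for i
    using coord_enum_bij that by (auto simp: bij_betw_def)
  have pow: "(2::real) ^ DIM('a) \<le> 8"
    using power_increasing[OF dim, of "2::real"] by simp
  have "16 / (2::real) ^ m \<le> 1" using m \<eta>(2) by linarith
  then have m16: "16 \<le> (2::real) ^ m" by (simp add: divide_le_eq)
  define E where "E = (\<lambda>\<kappa> (x::'a). (\<Prod>i<4. tensor_in V \<kappa> x i) - prod_tree m 2 (tensor_in W \<kappa> x))"
  have w: "w x = (\<Sum>\<kappa>\<in>S. c \<kappa> * (2 ^ DIM('a) * E \<kappa> x))" for x
  proof -
    have "DIM('a) \<le> 4" using dim by simp
    from prod_tensor_in[OF this] show ?thesis
      unfolding w_def tensor_sum_def tensor_net_def S_def[symmetric] sum_subtractf[symmetric]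
      by (intro sum.cong) (auto simp: E_def right_diff_distrib)
  qed
  have Wb: "\<bar>W i x\<bar> \<le> 2" if "i \<in> {1..N}" for i x using V(1)[OF that, of x] W(1)[OF that, of x] \<eta>(2) by linarith
  have inb: "\<bar>tensor_in W \<kappa> x i\<bar> \<le> 1" "\<bar>tensor_in V \<kappa> x i\<bar> \<le> 1" "\<bar>tensor_in W \<kappa> x i - tensor_in V \<kappa> x i\<bar> \<le> \<eta> / 2"
    if "\<kappa> \<in> S" for \<kappa> x i
  proof -
    have "\<kappa> (coord_enum i) \<in> {1..N}" if "i < DIM('a)" using \<kappa>[OF \<open>\<kappa> \<in> S\<close> e_mem[OF that]] .
    then show "\<bar>tensor_in W \<kappa> x i\<bar> \<le> 1" "\<bar>tensor_in V \<kappa> x i\<bar> \<le> 1" "\<bar>tensor_in W \<kappa> x i - tensor_in V \<kappa> x i\<bar> \<le> \<eta> / 2"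
      using Wb V(1) W(1) \<eta>(1) unfolding tensor_in_def
      by (auto simp flip: diff_divide_distrib intro: order_trans[of _ 1 2])
  qed
  have X0: "(\<Sum>\<kappa>\<in>S. \<bar>c \<kappa>\<bar>) \<le> X" using X by (simp add: coeff_l1_def S_def)
  have Eb: "\<bar>E \<kappa> x\<bar> \<le> 3 * \<eta>" if "\<kappa> \<in> S" for \<kappa> x
    using prod_tree_two_error(1)[OF m16 m inb(1)[OF that] inb(2)[OF that] inb(3)[OF that]] unfolding E_def by simp
  have Ed: "\<bar>E \<kappa> (x + h *\<^sub>R e) - E \<kappa> x\<bar> \<le> 4 * \<eta> * \<Lambda> * gauge_on (M (\<kappa> e)) (x \<bullet> e + h) (x \<bullet> e)"
    if \<kappa>S: "\<kappa> \<in> S" and e: "e \<in> Basis" for \<kappa> x h e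
  proof -
    obtain i0 where i0: "i0 < DIM('a)" "e = coord_enum i0"
      using coord_enum_bij[where 'a = 'a] e by (auto simp: bij_betw_def)
    have i04: "i0 < 4" using i0 dim by simp
    define i where "i = \<kappa> e"
    have i: "i \<in> {1..N}" using \<kappa>[OF \<kappa>S e] by (simp add: i_def)
    define y y' where "y = x \<bullet> e" and "y' = x \<bullet> e + h"
    define g where "g = gauge_on (M i) y' y"
    have g: "0 \<le> g" unfolding g_def using M(2)[OF i] by (intro gauge_on_nonneg)
    have gs: "gauge_on (M i) y y' = g" unfolding g_def gauge_on_def by (simp add: abs_minus_commute)
    have at: "tensor_in V \<kappa> x i0 = V i y / 2" "tensor_in W \<kappa> x i0 = W i y / 2"
      using i0 by (auto simp: tensor_in_def i_def y_def)
    have mv: "tensor_in V \<kappa> (x + h *\<^sub>R e) = (tensor_in V \<kappa> x)(i0 := V i y' / 2)"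
      "tensor_in W \<kappa> (x + h *\<^sub>R e) = (tensor_in W \<kappa> x)(i0 := W i y' / 2)"
      unfolding i0(2) i_def y'_def by (rule tensor_in_move[OF i0(1)])+
    have b0: "\<bar>W i y' / 2\<bar> \<le> 1" "\<bar>V i y' / 2\<bar> \<le> 1" "\<bar>W i y' / 2 - V i y' / 2\<bar> \<le> \<eta> / 2"
      using Wb[OF i, of y'] V(1)[OF i, of y'] W(1)[OF i, of y'] by (auto simp flip: diff_divide_distrib)
    have "\<bar>E \<kappa> x - E \<kappa> (x + h *\<^sub>R e)\<bar> \<le>
      \<bar>(tensor_in V \<kappa> x i0 - tensor_in W \<kappa> x i0) - (V i y' / 2 - W i y' / 2)\<bar> + (2 * \<eta> + \<eta>) * \<bar>tensor_in W \<kappa> x i0 - W i y' / 2\<bar>"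
      unfolding E_def mv
      by (rule prod_tree_two_error(2)[OF m16 m inb(1)[OF \<kappa>S] inb(2)[OF \<kappa>S] inb(3)[OF \<kappa>S] i04 b0])
    also have "\<bar>(tensor_in V \<kappa> x i0 - tensor_in W \<kappa> x i0) - (V i y' / 2 - W i y' / 2)\<bar> \<le> \<eta> * g / 2"
    proof -
      have eq: "(tensor_in V \<kappa> x i0 - tensor_in W \<kappa> x i0) - (V i y' / 2 - W i y' / 2) = - ((W i y - V i y) - (W i y' - V i y')) / 2"
        unfolding at by (simp add: field_simps)
      show ?thesis unfolding eq abs_divide abs_minus_cancel using W(2)[OF i, of y y'] unfolding gs by simp
    qed
    also have "\<bar>tensor_in W \<kappa> x i0 - W i y' / 2\<bar> \<le> \<Lambda> * g"
    proof -
      have "\<bar>W i y - W i y'\<bar> \<le> \<Lambda> * g + \<eta> * g"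
        using W(2)[OF i, of y y'] V(2)[OF i, of y y'] unfolding gs by linarith
      also have "\<dots> \<le> \<Lambda> * g + \<Lambda> * g" using \<eta> \<Lambda> g by (intro add_left_mono mult_right_mono) auto
      finally show ?thesis unfolding at by (simp flip: diff_divide_distrib)
    qed
    \<comment> \<open>The error of the moving factor contributes the half, the other factors and the
      tree contribute 3; \<open>\<Lambda>\<close> >= 1 merges them.\<close>
    also have "\<eta> * g / 2 + (2 * \<eta> + \<eta>) * (\<Lambda> * g) \<le> 4 * \<eta> * \<Lambda> * g"
    proof -
      have "\<eta> * g * 1 \<le> \<eta> * g * \<Lambda>" using \<eta> g \<Lambda> by (intro mult_left_mono mult_nonneg_nonneg)
      moreover have "0 \<le> \<eta> * g" using \<eta> g by simp
      ultimately show ?thesis by (simp add: algebra_simps)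
    qed
    finally show ?thesis using \<eta>(1) by (simp add: abs_minus_commute g_def i_def y_def y'_def mult_left_mono)
  qed
  have wd: "\<bar>w (x + h *\<^sub>R e) - w x\<bar> \<le> 32 * \<eta> * \<Lambda> * (\<Sum>\<kappa>\<in>S. \<bar>c \<kappa>\<bar> * gauge_on (M (\<kappa> e)) (x \<bullet> e + h) (x \<bullet> e))"
    if e: "e \<in> Basis" for e x h
  proof -
    have "w (x + h *\<^sub>R e) - w x = (\<Sum>\<kappa>\<in>S. c \<kappa> * (2 ^ DIM('a) * (E \<kappa> (x + h *\<^sub>R e) - E \<kappa> x)))"
      unfolding w by (simp add: sum_subtractf right_diff_distrib)
    also have "\<bar>\<dots>\<bar> \<le> (\<Sum>\<kappa>\<in>S. \<bar>c \<kappa>\<bar> * (8 * (4 * \<eta> * \<Lambda> * gauge_on (M (\<kappa> e)) (x \<bullet> e + h) (x \<bullet> e))))"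
      using pow by (intro order_trans[OF sum_abs] sum_mono abs_mult_le Ed e) auto
    also have "\<dots> = 32 * \<eta> * \<Lambda> * (\<Sum>\<kappa>\<in>S. \<bar>c \<kappa>\<bar> * gauge_on (M (\<kappa> e)) (x \<bullet> e + h) (x \<bullet> e))"
      by (simp add: sum_distrib_left algebra_simps)
    finally show ?thesis .
  qed
  show "\<bar>w x\<bar> \<le> 24 * \<eta> * X"
  proof -
    have "\<bar>w x\<bar> \<le> (\<Sum>\<kappa>\<in>S. \<bar>c \<kappa>\<bar> * (8 * (3 * \<eta>)))"
      unfolding w using pow by (intro order_trans[OF sum_abs] sum_mono abs_mult_le Eb) auto
    also have "\<dots> = (\<Sum>\<kappa>\<in>S. \<bar>c \<kappa>\<bar>) * (24 * \<eta>)" by (simp add: sum_distrib_right)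
    also have "\<dots> \<le> X * (24 * \<eta>)" using X0 \<eta>(1) by (intro mult_right_mono) auto
    finally show ?thesis by (simp add: mult.commute)
  qed
  \<comment> \<open>This constant depends on the interval lengths; it only shows that w is
    Lipschitz.\<close>
  define Kf where "Kf = (\<lambda>e::'a. 32 * \<eta> * \<Lambda> * (\<Sum>\<kappa>\<in>S. \<bar>c \<kappa>\<bar> * (\<Sum>J\<in>M (\<kappa> e). 1 / sqrt (Sup J - Inf J))))"
  have Kf: "\<bar>w (x + h *\<^sub>R e) - w x\<bar> \<le> Kf e * \<bar>h\<bar>" if e: "e \<in> Basis" for e x h
  proof -
    have "(\<Sum>\<kappa>\<in>S. \<bar>c \<kappa>\<bar> * gauge_on (M (\<kappa> e)) (x \<bullet> e + h) (x \<bullet> e))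
        \<le> (\<Sum>\<kappa>\<in>S. \<bar>c \<kappa>\<bar> * ((\<Sum>J\<in>M (\<kappa> e). 1 / sqrt (Sup J - Inf J)) * \<bar>x \<bullet> e + h - x \<bullet> e\<bar>))"
      using M(2) \<kappa> e by (intro sum_mono mult_left_mono gauge_on_lipschitz) auto
    then have "32 * \<eta> * \<Lambda> * (\<Sum>\<kappa>\<in>S. \<bar>c \<kappa>\<bar> * gauge_on (M (\<kappa> e)) (x \<bullet> e + h) (x \<bullet> e))
        \<le> 32 * \<eta> * \<Lambda> * (\<Sum>\<kappa>\<in>S. \<bar>c \<kappa>\<bar> * ((\<Sum>J\<in>M (\<kappa> e). 1 / sqrt (Sup J - Inf J)) * \<bar>x \<bullet> e + h - x \<bullet> e\<bar>))"
      using \<eta>(1) \<Lambda> by (intro mult_left_mono) auto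
    also have "\<dots> = Kf e * \<bar>h\<bar>" by (simp add: Kf_def sum_distrib_right mult.assoc)
    finally show ?thesis using wd[OF e, of x h] by linarith
  qed
  show "\<exists>K. \<forall>e\<in>Basis. \<forall>x h. \<bar>w (x + h *\<^sub>R e) - w x\<bar> \<le> K * \<bar>h\<bar>"
  proof (intro exI ballI allI)
    fix e x :: 'a and h assume e: "e \<in> Basis"
    have "Kf e \<le> (\<Sum>e\<in>Basis. Kf e)"
    proof (rule member_le_sum[OF e])
      fix e' :: 'a assume "e' \<in> Basis - {e}"
      then have "0 \<le> sqrt (Sup J - Inf J)" if "\<kappa> \<in> S" "J \<in> M (\<kappa> e')" for \<kappa> J
        using M(2)[OF \<kappa>[OF that(1)] that(2)] by (simp add: less_imp_le)
      then show "0 \<le> Kf e'" unfolding Kf_def using \<eta>(1) \<Lambda>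
        by (intro mult_nonneg_nonneg sum_nonneg divide_nonneg_nonneg) auto
    qed simp
    then show "\<bar>w (x + h *\<^sub>R e) - w x\<bar> \<le> (\<Sum>e\<in>Basis. Kf e) * \<bar>h\<bar>"
      using Kf[OF e, of x h] by (meson abs_ge_zero mult_right_mono order_trans)
  qed
  show lw: "left_diff e w" if e: "e \<in> Basis" for e
  proof -
    have "left_diff e (\<lambda>x. tensor_in V \<kappa> x i)" "left_diff e (\<lambda>x. tensor_in W \<kappa> x i)" if \<kappa>S: "\<kappa> \<in> S" for \<kappa> i
    proof -
      have "left_diff e (\<lambda>x. tensor_in U \<kappa> x i)" if "\<And>i. i \<in> {1..N} \<Longrightarrow> left_diff 1 (U i)" for U
      proof (cases "i < DIM('a)")
        case True
        have "left_diff e (\<lambda>x. 1/2 * U (\<kappa> (coord_enum i)) (x \<bullet> coord_enum i))"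
          using that[OF \<kappa>[OF \<kappa>S e_mem[OF True]]] e e_mem[OF True] by (intro left_diff_cmult left_diff_coordinate)
        then show ?thesis using True by (simp add: tensor_in_def)
      next
        case False
        then show ?thesis by (simp add: tensor_in_def left_diff_const)
      qed
      then show "left_diff e (\<lambda>x. tensor_in V \<kappa> x i)" "left_diff e (\<lambda>x. tensor_in W \<kappa> x i)" using left_diff by blast+
    qed
    then have "left_diff e (\<lambda>x. \<Sum>\<kappa>\<in>S. c \<kappa> * (2 ^ DIM('a) * ((\<Prod>i<4. tensor_in V \<kappa> x i) - prod_tree m 2 (\<lambda>i. tensor_in W \<kappa> x i))))"
      by (intro left_diff_sum left_diff_cmult left_diff_diff left_diff_prod left_diff_prod_tree) auto
    then show ?thesis using w unfolding E_def by (metis (no_types, lifting) ext)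
  qed
  show "(LINT x:cube a b|lebesgue. (lim (left_quot e w x))\<^sup>2) \<le> (64 * \<eta> * \<Lambda> * X)\<^sup>2 * (b - a) ^ (DIM('a) - 1)" if e: "e \<in> Basis"
  proof -
    define C where "C = 32 * \<eta> * \<Lambda>"
    have C: "0 \<le> C" using \<eta>(1) \<Lambda> by (simp add: C_def)
    have "\<bar>lim (left_quot e w x)\<bar> \<le> C * (\<Sum>\<kappa>\<in>S. \<bar>c \<kappa>\<bar> * (\<Sum>J\<in>M (\<kappa> e). 1 / sqrt (Sup J - Inf J) * indicator {Inf J..Sup J} (x \<bullet> e)))"
      (is "_ \<le> ?R x") for x
    proof -
      have lim: "left_quot e w x \<longlonglongrightarrow> lim (left_quot e w x)" by (rule left_quot_limit_bounded(1)[OF lw[OF e] Kf[OF e]])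
      have "\<forall>\<^sub>F n in sequentially. \<forall>i\<in>{1..N}. gauge_on (M i) (x \<bullet> e - 1 / real (Suc n)) (x \<bullet> e) * real (Suc n)
          \<le> (\<Sum>J\<in>M i. 1 / sqrt (Sup J - Inf J) * indicator {Inf J..Sup J} (x \<bullet> e))"
        using M by (intro eventually_ball_finite ballI gauge_on_quotient) auto
      then have "\<forall>\<^sub>F n in sequentially. \<bar>left_quot e w x n\<bar> \<le> ?R x"
      proof eventually_elim
        case (elim n)
        have "\<bar>left_quot e w x n\<bar> = \<bar>w (x + (- (1 / real (Suc n))) *\<^sub>R e) - w x\<bar> * real (Suc n)"
          by (simp add: left_quot_def abs_mult abs_minus_commute del: of_nat_Suc)
        also have "\<dots> \<le> C * (\<Sum>\<kappa>\<in>S. \<bar>c \<kappa>\<bar> * gauge_on (M (\<kappa> e)) (x \<bullet> e + - (1 / real (Suc n))) (x \<bullet> e)) * real (Suc n)"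
          unfolding C_def by (intro mult_right_mono wd[OF e]) simp
        also have "\<dots> = C * (\<Sum>\<kappa>\<in>S. \<bar>c \<kappa>\<bar> * (gauge_on (M (\<kappa> e)) (x \<bullet> e - 1 / real (Suc n)) (x \<bullet> e) * real (Suc n)))"
          by (simp add: sum_distrib_right mult.assoc)
        also have "\<dots> \<le> ?R x"
          using elim C \<kappa> e by (intro mult_left_mono sum_mono) auto
        finally show ?case .
      qed
      then show ?thesis by (intro tendsto_upperbound[OF tendsto_rabs[OF lim]]) auto
    qed
    from L2_step_bound[where M = "\<lambda>\<kappa>. M (\<kappa> e)" and cc = c, OF e ab finS C _ _ this X0]
    have "(LINT x:cube a b|lebesgue. (lim (left_quot e w x))\<^sup>2) \<le> (2 * C * X)\<^sup>2 * (b - a) ^ (DIM('a) - 1)"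
      using M \<kappa> e by blast
    then show ?thesis by (simp add: C_def mult.assoc)
  qed
qed

section \<open>Size and depth\<close>

text \<open>Two layers precede the tree: the two ReLU terms of the clamp, then the pairs for the 2^k
  shifted factors. They cost 7 + 10 * 2^k, which fits into 20 * 2^k; the tree takes the remaining
  90.\<close>

lemma computes_nodal_net:
  assumes "f \<in> F" "l \<le> n"
  shows "computes F (2 + k * (m + 3)) (110 * 2 ^ k * (m + 1)) (pm_parts (\<lambda>x. nodal_net m k n l (unit_clamp \<alpha> \<beta> (f x))))"
proof -
  define y where "y = (\<lambda>x. 1 / (\<beta> - \<alpha>) * (f x - \<alpha>))"
  define G where "G = {\<lambda>x. relu (y x), \<lambda>x. relu (y x - 1)}"
  have y: "aff F (2 + 1) y" unfolding y_def by (intro aff_scale aff_diff aff_feature aff_const assms)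
  have "relu_step F ((2 + 1) + ((2 + 1) + 1)) G"
    unfolding G_def by (intro relu_step_insert relu_step_single aff_diff y aff_const)
  then have 1: "computes F 1 7 G" by (intro computes_relu_step) simp
  define s where "s = (\<lambda>x. relu (y x) - relu (y x - 1))"
  have sc: "s x = unit_clamp \<alpha> \<beta> (f x)" for x by (simp add: s_def y_def unit_clamp_def)
  have s: "aff G (2 + 2) s" unfolding s_def by (intro aff_diff aff_feature) (auto simp: G_def)
  define a where "a = (\<lambda>i x. if i \<le> n \<and> i \<noteq> l then s x - real i / real n else 1)"
  have a: "aff G 5 (a i)" for i
  proof (cases "i \<le> n \<and> i \<noteq> l")
    case True
    have "aff G (4 + 1) (\<lambda>x. s x - real i / real n)" using s by (intro aff_diff aff_const) simp
    then show ?thesis using True by (simp add: a_def)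
  next
    case False
    then show ?thesis using aff_mono[OF aff_const[of G 1], of G 5] by (auto simp: a_def)
  qed
  define H where "H = (\<Union>i\<in>{..<2 ^ k}. pm_parts (a i))"
  have 2: "computes G 1 (2 ^ k * 10) H"
    using computes_UN[of "{..<2 ^ k}" G 1 10 "\<lambda>i. pm_parts (a i)"] computes_relu_step[OF relu_step_pm_parts[OF a]]
    by (simp add: H_def del: computes.simps)
  have "computes H (k * (m + 3)) ((2 ^ k - 1) * (90 * (m + 1))) (pm_parts (\<lambda>x. prod_tree m k (\<lambda>i. a i x)))"
  proof (rule computes_prod_tree)
    show "pm_parts (a i) \<subseteq> H" if "i < 2 ^ k" for i using that by (auto simp: H_def)
    show "\<bar>a i x\<bar> \<le> 1" for i x
      unfolding a_def sc by (rule shifted_node_range[OF unit_clamp_range])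
  qed
  moreover have "(\<lambda>x. prod_tree m k (\<lambda>i. a i x)) = (\<lambda>x. nodal_net m k n l (unit_clamp \<alpha> \<beta> (f x)))"
    by (rule ext) (simp only: nodal_net_def a_def sc)
  ultimately have 3: "computes H (k * (m + 3)) ((2 ^ k - 1) * (90 * (m + 1))) (pm_parts (\<lambda>x. nodal_net m k n l (unit_clamp \<alpha> \<beta> (f x))))"
    by simp
  have "computes F (1 + 1 + k * (m + 3)) (7 + 2 ^ k * 10 + (2 ^ k - 1) * (90 * (m + 1))) (pm_parts (\<lambda>x. nodal_net m k n l (unit_clamp \<alpha> \<beta> (f x))))"
    by (rule computes_trans[OF computes_trans[OF 1 2] 3])
  then have "computes F (2 + k * (m + 3)) (7 + 2 ^ k * 10 + (2 ^ k - 1) * (90 * (m + 1))) (pm_parts (\<lambda>x. nodal_net m k n l (unit_clamp \<alpha> \<beta> (f x))))"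
    by (simp only: one_add_one)
  then show ?thesis
  proof (rule computes_mono)
    have "(2 ^ k - 1) * (90 * (m + 1)) \<le> 2 ^ k * (90 * (m + 1))" by (intro mult_right_mono) auto
    moreover have "7 + 2 ^ k * 10 \<le> 2 ^ k * (20 * (m + 1))"
    proof -
      have "7 + 2 ^ k * 10 \<le> (2::nat) ^ k * 20" using one_le_power[of "2::nat" k] by linarith
      also have "\<dots> \<le> 2 ^ k * (20 * (m + 1))" by (intro mult_left_mono) auto
      finally show ?thesis .
    qed
    moreover have "110 * 2 ^ k * (m + 1) = 2 ^ k * (20 * (m + 1)) + 2 ^ k * (90 * (m + 1))" by (simp add: algebra_simps)
    ultimately show "7 + 2 ^ k * 10 + (2 ^ k - 1) * (90 * (m + 1)) \<le> 110 * 2 ^ k * (m + 1)" by linarith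
  qed simp
qed

text \<open>All nodal networks run in parallel; one more layer forms the linear combination.
  Halving, as the leaves of the next tree demand, is free since it only rescales the
  weights.\<close>

lemma computes_pw_net:
  assumes "f \<in> F" "finite M" "card M \<le> 2"
  shows "computes F (3 + k * (m + 3)) (250 * (n + 1) * 2 ^ k * (m + 1)) (pm_parts (\<lambda>x. pw_net m k n \<kappa> M A (f x) / 2))"
proof -
  define T where "T = (\<lambda>J l x. nodal_net m k n l (unit_clamp (Inf J) (Sup J) (f x)))"
  define H where "H = (\<Union>J\<in>M. \<Union>l\<in>{..n}. pm_parts (T J l))"
  let ?c = "110 * 2 ^ k * (m + 1)"
  have "computes F (2 + k * (m + 3)) (card M * (card {..n} * ?c)) H"
    unfolding H_def T_def by (intro computes_UN assms computes_nodal_net) auto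
  then have 1: "computes F (2 + k * (m + 3)) (2 * ((n + 1) * ?c)) H"
    by (rule computes_mono) (use mult_right_mono[OF assms(3), of "card {..n} * ?c"] in simp_all)
  have "aff H (1 + (1 + card M * (1 + card {..n} * 4))) (\<lambda>x. \<kappa> + (\<Sum>J\<in>M. \<Sum>l\<in>{..n}. A J l * T J l x))"
    by (intro aff_add aff_const aff_sum assms aff_scale aff_pm_parts) (auto simp: H_def)
  then have "aff H (12 * (n + 1)) (\<lambda>x. \<kappa> + (\<Sum>J\<in>M. \<Sum>l\<in>{..n}. A J l * T J l x))"
  proof (rule aff_mono)
    have "card M * (1 + card {..n} * 4) \<le> 2 * (1 + card {..n} * 4)" using assms(3) by (intro mult_right_mono) auto
    then show "1 + (1 + card M * (1 + card {..n} * 4)) \<le> 12 * (n + 1)" by simp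
  qed simp
  from aff_scale[OF this, of "1/2"]
  have "aff H (12 * (n + 1)) (\<lambda>x. pw_net m k n \<kappa> M A (f x) / 2)"
    by (simp add: pw_net_def T_def)
  from computes_trans[OF 1 computes_relu_step[OF relu_step_pm_parts[OF this]]]
  have "computes F (3 + k * (m + 3)) (2 * ((n + 1) * ?c) + 2 * (12 * (n + 1))) (pm_parts (\<lambda>x. pw_net m k n \<kappa> M A (f x) / 2))"
    by (simp add: numeral_3_eq_3 add.commute del: computes.simps)
  then show ?thesis
  proof (rule computes_mono)
    have "1 \<le> (2::nat) ^ k * (m + 1)" by (simp add: Suc_le_eq)
    then have "24 * (n + 1) * 1 \<le> 24 * (n + 1) * (2 ^ k * (m + 1))" by (rule mult_le_mono2)
    then show "2 * ((n + 1) * ?c) + 2 * (12 * (n + 1)) \<le> 250 * (n + 1) * 2 ^ k * (m + 1)"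
      by (simp add: algebra_simps)
  qed simp
qed

text \<open>Supplies the padding leaf 1 at the depth where the other leaves become available.
  Nothing is computed before the last layer, where the bias produces the constant.\<close>

lemma computes_const_pm_parts: "computes F (Suc L) 2 (pm_parts (\<lambda>x. c))"
proof -
  have "relu_step {} 2 (pm_parts (\<lambda>x. c))" using relu_step_pm_parts[OF aff_const[of "{}" c]] by simp
  then show ?thesis using computes_empty[of F L] by fastforce
qed

text \<open>The layer \<open>H\<close> holds each univariate network once for every coordinate, N d
  in all, and every multi-index reads its leaves from there. Hence the N^d trees only cost a
  multiple of m each, 270 for three multiplications and 4 for the output weights. The depth is 3 + k
  (m+3) for the leaves, 2 (m+3) for the trees and 1 for the output layer.\<close>

lemma tensor_net_realization:
  fixes c :: "('a::euclidean_space \<Rightarrow> nat) \<Rightarrow> real"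
  assumes dim: "DIM('a) \<le> 3"
    and M: "\<And>i. i \<in> {1..N} \<Longrightarrow> finite (M i) \<and> card (M i) \<le> 2"
    and bound: "\<And>i y. i \<in> {1..N} \<Longrightarrow> \<bar>pw_net m k n (\<kappa> i) (M i) (A i) y\<bar> \<le> 2"
  shows "\<exists>\<Phi>. nn_wf DIM('a) 1 \<Phi> \<and> nn_depth \<Phi> = (k + 2) * (m + 3) + 4 \<and>
    nn_size \<Phi> \<le> N * DIM('a) * (250 * (n + 1) * 2 ^ k * (m + 1)) + N ^ DIM('a) * (274 * (m + 1)) + 3 \<and>
    (realize \<Phi> :: 'a \<Rightarrow> real) = tensor_net m N c (\<lambda>i. pw_net m k n (\<kappa> i) (M i) (A i))"
proof -
  define W where "W = (\<lambda>i. pw_net m k n (\<kappa> i) (M i) (A i))"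
  define S where "S = (Basis :: 'a set) \<rightarrow>\<^sub>E {1..N}"
  have S: "finite S" "card S = N ^ DIM('a)" unfolding S_def by (auto simp: card_PiE intro: finite_PiE)
  define f where "f = (\<lambda>j (x::'a). x \<bullet> coord_enum j)"
  define F where "F = f ` {..<DIM('a)}"
  define H where "H = (\<Union>(i, j)\<in>{1..N} \<times> {..<DIM('a)}. pm_parts (\<lambda>x. W i (f j x) / 2)) \<union> pm_parts (\<lambda>x. 1)"
  let ?c = "250 * (n + 1) * 2 ^ k * (m + 1)"
  have e_mem: "coord_enum i \<in> (Basis :: 'a set)" if "i < DIM('a)" for i
    using coord_enum_bij that by (auto simp: bij_betw_def)
  have "computes F (3 + k * (m + 3)) (card ({1..N} \<times> {..<DIM('a)}) * ?c)
      (\<Union>(i, j)\<in>{1..N} \<times> {..<DIM('a)}. pm_parts (\<lambda>x. W i (f j x) / 2))"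
  proof (rule computes_UN)
    fix p assume "p \<in> {1..N} \<times> {..<DIM('a)}"
    then obtain i j where "p = (i, j)" "i \<in> {1..N}" "j < DIM('a)" by auto
    then show "computes F (3 + k * (m + 3)) ?c (case p of (i, j) \<Rightarrow> pm_parts (\<lambda>x. W i (f j x) / 2))"
      using M[of i] computes_pw_net[of "f j" F "M i" k m n "\<kappa> i" "A i"] by (auto simp: W_def F_def)
  qed simp
  moreover have "computes F (3 + k * (m + 3)) 2 (pm_parts (\<lambda>x. 1))"
    using computes_const_pm_parts[of F "2 + k * (m + 3)" 1] by (simp only: add_Suc[symmetric] eval_nat_numeral)
  ultimately have 1: "computes F (3 + k * (m + 3)) (N * DIM('a) * ?c + 2) H"
    unfolding H_def using computes_Un by (fastforce simp: card_cartesian_product simp del: computes.simps)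
  define T where "T = (\<lambda>\<kappa>' (x::'a). prod_tree m 2 (tensor_in W \<kappa>' x))"
  have \<kappa>: "\<kappa>' (coord_enum i) \<in> {1..N}" if "\<kappa>' \<in> S" "i < DIM('a)" for \<kappa>' i
    using that(1) e_mem[OF that(2)] unfolding S_def by (rule PiE_mem)
  define G where "G = (\<Union>\<kappa>'\<in>S. pm_parts (T \<kappa>'))"
  have 2: "computes H (2 * (m + 3)) (card S * ((2 ^ 2 - 1) * (90 * (m + 1)))) G"
    unfolding G_def
  proof (rule computes_UN[OF S(1)])
    fix \<kappa>' assume \<kappa>': "\<kappa>' \<in> S"
    show "computes H (2 * (m + 3)) ((2 ^ 2 - 1) * (90 * (m + 1))) (pm_parts (T \<kappa>'))"
      unfolding T_def
    proof (rule computes_prod_tree)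
      fix i assume "i < (2::nat) ^ 2"
      show "pm_parts (\<lambda>x. tensor_in W \<kappa>' x i) \<subseteq> H"
      proof (cases "i < DIM('a)")
        case True
        then have "(\<lambda>x. tensor_in W \<kappa>' x i) = (\<lambda>x. W (\<kappa>' (coord_enum i)) (f i x) / 2)"
          by (simp add: tensor_in_def f_def)
        moreover have "(\<kappa>' (coord_enum i), i) \<in> {1..N} \<times> {..<DIM('a)}" using \<kappa>[OF \<kappa>' True] True by simp
        ultimately show ?thesis unfolding H_def by fastforce
      next
        case False
        then show ?thesis by (simp add: tensor_in_def H_def)
      qed
      show "\<bar>tensor_in W \<kappa>' x i\<bar> \<le> 1" for x
        using bound[OF \<kappa>[OF \<kappa>']] by (auto simp: tensor_in_def W_def)
    qed
  qed
  define out where "out = (\<lambda>x. \<Sum>\<kappa>'\<in>S. (c \<kappa>' * 2 ^ DIM('a)) * T \<kappa>' x)"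
  have 3: "aff G (1 + card S * 4) out"
    unfolding out_def by (intro aff_sum S(1) aff_scale aff_pm_parts) (auto simp: G_def)
  obtain \<Phi> where \<Phi>: "nn_wf DIM('a) 1 \<Phi>" "nn_depth \<Phi> = 3 + k * (m + 3) + 2 * (m + 3) + 1"
    "nn_size \<Phi> \<le> N * DIM('a) * ?c + 2 + card S * ((2 ^ 2 - 1) * (90 * (m + 1))) + (1 + card S * 4)"
    "\<And>y x. (\<forall>j<DIM('a). y j = f j x) \<Longrightarrow> nn_eval \<Phi> y 0 = out x"
    using computes_network[OF computes_trans[OF 1 2, unfolded F_def] 3] by blast
  have "(realize \<Phi> :: 'a \<Rightarrow> real) = out"
    by (rule ext, unfold realize_def, rule \<Phi>(4)) (simp add: f_def)
  moreover have "out = tensor_net m N c W" by (rule ext) (simp add: out_def tensor_net_def T_def S_def)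
  moreover have "nn_depth \<Phi> = (k + 2) * (m + 3) + 4" using \<Phi>(2) by (simp add: algebra_simps)
  moreover have "nn_size \<Phi> \<le> N * DIM('a) * ?c + N ^ DIM('a) * (274 * (m + 1)) + 3"
  proof -
    have "card S * ((2 ^ 2 - 1) * (90 * (m + 1))) + card S * 4 = card S * (270 * (m + 1) + 4)"
      by (simp add: algebra_simps)
    also have "\<dots> \<le> card S * (274 * (m + 1))" by (intro mult_left_mono) auto
    finally show ?thesis using \<Phi>(3) unfolding S(2) by linarith
  qed
  ultimately show ?thesis using \<Phi>(1) unfolding W_def by metis
qed

section \<open>Choice of the tree depth and the exceptional null set\<close>

lemma exists_two_power:
  assumes "1 \<le> (n::nat)"
  shows "\<exists>k. 2 \<le> k \<and> n < 2 ^ k \<and> 2 ^ k \<le> 2 * (n + 1)"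
proof -
  define k where "k = (LEAST k. n < 2 ^ k)"
  have ex: "n < 2 ^ n" by (rule less_exp)
  then have k: "n < 2 ^ k" unfolding k_def by (rule LeastI)
  have "k \<noteq> 0" using k assms by (intro notI) simp
  then obtain l where l: "k = Suc l" by (cases k) auto
  have "\<not> n < 2 ^ l" using not_less_Least[of l "\<lambda>k. n < 2 ^ k"] l unfolding k_def by simp
  then have le: "2 ^ l \<le> n" by simp
  show ?thesis
  proof (cases "l = 0")
    case True
    then have "n = 1" using k l assms by simp
    \<comment> \<open>For n = 1 the least exponent is 1; it is raised to 2, since 4^k must reach 16
      for the tree error of the tensor product to be covered.\<close>
    then show ?thesis by (intro exI[of _ 2]) simp
  next
    case False
    then show ?thesis using k l le by (intro exI[of _ k]) auto
  qed
qed

text \<open>The excluded points lie on finitely many hyperplanes, so exceptional points of the v_i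
  do no harm in the tensor product.\<close>

lemma AE_cube_coordinates:
  assumes "finite Z"
  shows "AE x in lebesgue. \<forall>j\<in>(Basis::'a::euclidean_space set). x \<bullet> j \<notin> Z"
proof -
  have "AE x in lebesgue. x \<bullet> j \<notin> Z" if "j \<in> Basis" for j :: 'a
  proof -
    have "negligible (\<Union>z\<in>Z. {x. x \<bullet> j = z})"
      using assms that by (intro negligible_Union) auto
    moreover have "(\<Union>z\<in>Z. {x. x \<bullet> j = z}) = {x. x \<bullet> j \<in> Z}" by auto
    ultimately show ?thesis using AE_not_in[of "{x. x \<bullet> j \<in> Z}" lebesgue] by (simp add: negligible_iff_null_sets)
  qed
  then show ?thesis by (intro AE_finite_allI) auto
qed

section \<open>Growth of the constants\<close>

text \<open>For t < 1 the product t ln t is negative, and the right side of the depth bound has to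
  stay away from 0. With r = sqrt t, the inequality ln r >= 1 - 1/r gives t ln t >= 2 r^2 - 2 r >=
  -1/2.\<close>

lemma one_plus_t_ln_t_ge:
  fixes t :: real
  assumes "0 \<le> t"
  shows "1 / 2 \<le> 1 + t * ln t"
proof (cases "t = 0")
  case False
  then have t: "0 < t" using assms by simp
  define r where "r = sqrt t"
  have r: "0 < r" "t = r * r" using t by (auto simp: r_def)
  have "ln (1 / r) \<le> 1 / r - 1" using r by (intro ln_le_minus_one) simp
  then have "1 - 1 / r \<le> ln r" using r by (simp add: ln_div)
  then have "(2 * t) * (1 - 1 / r) \<le> (2 * t) * ln r" using t by (intro mult_left_mono) auto
  moreover have "(2 * t) * (1 - 1 / r) = 2 * (r - 1 / 2)\<^sup>2 - 1 / 2"
    using r by (simp add: power2_eq_square field_simps)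
  moreover have "(2 * t) * ln r = t * ln t" using r by (simp add: ln_mult)
  moreover have "0 \<le> 2 * (r - 1 / 2)\<^sup>2" by simp
  ultimately show ?thesis by linarith
qed simp

text \<open>From t = 3 on, ln t >= 1 and the left side is at most 6 t ln t. Below 3 it is at most
  16, while the right side is at least 32 / 2; this fixes the constant.\<close>

lemma depth_growth:
  fixes t :: real
  assumes "0 \<le> t"
  shows "(1 + ln (1 + t)) * (1 + t) \<le> 32 * (1 + t * ln t)"
proof (cases "t \<ge> 3")
  case True
  have "1 \<le> ln (3::real)" using exp_le by (subst ln_ge_iff) auto
  then have l: "1 \<le> ln t" using True ln_mono[of 3 t] by linarith
  have "ln (1 + t) \<le> ln (2 * t)" using True by (intro ln_mono) auto
  also have "\<dots> = ln 2 + ln t" using True by (simp add: ln_mult)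
  finally have "1 + ln (1 + t) \<le> 3 * ln t" using ln_2_less_1 l by linarith
  then have "(1 + ln (1 + t)) * (1 + t) \<le> (3 * ln t) * (2 * t)"
    using True l by (intro mult_mono) auto
  also have "\<dots> \<le> 32 * (1 + t * ln t)"
  proof -
    have "0 \<le> t * ln t" using True l by simp
    then show ?thesis by (simp add: algebra_simps)
  qed
  finally show ?thesis .
next
  case False
  have "ln (1 + t) \<le> t" using assms ln_add_one_self_le_self by blast
  then have "(1 + ln (1 + t)) * (1 + t) \<le> 4 * 4" using False assms by (intro mult_mono) auto
  also have "4 * 4 \<le> 32 * (1 + t * ln t)" using one_plus_t_ln_t_ge[OF assms] by simp
  finally show ?thesis .
qed

lemma power_one_plus_le:
  fixes t :: real
  assumes "0 \<le> t"
  shows "(1 + t) ^ r \<le> 2 ^ r * (1 + t ^ r)"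
proof -
  have "(1 + t) ^ r \<le> (2 * max 1 t) ^ r" using assms by (intro power_mono) auto
  also have "\<dots> = 2 ^ r * max 1 t ^ r" by (simp add: power_mult_distrib)
  also have "\<dots> \<le> 2 ^ r * (1 + t ^ r)" using assms by (intro mult_left_mono) (auto simp: max_def)
  finally show ?thesis .
qed

lemma le_exp_self: "x \<le> exp (x::real)"
  using exp_ge_add_one_self[of x] by linarith

text \<open>Each factor of the numerator is at most exp of a constant times u = 1 + t, and these
  constants are the summands of the bracket in the hypothesis on m. In the first one, 4 a1 collects
  2 a1 from (n+1)^2 and 2 a1 from (2e)^n, and 2 comes from 3 <= e^2. The outer factor 2 is due to
  2^m >= exp(m/2), and the summand 1 leaves exp(-u) over.\<close>

lemma accuracy_bound:
  fixes t a1 C_v b_v C_c ell :: real and n k m d :: nat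
  assumes t: "0 \<le> t" and pos: "0 < C_v" "0 < b_v" "0 < C_c" "0 < ell" "1 \<le> a1" and d: "d \<le> 3"
    and n: "real n + 1 \<le> a1 * (1 + t)" and k: "2 ^ k \<le> 2 * (real n + 1)"
    and m: "2 * (2 * (4 * a1 + C_v + b_v + 2) + (2 + 2 * a1) + (C_c + 7) + 114 * (1 + ell) ^ 3 + 1) * (1 + t) \<le> real m"
  shows "(1 + 2 * (real n + 1)\<^sup>2 * (C_v * exp (b_v * t) * (2 * exp 1) ^ n))\<^sup>2 * (4 ^ k / 2 ^ m)
    * (1 + C_c * (1 + t ^ (2 * d))) * (114 * (1 + ell) ^ 3) \<le> exp (- t)"
proof -
  define u where "u = 1 + t"
  have u: "1 \<le> u" using t by (simp add: u_def)
  have two: "(2::real) \<le> exp 1" using exp_ge_add_one_self[of "1::real"] by simp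
  have e_mono: "exp (x * u) \<le> exp (y * u)" if "x \<le> y" for x y using that u by simp
  have n1: "real n + 1 \<le> exp (a1 * u)" using n le_exp_self[of "a1 * u"] unfolding u_def by linarith
  have W: "(2 * exp 1) ^ n \<le> exp (2 * a1 * u)"
  proof -
    have "(2 * exp 1) ^ n \<le> (exp 1 * exp (1::real)) ^ n" using two by (intro power_mono mult_right_mono) auto
    also have "\<dots> = exp (2 * real n)" by (simp flip: exp_add add: exp_of_nat_mult[symmetric] mult.commute)
    also have "\<dots> \<le> exp (2 * a1 * u)" using n unfolding u_def by (simp add: mult.assoc)
    finally show ?thesis .
  qed
  have K: "C_v * exp (b_v * t) \<le> exp ((C_v + b_v) * u)"
  proof -
    have "C_v * exp (b_v * t) \<le> exp C_v * exp (b_v * t)" by (intro mult_right_mono le_exp_self) auto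
    also have "\<dots> = exp (C_v + b_v * t)" by (simp add: exp_add)
    also have "\<dots> \<le> exp ((C_v + b_v) * u)" using pos t by (simp add: u_def algebra_simps)
    finally show ?thesis .
  qed
  define \<Lambda> where "\<Lambda> = 1 + 2 * (real n + 1)\<^sup>2 * (C_v * exp (b_v * t) * (2 * exp 1) ^ n)"
  have \<Lambda>0: "0 \<le> \<Lambda>" using pos by (simp add: \<Lambda>_def)
  have "\<Lambda> \<le> exp ((4 * a1 + C_v + b_v + 2) * u)"
  proof -
    have "(real n + 1)\<^sup>2 * (C_v * exp (b_v * t) * (2 * exp 1) ^ n)
        \<le> (exp (a1 * u))\<^sup>2 * (exp ((C_v + b_v) * u) * exp (2 * a1 * u))"
      using n1 W K pos by (intro mult_mono power_mono) auto
    also have "\<dots> = exp ((4 * a1 + C_v + b_v) * u)"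
      by (simp flip: exp_add add: power2_eq_square algebra_simps)
    finally have "\<Lambda> \<le> 1 + 2 * exp ((4 * a1 + C_v + b_v) * u)" by (simp add: \<Lambda>_def)
    also have "\<dots> \<le> 3 * exp ((4 * a1 + C_v + b_v) * u)" using pos u by simp
    also have "\<dots> \<le> exp (2 * u) * exp ((4 * a1 + C_v + b_v) * u)"
    proof (rule mult_right_mono)
      have "(3::real) \<le> exp 2" using exp_ge_add_one_self[of "2::real"] by simp
      also have "\<dots> \<le> exp (2 * u)" using u by simp
      finally show "3 \<le> exp (2 * u)" .
    qed simp
    also have "\<dots> = exp ((4 * a1 + C_v + b_v + 2) * u)" by (simp flip: exp_add add: algebra_simps)
    finally show ?thesis .
  qed
  then have L2: "\<Lambda>\<^sup>2 \<le> exp (2 * (4 * a1 + C_v + b_v + 2) * u)"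
    using \<Lambda>0 power_mono[of \<Lambda> "exp ((4 * a1 + C_v + b_v + 2) * u)" 2]
    by (simp flip: exp_add add: power2_eq_square algebra_simps)
  have k4: "(4::real) ^ k \<le> exp ((2 + 2 * a1) * u)"
  proof -
    have "(4::real) ^ k = (2 ^ k)\<^sup>2" by (simp add: power2_eq_square flip: power_mult_distrib)
    also have "\<dots> \<le> (exp 1 * exp (a1 * u))\<^sup>2"
      using k n1 two by (intro power_mono order_trans[OF k] mult_mono) auto
    also have "\<dots> = exp (2 + 2 * a1 * u)" by (simp flip: exp_add add: power2_eq_square algebra_simps)
    also have "\<dots> \<le> exp ((2 + 2 * a1) * u)" using u by (simp add: algebra_simps)
    finally show ?thesis .
  qed
  have X: "1 + C_c * (1 + t ^ (2 * d)) \<le> exp ((C_c + 7) * u)"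
  proof -
    have "t ^ (2 * d) \<le> u ^ (2 * d)" using t by (intro power_mono) (auto simp: u_def)
    also have "\<dots> \<le> u ^ 6" using u d by (intro power_increasing) auto
    also have "\<dots> \<le> exp u ^ 6" using u le_exp_self by (intro power_mono) auto
    also have "\<dots> = exp (6 * u)" using exp_of_nat_mult[of 6 u] by simp
    finally have "1 + t ^ (2 * d) \<le> 2 * exp (6 * u)" using one_le_exp_iff[of "6 * u"] u by linarith
    also have "\<dots> \<le> exp u * exp (6 * u)"
    proof (rule mult_right_mono)
      have "exp (1::real) \<le> exp u" using u by simp
      then show "2 \<le> exp u" using two by linarith
    qed simp
    also have "\<dots> = exp (7 * u)" by (simp flip: exp_add)
    finally have "1 + C_c * (1 + t ^ (2 * d)) \<le> 1 + C_c * exp (7 * u)" using pos by simp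
    also have "\<dots> \<le> (1 + C_c) * exp (7 * u)" using u by (simp add: algebra_simps)
    also have "\<dots> \<le> exp (C_c * u) * exp (7 * u)"
    proof (rule mult_right_mono)
      have "exp C_c \<le> exp (C_c * u)" using u pos by simp
      then show "1 + C_c \<le> exp (C_c * u)" using exp_ge_add_one_self[of C_c] by linarith
    qed simp
    also have "\<dots> = exp ((C_c + 7) * u)" by (simp flip: exp_add add: algebra_simps)
    finally show ?thesis .
  qed
  have ell: "114 * (1 + ell) ^ 3 \<le> exp (114 * (1 + ell) ^ 3 * u)"
  proof -
    have "114 * (1 + ell) ^ 3 \<le> exp (114 * (1 + ell) ^ 3)" by (rule le_exp_self)
    also have "\<dots> \<le> exp (114 * (1 + ell) ^ 3 * u)" using u pos by simp
    finally show ?thesis .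
  qed
  define b where "b = 2 * (4 * a1 + C_v + b_v + 2) + (2 + 2 * a1) + (C_c + 7) + 114 * (1 + ell) ^ 3"
  have "\<Lambda>\<^sup>2 * 4 ^ k * (1 + C_c * (1 + t ^ (2 * d))) * (114 * (1 + ell) ^ 3)
      \<le> exp (2 * (4 * a1 + C_v + b_v + 2) * u) * exp ((2 + 2 * a1) * u) * exp ((C_c + 7) * u) * exp (114 * (1 + ell) ^ 3 * u)"
    using L2 k4 X ell pos t by (intro mult_mono) auto
  also have "\<dots> = exp (b * u)" by (simp flip: exp_add add: b_def algebra_simps)
  finally have num: "\<Lambda>\<^sup>2 * 4 ^ k * (1 + C_c * (1 + t ^ (2 * d))) * (114 * (1 + ell) ^ 3) \<le> exp (b * u)" .
  have "exp (b * u + u) \<le> exp (real m / 2)"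
    using m unfolding b_def u_def by (simp add: algebra_simps)
  also have "\<dots> \<le> 2 ^ m"
  proof -
    have "exp (1 / 2) ^ 2 = exp (1::real)" by (simp flip: exp_add add: power2_eq_square)
    then have "exp (1 / 2) ^ 2 \<le> (2::real) ^ 2" using exp_le by simp
    then have "exp (1 / 2) \<le> (2::real)" by (rule power2_le_imp_le) simp
    then have "exp (1 / 2) ^ m \<le> (2::real) ^ m" by (intro power_mono) auto
    moreover have "exp (real m / 2) = exp (1 / 2) ^ m" using exp_of_nat_mult[of m "1 / 2 :: real"] by simp
    ultimately show ?thesis by simp
  qed
  finally have den: "exp (b * u + u) \<le> 2 ^ m" .
  have "\<Lambda>\<^sup>2 * (4 ^ k / 2 ^ m) * (1 + C_c * (1 + t ^ (2 * d))) * (114 * (1 + ell) ^ 3)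
      = \<Lambda>\<^sup>2 * 4 ^ k * (1 + C_c * (1 + t ^ (2 * d))) * (114 * (1 + ell) ^ 3) / 2 ^ m" by simp
  also have "\<dots> \<le> exp (b * u) / exp (b * u + u)" using num den by (intro frac_le) auto
  also have "\<dots> = exp (- u)" by (simp add: exp_add exp_minus field_simps)
  also have "\<dots> \<le> exp (- t)" by (simp add: u_def)
  finally show ?thesis unfolding \<Lambda>_def .
qed

text \<open>The univariate networks give u^2 from N, u^2 from n + 1 and 2^k, and u from m, that is
  u^5, which is at most u^(2d+1) because d >= 2. The products give u^(2d) from N^d and u from m. The
  constant 1500 is 3 * 250 * 2.\<close>

lemma size_bound:
  fixes t C_N a1 b1 :: real and N n k m d :: nat
  assumes t: "0 \<le> t" and d: "2 \<le> d" "d \<le> 3" and pos: "0 < C_N" "0 < a1" "0 < b1"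
    and N: "real N \<le> C_N * (1 + t\<^sup>2)" and n: "real n + 1 \<le> a1 * (1 + t)"
    and k: "2 ^ k \<le> 2 * (real n + 1)" and m: "real m + 1 \<le> b1 * (1 + t)"
  shows "real (N * d * (250 * (n + 1) * 2 ^ k * (m + 1)) + N ^ d * (274 * (m + 1)) + 3)
    \<le> (1500 * C_N * a1\<^sup>2 * b1 + 274 * C_N ^ d * b1 + 3) * 2 ^ (2 * d + 1) * (1 + t ^ (2 * d + 1))"
proof -
  define u where "u = 1 + t"
  have u: "1 \<le> u" using t by (simp add: u_def)
  have "1 + t\<^sup>2 \<le> u\<^sup>2" using t by (simp add: u_def power2_sum)
  then have N': "real N \<le> C_N * u\<^sup>2" using N pos by (meson less_imp_le mult_left_mono order_trans)
  have k': "2 ^ k \<le> 2 * (a1 * u)"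
    using order_trans[OF k mult_left_mono[OF n, of 2]] by (simp add: u_def)
  have "real N * real d * (250 * (real n + 1) * 2 ^ k * (real m + 1))
      \<le> (C_N * u\<^sup>2) * 3 * (250 * (a1 * u) * (2 * (a1 * u)) * (b1 * u))"
    using N' k' n m d pos u unfolding u_def[symmetric] by (intro mult_mono) auto
  also have "\<dots> = 1500 * C_N * a1\<^sup>2 * b1 * u ^ 5" by (simp add: power2_eq_square eval_nat_numeral)
  also have "\<dots> \<le> 1500 * C_N * a1\<^sup>2 * b1 * u ^ (2 * d + 1)"
    using pos u d by (intro mult_left_mono power_increasing) auto
  finally have s1: "real N * real d * (250 * (real n + 1) * 2 ^ k * (real m + 1)) \<le> 1500 * C_N * a1\<^sup>2 * b1 * u ^ (2 * d + 1)" .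
  have "real N ^ d * (274 * (real m + 1)) \<le> (C_N * u\<^sup>2) ^ d * (274 * (b1 * u))"
    using N' m pos u unfolding u_def[symmetric] by (intro mult_mono power_mono) auto
  also have "\<dots> = 274 * C_N ^ d * b1 * u ^ (2 * d + 1)"
    by (simp add: power_mult_distrib power_mult)
  finally have s2: "real N ^ d * (274 * (real m + 1)) \<le> 274 * C_N ^ d * b1 * u ^ (2 * d + 1)" .
  have one: "1 \<le> u ^ (2 * d + 1)" using u by (rule one_le_power)
  have eq: "real (N * d * (250 * (n + 1) * 2 ^ k * (m + 1)) + N ^ d * (274 * (m + 1)) + 3) =
      real N * real d * (250 * (real n + 1) * 2 ^ k * (real m + 1)) + real N ^ d * (274 * (real m + 1)) + 3"
    by (simp add: algebra_simps)
  have "real (N * d * (250 * (n + 1) * 2 ^ k * (m + 1)) + N ^ d * (274 * (m + 1)) + 3)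
      \<le> (1500 * C_N * a1\<^sup>2 * b1 + 274 * C_N ^ d * b1 + 3) * u ^ (2 * d + 1)"
    unfolding eq distrib_right using s1 s2 one by linarith
  also have "\<dots> \<le> (1500 * C_N * a1\<^sup>2 * b1 + 274 * C_N ^ d * b1 + 3) * (2 ^ (2 * d + 1) * (1 + t ^ (2 * d + 1)))"
    unfolding u_def using pos t by (intro mult_left_mono power_one_plus_le) auto
  finally show ?thesis by (simp only: mult.assoc)
qed

text \<open>Since ln 2 >= 1/2, the number of tree levels is at most 2 ln(2 a1 u); this is the
  logarithmic factor, while m supplies the linear one.\<close>

lemma depth_bound:
  fixes t a1 b2 :: real and n k m :: nat
  assumes t: "0 \<le> t" and pos: "1 \<le> a1" "0 < b2" and n: "real n + 1 \<le> a1 * (1 + t)"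
    and k: "2 ^ k \<le> 2 * (real n + 1)" and m: "real m + 3 \<le> b2 * (1 + t)"
  shows "real ((k + 2) * (m + 3) + 4) \<le> ((2 * ln (2 * a1) + 2) * b2 + 4) * 32 * (1 + t * ln t)"
proof -
  define u where "u = 1 + t"
  have u: "1 \<le> u" using t by (simp add: u_def)
  have lnu: "0 \<le> ln u" using u by simp
  have lna: "0 \<le> ln (2 * a1)" using pos by simp
  have "2 ^ k \<le> 2 * a1 * u"
    using order_trans[OF k mult_left_mono[OF n, of 2]] by (simp add: u_def mult.assoc)
  then have "ln (2 ^ k) \<le> ln (2 * a1 * u)" using pos u by (intro ln_mono) auto
  then have "real k * ln 2 \<le> ln (2 * a1) + ln u" using pos u by (simp add: ln_realpow ln_mult)
  moreover have "real k * (1 / 2) \<le> real k * ln 2" 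
  proof (rule mult_left_mono)
    have "ln (1 / 2 :: real) \<le> 1 / 2 - 1" by (rule ln_le_minus_one) simp
    then show "1 / 2 \<le> ln (2 :: real)" by (simp add: ln_div)
  qed simp
  ultimately have "real k + 2 \<le> 2 * ln (2 * a1) + 2 * ln u + 2" by linarith
  also have "\<dots> \<le> (2 * ln (2 * a1) + 2) * (1 + ln u)" using lna lnu by (simp add: algebra_simps)
  finally have k': "real k + 2 \<le> (2 * ln (2 * a1) + 2) * (1 + ln u)" .
  have "(real k + 2) * (real m + 3) \<le> ((2 * ln (2 * a1) + 2) * (1 + ln u)) * (b2 * u)"
    using k' m lna lnu unfolding u_def[symmetric] by (intro mult_mono) auto
  also have "\<dots> = (2 * ln (2 * a1) + 2) * b2 * ((1 + ln u) * u)" by simp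
  finally have "(real k + 2) * (real m + 3) \<le> (2 * ln (2 * a1) + 2) * b2 * ((1 + ln u) * u)" .
  moreover have "1 * 1 \<le> (1 + ln u) * u" using u lnu by (intro mult_mono) auto
  ultimately have "real ((k + 2) * (m + 3) + 4) \<le> ((2 * ln (2 * a1) + 2) * b2 + 4) * ((1 + ln u) * u)"
    by (simp add: distrib_right add.commute)
  also have "\<dots> \<le> ((2 * ln (2 * a1) + 2) * b2 + 4) * (32 * (1 + t * ln t))"
    unfolding u_def using lna pos depth_growth[OF t] by (intro mult_left_mono) auto
  finally show ?thesis by (simp only: mult.assoc)
qed

section \<open>The approximation theorem\<close>

text \<open>The number 114 is chosen so that 24^2 + 3 * 64^2 = 12864 is at most 114^2 = 12996. The
  exponent 4 of 1 + ell covers both powers of ell, as d <= 3.\<close>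

lemma H1_constants:
  fixes ell Z Y :: real and d :: nat
  assumes "0 \<le> ell" "1 \<le> d" "d \<le> 3" "0 \<le> Y" "Y \<le> Z"
  shows "(24 * Y)\<^sup>2 * ell ^ d + real d * ((64 * Z)\<^sup>2 * ell ^ (d - 1)) \<le> (Z * (114 * (1 + ell)\<^sup>2))\<^sup>2"
proof -
  have pw: "ell ^ i \<le> (1 + ell) ^ 4" if "i \<le> 4" for i
  proof -
    have "ell ^ i \<le> (1 + ell) ^ i" using assms(1) by (intro power_mono) auto
    also have "\<dots> \<le> (1 + ell) ^ 4" using assms(1) that by (intro power_increasing) auto
    finally show ?thesis .
  qed
  have "(24 * Y)\<^sup>2 * ell ^ d \<le> (24 * Z)\<^sup>2 * (1 + ell) ^ 4"
    using assms pw[of d] by (intro mult_mono power_mono) auto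
  moreover have "real d * ((64 * Z)\<^sup>2 * ell ^ (d - 1)) \<le> 3 * ((64 * Z)\<^sup>2 * (1 + ell) ^ 4)"
    using assms pw[of "d - 1"] by (intro mult_mono) auto
  moreover have "(24 * Z)\<^sup>2 * (1 + ell) ^ 4 + 3 * ((64 * Z)\<^sup>2 * (1 + ell) ^ 4) = 12864 * (Z\<^sup>2 * (1 + ell) ^ 4)"
    by (simp add: power_mult_distrib)
  moreover have "(Z * (114 * (1 + ell)\<^sup>2))\<^sup>2 = 12996 * (Z\<^sup>2 * (1 + ell) ^ 4)"
    by (simp add: power_mult_distrib flip: power_mult)
  moreover have "0 \<le> Z\<^sup>2 * (1 + ell) ^ 4" using assms(1) by simp
  ultimately show ?thesis by linarith
qed

lemma measure_cube:
  assumes "a \<le> b"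
  shows "measure lebesgue (cube a b :: 'a::euclidean_space set) = (b - a) ^ DIM('a)"
  unfolding cube_eq_box using assms by (simp add: measure_completion measure_lborel_box_eq inner_diff_left)

lemma tensor_net_bound:
  fixes x :: "'a::euclidean_space"
  assumes "\<And>i y. i \<in> {1..N} \<Longrightarrow> \<bar>W i y\<bar> \<le> 2"
  shows "\<bar>tensor_net m N c W x\<bar> \<le> 2 ^ DIM('a) * coeff_l1 N c"
proof -
  have "\<bar>tensor_net m N c W x\<bar> \<le> (\<Sum>\<kappa>\<in>Basis \<rightarrow>\<^sub>E {1..N}. (\<bar>c \<kappa>\<bar> * 2 ^ DIM('a)) * 1)"
    unfolding tensor_net_def
  proof (intro order_trans[OF sum_abs] sum_mono abs_mult_le)
    fix \<kappa> :: "'a \<Rightarrow> nat" assume \<kappa>: "\<kappa> \<in> Basis \<rightarrow>\<^sub>E {1..N}"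
    show "\<bar>prod_tree m 2 (tensor_in W \<kappa> x)\<bar> \<le> 1"
    proof (rule prod_tree_range)
      fix i :: nat
      have "coord_enum i \<in> (Basis :: 'a set)" if "i < DIM('a)" using coord_enum_bij that by (auto simp: bij_betw_def)
      then have "\<kappa> (coord_enum i) \<in> {1..N}" if "i < DIM('a)" using PiE_mem[OF \<kappa>] that by blast
      then show "\<bar>tensor_in W \<kappa> x i\<bar> \<le> 1" using assms by (auto simp: tensor_in_def)
    qed
  qed auto
  also have "\<dots> = 2 ^ DIM('a) * coeff_l1 N c" by (simp add: coeff_l1_def sum_distrib_left mult.commute)
  finally show ?thesis .
qed

text \<open>The left side of the accuracy hypothesis is
  \<open>\<eta> * \<Lambda> * X * (114 * (1 + ell)\<^sup>2)\<close> with the univariate error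
  \<open>\<eta> = \<Lambda> * (1 + ell) * \<delta>\<close> inserted; this explains the square of
  \<open>\<Lambda>\<close> and the third power of 1 + ell.\<close>

lemma tensor_approximation:
  fixes c :: "('a::euclidean_space \<Rightarrow> nat) \<Rightarrow> real" and v :: "nat \<Rightarrow> real \<Rightarrow> real"
  assumes dim: "DIM('a) \<le> 3" and ell: "b - a = ell" "0 < ell" and part: "interval_partition a b N_int G"
    and v: "\<And>i. i \<in> {1..N} \<Longrightarrow> piecewise_poly p G (v i) \<and> in_H1 {a<..<b} (v i) \<and>
        local_support {a<..<b} G (v i) \<and> H1_norm {a<..<b} (v i) \<le> K \<and> Linf_le {a<..<b} (v i) 1"
    and K: "0 < K" and k: "2 \<le> k" "p + 1 < 2 ^ k" and X: "coeff_l1 N c \<le> X" "1 \<le> X"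
    and acc: "(1 + 2 * (real (p + 1) + 1)\<^sup>2 * (K * (2 * exp 1) ^ (p + 1)))\<^sup>2 * (4 ^ k / 2 ^ m) * X * (114 * (1 + ell) ^ 3) \<le> \<epsilon>"
    and \<epsilon>: "\<epsilon> \<le> 1"
  shows "\<exists>\<Phi>. nn_wf DIM('a) 1 \<Phi> \<and> nn_depth \<Phi> = (k + 2) * (m + 3) + 4 \<and>
    nn_size \<Phi> \<le> N * DIM('a) * (250 * (p + 1 + 1) * 2 ^ k * (m + 1)) + N ^ DIM('a) * (274 * (m + 1)) + 3 \<and>
    in_H1 (cube a b) (\<lambda>x. tensor_sum N c v x - realize \<Phi> x) \<and>
    H1_norm (cube a b) (\<lambda>x. tensor_sum N c v x - realize \<Phi> x) \<le> \<epsilon> \<and>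
    (\<forall>x::'a. \<bar>realize \<Phi> x\<bar> \<le> 2 ^ DIM('a) * coeff_l1 N c)"
proof -
  \<comment> \<open>The nodes i/n need n > 0, whereas p may be 0.\<close>
  define n where "n = p + 1"
  have n: "0 < n" "p \<le> n" by (auto simp: n_def)
  have ab: "a < b" using ell by simp
  define B where "B = K * (2 * exp 1) ^ n"
  define \<Lambda> where "\<Lambda> = 1 + 2 * (real n + 1)\<^sup>2 * B"
  define \<delta> where "\<delta> = 4 ^ k / (2::real) ^ m"
  define \<eta> where "\<eta> = \<Lambda> * (1 + ell) * \<delta>"
  have B: "0 \<le> B" using K by (simp add: B_def)
  have \<Lambda>: "1 \<le> \<Lambda>" using B by (simp add: \<Lambda>_def)
  have \<delta>: "0 \<le> \<delta>" by (simp add: \<delta>_def)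
  have \<eta>: "0 \<le> \<eta>" using \<Lambda> \<delta> ell by (simp add: \<eta>_def)
  have acc': "\<eta> * \<Lambda> * X * (114 * (1 + ell)\<^sup>2) \<le> \<epsilon>"
  proof -
    have "\<eta> * \<Lambda> * X * (114 * (1 + ell)\<^sup>2) = \<Lambda>\<^sup>2 * \<delta> * X * (114 * (1 + ell) ^ 3)"
      by (simp add: \<eta>_def power2_eq_square power3_eq_cube)
    then show ?thesis using acc by (simp add: \<Lambda>_def B_def n_def \<delta>_def)
  qed
  \<comment> \<open>The cofactors of \<open>\<eta>\<close> are at least 1, so the one accuracy
    hypothesis also yields \<open>\<eta>\<close> <= 1, then \<open>\<delta>\<close> <= 1 and with it
    the condition 4^k <= 2^m of the trees.\<close>
  have "1 * 1 * 1 \<le> \<Lambda> * X * (114 * (1 + ell)\<^sup>2)"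
  proof (intro mult_mono)
    have "1 \<le> (1 + ell)\<^sup>2" using ell by (intro one_le_power) simp
    then show "1 \<le> 114 * (1 + ell)\<^sup>2" by linarith
  qed (use \<Lambda> X in auto)
  then have "\<eta> * 1 \<le> \<eta> * (\<Lambda> * X * (114 * (1 + ell)\<^sup>2))" using \<eta> by (intro mult_left_mono) auto
  then have "\<eta> \<le> \<eta> * \<Lambda> * X * (114 * (1 + ell)\<^sup>2)" by (simp add: mult.assoc)
  then have \<eta>1: "\<eta> \<le> 1" using acc' \<epsilon> by linarith
  have "1 * 1 \<le> \<Lambda> * (1 + ell)" using \<Lambda> ell by (intro mult_mono) auto
  then have "\<delta> * 1 \<le> \<delta> * (\<Lambda> * (1 + ell))" using \<delta> by (intro mult_left_mono) auto
  then have \<delta>\<eta>: "\<delta> \<le> \<eta>" by (simp add: \<eta>_def mult.commute)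
  have "16 / (2::real) ^ m \<le> \<delta>"
    unfolding \<delta>_def using power_increasing[OF k(1), of "4::real"] by (intro divide_right_mono) auto
  then have m16: "16 / (2::real) ^ m \<le> \<eta>" using \<delta>\<eta> by linarith
  have "\<delta> \<le> 1" using \<delta>\<eta> \<eta>1 by linarith
  then have mk: "4 ^ k \<le> (2::real) ^ m" by (simp add: \<delta>_def divide_le_eq)
  have nk: "n < 2 ^ k" using k(2) by (simp add: n_def)
  \<comment> \<open>Intervals, constant and coefficients are packed into a triple so that a single
    choice over i suffices.\<close>
  have "\<forall>i\<in>{1..N}. \<exists>z. fst z \<subseteq> G \<and> card (fst z) \<le> 2 \<and>
    (\<forall>J\<in>fst z. \<forall>j\<le>n. \<bar>snd (snd z) J j\<bar> \<le> sqrt (Sup J - Inf J) * K * (2 * exp 1) ^ n) \<and>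
    finite {x \<in> {a<..<b}. v i x \<noteq> pw_interp n (fst (snd z)) (fst z) (snd (snd z)) x} \<and>
    (\<forall>x. \<bar>pw_interp n (fst (snd z)) (fst z) (snd (snd z)) x\<bar> \<le> 1)"
  proof
    fix i assume i: "i \<in> {1..N}"
    have "\<exists>M \<kappa> A. M \<subseteq> G \<and> card M \<le> 2 \<and>
      (\<forall>J\<in>M. \<forall>j\<le>n. \<bar>A J j\<bar> \<le> sqrt (Sup J - Inf J) * K * (2 * exp 1) ^ n) \<and>
      finite {x \<in> {a<..<b}. v i x \<noteq> pw_interp n \<kappa> M A x} \<and> (\<forall>x. \<bar>pw_interp n \<kappa> M A x\<bar> \<le> 1)"
      using v[OF i] K n by (intro one_dim_representation[OF ab part]) auto
    then obtain M \<kappa> A where "M \<subseteq> G \<and> card M \<le> 2 \<and>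
      (\<forall>J\<in>M. \<forall>j\<le>n. \<bar>A J j\<bar> \<le> sqrt (Sup J - Inf J) * K * (2 * exp 1) ^ n) \<and>
      finite {x \<in> {a<..<b}. v i x \<noteq> pw_interp n \<kappa> M A x} \<and> (\<forall>x. \<bar>pw_interp n \<kappa> M A x\<bar> \<le> 1)" by blast
    then show "\<exists>z. fst z \<subseteq> G \<and> card (fst z) \<le> 2 \<and>
      (\<forall>J\<in>fst z. \<forall>j\<le>n. \<bar>snd (snd z) J j\<bar> \<le> sqrt (Sup J - Inf J) * K * (2 * exp 1) ^ n) \<and>
      finite {x \<in> {a<..<b}. v i x \<noteq> pw_interp n (fst (snd z)) (fst z) (snd (snd z)) x} \<and>
      (\<forall>x. \<bar>pw_interp n (fst (snd z)) (fst z) (snd (snd z)) x\<bar> \<le> 1)"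
      by (intro exI[of _ "(M, \<kappa>, A)"]) simp
  qed
  from bchoice[OF this] obtain z where z: "\<forall>i\<in>{1..N}. fst (z i) \<subseteq> G \<and> card (fst (z i)) \<le> 2 \<and>
    (\<forall>J\<in>fst (z i). \<forall>j\<le>n. \<bar>snd (snd (z i)) J j\<bar> \<le> sqrt (Sup J - Inf J) * K * (2 * exp 1) ^ n) \<and>
    finite {x \<in> {a<..<b}. v i x \<noteq> pw_interp n (fst (snd (z i))) (fst (z i)) (snd (snd (z i))) x} \<and>
    (\<forall>x. \<bar>pw_interp n (fst (snd (z i))) (fst (z i)) (snd (snd (z i))) x\<bar> \<le> 1)" ..
  define M \<kappa> A where "M = (\<lambda>i. fst (z i))" and "\<kappa> = (\<lambda>i. fst (snd (z i)))" and "A = (\<lambda>i. snd (snd (z i)))"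
  define V W where "V = (\<lambda>i. pw_interp n (\<kappa> i) (M i) (A i))" and "W = (\<lambda>i. pw_net m k n (\<kappa> i) (M i) (A i))"
  have Vv: "finite {x \<in> {a<..<b}. v i x \<noteq> V i x}" and V1: "\<bar>V i x\<bar> \<le> 1"
    and MG: "M i \<subseteq> G" and Mc: "card (M i) \<le> 2"
    and Ab: "\<And>J j. J \<in> M i \<Longrightarrow> j \<le> n \<Longrightarrow> \<bar>A i J j\<bar> \<le> sqrt (Sup J - Inf J) * B"
    if "i \<in> {1..N}" for i x
    using z[rule_format, OF that] by (auto simp: V_def M_def \<kappa>_def A_def B_def mult.assoc)
  have finG: "finite G" using part by (simp add: interval_partition_def)
  have Mf: "finite (M i) \<and> card (M i) \<le> 2" if "i \<in> {1..N}" for i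
    using MG[OF that] Mc[OF that] finG finite_subset by blast
  have MJ: "Inf J < Sup J \<and> Sup J - Inf J \<le> ell" if "i \<in> {1..N}" "J \<in> M i" for i J
  proof -
    have "J \<in> G" using MG that by blast
    from interval_partition_intervals[OF part this] show ?thesis using ell by linarith
  qed
  have err: "\<bar>V i x - V i y\<bar> \<le> \<Lambda> * gauge_on (M i) x y" "\<bar>W i x - V i x\<bar> \<le> \<eta>"
    "\<bar>(W i x - V i x) - (W i y - V i y)\<bar> \<le> \<eta> * gauge_on (M i) x y" if i: "i \<in> {1..N}" for i x y
    unfolding V_def W_def \<eta>_def \<delta>_def \<Lambda>_def
    by (rule pw_net_error[OF mk nk Mc[OF i] B _ MJ[OF i] Ab[OF i]]; use ell in simp)+
  have W2: "\<bar>W i y\<bar> \<le> 2" if "i \<in> {1..N}" for i y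
    using V1[OF that, of y] err(2)[OF that, of y] \<eta>1 by linarith
  have lqV: "left_diff 1 (V i)" "left_diff 1 (W i)" for i unfolding V_def W_def by (rule left_diff_pw_interp left_diff_pw_net)+
  define w where "w = (\<lambda>x. tensor_sum N c V x - tensor_net m N c W x)"
  have wb: "\<bar>w x\<bar> \<le> 24 * \<eta> * X" "\<exists>Kl. \<forall>e\<in>Basis. \<forall>x h. \<bar>w (x + h *\<^sub>R e) - w x\<bar> \<le> Kl * \<bar>h\<bar>"
    "e \<in> Basis \<Longrightarrow> left_diff e w"
    "e \<in> Basis \<Longrightarrow> (LINT x:cube a b|lebesgue. (lim (left_quot e w x))\<^sup>2) \<le> (64 * \<eta> * \<Lambda> * X)\<^sup>2 * (b - a) ^ (DIM('a) - 1)" for x e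
    unfolding w_def
    by (rule tensor_sum_error[where M = M and \<Lambda> = \<Lambda> and \<eta> = \<eta> and X = X, OF dim ab Mf _ \<Lambda> \<eta> \<eta>1 m16 V1 err lqV(1) lqV(2) X(1)]; use MJ in blast)+
  obtain Kl where Kl: "\<And>e x h. e \<in> Basis \<Longrightarrow> \<bar>w (x + h *\<^sub>R e) - w x\<bar> \<le> Kl * \<bar>h\<bar>" using wb(2) by blast
  have "\<exists>\<Phi>. nn_wf DIM('a) 1 \<Phi> \<and> nn_depth \<Phi> = (k + 2) * (m + 3) + 4 \<and>
    nn_size \<Phi> \<le> N * DIM('a) * (250 * (n + 1) * 2 ^ k * (m + 1)) + N ^ DIM('a) * (274 * (m + 1)) + 3 \<and>
    (realize \<Phi> :: 'a \<Rightarrow> real) = tensor_net m N c W"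
    unfolding W_def by (rule tensor_net_realization[OF dim]; use Mf W2 in \<open>simp add: W_def\<close>)
  then obtain \<Phi> where \<Phi>: "nn_wf DIM('a) 1 \<Phi>" "nn_depth \<Phi> = (k + 2) * (m + 3) + 4"
    "nn_size \<Phi> \<le> N * DIM('a) * (250 * (n + 1) * 2 ^ k * (m + 1)) + N ^ DIM('a) * (274 * (m + 1)) + 3"
    "(realize \<Phi> :: 'a \<Rightarrow> real) = tensor_net m N c W"
    by blast
  define Z where "Z = (\<Union>i\<in>{1..N}. {x \<in> {a<..<b}. v i x \<noteq> V i x})"
  have "finite Z" unfolding Z_def using Vv by blast
  from AE_cube_coordinates[OF this, where 'a = 'a]
  have ae: "AE x in lebesgue. x \<in> cube a b \<longrightarrow> w x = tensor_sum N c v x - realize \<Phi> x"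
  proof eventually_elim
    case (elim x)
    have "tensor_sum N c V x = tensor_sum N c v x" if x: "x \<in> cube a b"
      unfolding tensor_sum_def
    proof (intro sum.cong refl arg_cong2[of _ _ _ _ "(*)"] prod.cong)
      fix \<kappa>' :: "'a \<Rightarrow> nat" and j :: 'a assume "\<kappa>' \<in> Basis \<rightarrow>\<^sub>E {1..N}" "j \<in> Basis"
      then have "\<kappa>' j \<in> {1..N}" "x \<bullet> j \<in> {a<..<b}" "x \<bullet> j \<notin> Z"
        using x elim by (auto simp: cube_def)
      then show "V (\<kappa>' j) (x \<bullet> j) = v (\<kappa>' j) (x \<bullet> j)" unfolding Z_def by auto
    qed
    then show ?case by (simp add: w_def \<Phi>(4))
  qed
  have d1: "1 \<le> DIM('a)" by (simp add: Suc_le_eq)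
  have H1: "in_H1 (cube a b) (\<lambda>x. tensor_sum N c v x - realize \<Phi> x)"
    "(H1_norm (cube a b) (\<lambda>x. tensor_sum N c v x - realize \<Phi> x))\<^sup>2 \<le>
      (24 * \<eta> * X)\<^sup>2 * measure lebesgue (cube a b :: 'a set) + real DIM('a) * ((64 * \<eta> * \<Lambda> * X)\<^sup>2 * (b - a) ^ (DIM('a) - 1))"
    unfolding cube_eq_box
    by (rule H1_bound[OF ae[unfolded cube_eq_box] Kl wb(3) wb(1) wb(4)[unfolded cube_eq_box]]; assumption)+
  have "(H1_norm (cube a b) (\<lambda>x. tensor_sum N c v x - realize \<Phi> x))\<^sup>2 \<le>
      (24 * (\<eta> * X))\<^sup>2 * ell ^ DIM('a) + real DIM('a) * ((64 * (\<eta> * \<Lambda> * X))\<^sup>2 * ell ^ (DIM('a) - 1))"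
    using H1(2) measure_cube[of a b, where 'a = 'a] ab ell(1) by (simp add: mult.assoc)
  also have "\<dots> \<le> (\<eta> * \<Lambda> * X * (114 * (1 + ell)\<^sup>2))\<^sup>2"
  proof (rule H1_constants)
    have "\<eta> * X * 1 \<le> \<eta> * X * \<Lambda>" using \<eta> X(2) \<Lambda> by (intro mult_left_mono) auto
    then show "\<eta> * X \<le> \<eta> * \<Lambda> * X" by (simp only: mult_ac)
  qed (use ell d1 dim \<eta> X(2) in auto)
  also have "\<dots> \<le> \<epsilon>\<^sup>2" using acc' \<eta> \<Lambda> X(2) by (intro power_mono) auto
  finally have "H1_norm (cube a b) (\<lambda>x. tensor_sum N c v x - realize \<Phi> x) \<le> \<epsilon>"
  proof (rule power2_le_imp_le)
    show "0 \<le> \<epsilon>" using acc' \<eta> \<Lambda> X(2) by (intro order_trans[OF _ acc']) auto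
  qed
  moreover have Wb: "\<bar>tensor_net m N c W x\<bar> \<le> 2 ^ DIM('a) * coeff_l1 N c" for x :: 'a
    by (rule tensor_net_bound) (rule W2)
  ultimately show ?thesis
    using \<Phi> H1(1) Wb unfolding n_def by (intro exI[of _ \<Phi>]) auto
qed

theorem theorem4p2:
  fixes C_p C_N C_v C_c b_v ell :: real
  assumes dim: "DIM('a::euclidean_space) = 2 \<or> DIM('a) = 3"
    and pos: "C_p > 0" "C_N > 0" "C_v > 0" "C_c > 0" "b_v > 0" "ell > 0"
  shows "\<exists>C>0. \<forall>(a::real) b (\<epsilon>::real) (p::nat) (N::nat) (N_int::nat)
            (c::('a \<Rightarrow> nat) \<Rightarrow> real) (G::real set set) (v::nat \<Rightarrow> real \<Rightarrow> real).
     b - a = ell \<and> 0 < \<epsilon> \<and> \<epsilon> \<le> 1 \<and>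
     real N \<le> C_N * (1 + \<bar>ln \<epsilon>\<bar>^2) \<and>
     coeff_l1 N c \<le> C_c * (1 + \<bar>ln \<epsilon>\<bar>^(2 * DIM('a))) \<and>
     real p \<le> C_p * (1 + \<bar>ln \<epsilon>\<bar>) \<and>
     interval_partition a b N_int G \<and>
     (\<forall>i\<in>{1..N}. piecewise_poly p G (v i) \<and> in_H1 {a<..<b} (v i) \<and>
        local_support {a<..<b} G (v i) \<and>
        H1_norm {a<..<b} (v i) \<le> C_v * \<epsilon> powr (- b_v) \<and>
        Linf_le {a<..<b} (v i) 1)
     \<longrightarrow>
     (\<exists>\<Phi>. nn_wf DIM('a) 1 \<Phi> \<and>
        (let Q = {x::'a. \<forall>j\<in>Basis. x \<bullet> j \<in> {a<..<b}};
             w = (\<lambda>x. tensor_sum N c v x - realize \<Phi> x) in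
          in_H1 Q w \<and> H1_norm Q w \<le> \<epsilon> \<and>
          Linf_le Q (realize \<Phi>) ((2 ^ DIM('a) + 1) * C_c * (1 + \<bar>ln \<epsilon>\<bar>^(2 * DIM('a)))) \<and>
          real (nn_size \<Phi>) \<le> C * (1 + \<bar>ln \<epsilon>\<bar>^(2 * DIM('a) + 1)) \<and>
          real (nn_depth \<Phi>) \<le> C * (1 + \<bar>ln \<epsilon>\<bar> * ln \<bar>ln \<epsilon>\<bar>)))"
proof -
  define d where "d = DIM('a)"
  have d: "2 \<le> d" "d \<le> 3" using dim by (auto simp: d_def)
  \<comment> \<open>The 2 covers the two units in n + 1 = p + 2.\<close>
  define a1 where "a1 = C_p + 2"
  define b0 where "b0 = 2 * (2 * (4 * a1 + C_v + b_v + 2) + (2 + 2 * a1) + (C_c + 7) + 114 * (1 + ell) ^ 3 + 1)"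
  have a1: "1 \<le> a1" using pos by (simp add: a1_def)
  have b0: "0 < b0" using pos a1 unfolding b0_def by (intro mult_pos_pos add_pos_pos) auto
  define C1 where "C1 = (1500 * C_N * a1\<^sup>2 * (b0 + 2) + 274 * C_N ^ d * (b0 + 2) + 3) * 2 ^ (2 * d + 1)"
  define C2 where "C2 = ((2 * ln (2 * a1) + 2) * (b0 + 4) + 4) * 32"
  have C1: "0 < C1" using pos b0 unfolding C1_def by (intro mult_pos_pos add_nonneg_pos) auto
  have C2: "0 < C2" using a1 b0 unfolding C2_def by (intro mult_pos_pos add_nonneg_pos) auto
  show ?thesis
  \<comment> \<open>C1 serves the size and C2 the depth; the sum bounds both since the growth
    functions are nonnegative, for the depth by the lower bound 1/2.\<close>
  proof (intro exI[of _ "C1 + C2"] conjI allI impI, goal_cases)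
    case 1
    show ?case using C1 C2 by simp
  next
    case (2 a b \<epsilon> p N N_int c G v)
    then have ab: "b - a = ell" and \<epsilon>: "0 < \<epsilon>" "\<epsilon> \<le> 1" and N: "real N \<le> C_N * (1 + \<bar>ln \<epsilon>\<bar>^2)"
      and c: "coeff_l1 N c \<le> C_c * (1 + \<bar>ln \<epsilon>\<bar>^(2 * DIM('a)))" and p: "real p \<le> C_p * (1 + \<bar>ln \<epsilon>\<bar>)"
      and part: "interval_partition a b N_int G"
      and v: "\<And>i. i \<in> {1..N} \<Longrightarrow> piecewise_poly p G (v i) \<and> in_H1 {a<..<b} (v i) \<and>
        local_support {a<..<b} G (v i) \<and> H1_norm {a<..<b} (v i) \<le> C_v * \<epsilon> powr (- b_v) \<and> Linf_le {a<..<b} (v i) 1"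
      by auto
    define t where "t = \<bar>ln \<epsilon>\<bar>"
    have t: "0 \<le> t" by (simp add: t_def)
    have lnt: "ln \<epsilon> = - t" using \<epsilon> by (simp add: t_def)
    have \<epsilon>t: "\<epsilon> = exp (- t)" using \<epsilon>(1) lnt by (metis exp_ln)
    have K: "C_v * \<epsilon> powr (- b_v) = C_v * exp (b_v * t)" using \<epsilon> lnt by (simp add: powr_def)
    define m where "m = nat \<lceil>b0 * (1 + t)\<rceil>"
    have bt: "0 \<le> b0 * (1 + t)" using b0 t by simp
    have m_ge: "b0 * (1 + t) \<le> real m" unfolding m_def by (rule real_nat_ceiling_ge)
    have m_le: "real m \<le> b0 * (1 + t) + 1"
      unfolding m_def using bt of_int_ceiling_le_add_one[of "b0 * (1 + t)"] by simp
    have shift: "(x + y) * (1 + t) = x * (1 + t) + (y + y * t)" for x y by (simp add: algebra_simps)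
    have le: "x \<le> (z + y) * (1 + t)" if "x \<le> z * (1 + t) + y" "0 \<le> y" for x y z
    proof -
      have "0 \<le> y * t" using that(2) t by simp
      then show ?thesis unfolding shift using that(1) by linarith
    qed
    have m1: "real m + 1 \<le> (b0 + 2) * (1 + t)" by (rule le) (use m_le in simp_all)
    have m3: "real m + 3 \<le> (b0 + 4) * (1 + t)" by (rule le) (use m_le in simp_all)
    have n: "real (p + 1) + 1 \<le> a1 * (1 + t)"
      unfolding a1_def by (rule le) (use p in \<open>simp_all add: t_def\<close>)
    obtain k where k: "2 \<le> k" "p + 1 < 2 ^ k" "2 ^ k \<le> 2 * ((p + 1) + 1)"
      using exists_two_power[of "p + 1"] by auto
    have k': "(2::real) ^ k \<le> 2 * (real (p + 1) + 1)"
    proof -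
      have "real (2 ^ k) \<le> real (2 * ((p + 1) + 1))" using k(3) by (simp only: of_nat_le_iff)
      then show ?thesis by simp
    qed
    \<comment> \<open>The extra 1 gives X >= 1 also when \<open>C_c\<close> is small.\<close>
    define X where "X = 1 + C_c * (1 + t ^ (2 * d))"
    have X: "coeff_l1 N c \<le> X" "1 \<le> X" using c pos t by (auto simp: X_def t_def d_def)
    have acc: "(1 + 2 * (real (p + 1) + 1)\<^sup>2 * (C_v * \<epsilon> powr (- b_v) * (2 * exp 1) ^ (p + 1)))\<^sup>2 * (4 ^ k / 2 ^ m) * X
        * (114 * (1 + ell) ^ 3) \<le> \<epsilon>"
      using accuracy_bound[OF t pos(3,5,4,6) a1 d(2) n k' m_ge[unfolded b0_def]]
      unfolding K X_def \<epsilon>t[symmetric] .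
    have K0: "0 < C_v * \<epsilon> powr (- b_v)" using pos \<epsilon> by simp
    have dim3: "DIM('a) \<le> 3" using d by (simp add: d_def)
    obtain \<Phi> where \<Phi>: "nn_wf DIM('a) 1 \<Phi>" "nn_depth \<Phi> = (k + 2) * (m + 3) + 4"
      "nn_size \<Phi> \<le> N * DIM('a) * (250 * (p + 1 + 1) * 2 ^ k * (m + 1)) + N ^ DIM('a) * (274 * (m + 1)) + 3"
      "in_H1 (cube a b) (\<lambda>x. tensor_sum N c v x - realize \<Phi> x)"
      "H1_norm (cube a b) (\<lambda>x. tensor_sum N c v x - realize \<Phi> x) \<le> \<epsilon>"
      "\<And>x::'a. \<bar>realize \<Phi> x\<bar> \<le> 2 ^ DIM('a) * coeff_l1 N c"
      using tensor_approximation[where v = v, OF dim3 ab pos(6) part v K0 k(1,2) X acc \<epsilon>(2)] by blast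
    have "real (nn_size \<Phi>) \<le> real (N * d * (250 * ((p + 1) + 1) * 2 ^ k * (m + 1)) + N ^ d * (274 * (m + 1)) + 3)"
      using \<Phi>(3) unfolding d_def by (simp only: of_nat_le_iff)
    also have "\<dots> \<le> C1 * (1 + t ^ (2 * d + 1))"
      unfolding C1_def using t d pos a1 b0 N n k' m1 by (intro size_bound) (auto simp: t_def)
    also have "\<dots> \<le> (C1 + C2) * (1 + t ^ (2 * d + 1))" using C2 t by (intro mult_right_mono) auto
    finally have size: "real (nn_size \<Phi>) \<le> (C1 + C2) * (1 + t ^ (2 * d + 1))" .
    have "real (nn_depth \<Phi>) \<le> C2 * (1 + t * ln t)"
      unfolding \<Phi>(2) C2_def by (rule depth_bound[OF t a1 _ n k' m3]) (use b0 in simp)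
    also have "\<dots> \<le> (C1 + C2) * (1 + t * ln t)"
      using C1 one_plus_t_ln_t_ge[OF t] by (intro mult_right_mono) auto
    finally have depth: "real (nn_depth \<Phi>) \<le> (C1 + C2) * (1 + t * ln t)" .
    have "\<bar>realize \<Phi> x\<bar> \<le> (2 ^ DIM('a) + 1) * C_c * (1 + t ^ (2 * DIM('a)))" for x :: 'a
    proof -
      have "0 \<le> C_c * (1 + t ^ (2 * DIM('a)))" using pos t by simp
      moreover have "2 ^ DIM('a) * coeff_l1 N c \<le> 2 ^ DIM('a) * (C_c * (1 + t ^ (2 * DIM('a))))"
        using c by (intro mult_left_mono) (auto simp: t_def)
      ultimately have "2 ^ DIM('a) * coeff_l1 N c \<le> 2 ^ DIM('a) * (C_c * (1 + t ^ (2 * DIM('a)))) + C_c * (1 + t ^ (2 * DIM('a)))"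
        by linarith
      also have "\<dots> = (2 ^ DIM('a) + 1) * C_c * (1 + t ^ (2 * DIM('a)))" by (simp only: distrib_right mult_1 mult.assoc)
      finally show ?thesis using \<Phi>(6)[of x] by linarith
    qed
    then have "Linf_le (cube a b) (realize \<Phi> :: 'a \<Rightarrow> real) ((2 ^ DIM('a) + 1) * C_c * (1 + t ^ (2 * DIM('a))))"
      by (simp add: Linf_le_def)
    then show ?case
      using \<Phi>(1,4,5) size depth unfolding Let_def cube_def t_def d_def by blast
  qed
qed

end
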